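(* Let $n\ge1$ and let $F_n$ be the free group on $n$ generators. Then a semidirect product $F_n\rtimes\mathbb{Z}$ (with respect to any homomorphism $\mathbb{Z}\to Aut(F_n)$) is quasi-isometric to $F_n\times\mathbb{Z}$ if and only if it is virtually $F_n\times\mathbb{Z}$.
   Context: Finitely generated groups are quasi-isometric if their Cayley graphs with respect to finite generating sets are quasi-isometric metric spaces. A group is virtually $F_n\times\mathbb{Z}$ if it has a finite-index subgroup isomorphic to $F_n\times\mathbb{Z}$. *)

theory Defs
  imports
    "HOL-Algebra.Bij"
    "HOL-Algebra.Elementary_Groups"
    "HOL-Algebra.Generated_Groups"
    "HOL-Analysis.Abstract_Metric_Spaces"
begin

section \<open>Free groups\<close>

text \<open>
  A letter \<open>(x, True)\<close> stands for the generator \<open>x\<close> and \<open>(x, False)\<close> for its inverse.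
  Elements of the free group on \<open>X\<close> are the reduced words over these letters.
\<close>

definition inv_letter :: "'a \<times> bool \<Rightarrow> 'a \<times> bool"
  where "inv_letter l = (fst l, \<not> snd l)"

definition reduced :: "('a \<times> bool) list \<Rightarrow> bool"
  where "reduced w \<longleftrightarrow> successively (\<lambda>k l. l \<noteq> inv_letter k) w"

fun cancel_Cons :: "'a \<times> bool \<Rightarrow> ('a \<times> bool) list \<Rightarrow> ('a \<times> bool) list" where
  "cancel_Cons k [] = [k]"
| "cancel_Cons k (l # w) = (if l = inv_letter k then w else k # l # w)"

definition free_group :: "'a set \<Rightarrow> ('a \<times> bool) list monoid" where
  "free_group X =
     \<lparr>carrier = {w. reduced w \<and> fst ` set w \<subseteq> X},
      monoid.mult = (\<lambda>u v. foldr cancel_Cons u v),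
      one = []\<rparr>"

lemma inv_letter_inv_letter [simp]: "inv_letter (inv_letter k) = k"
  by (simp add: inv_letter_def)

lemma fst_inv_letter [simp]: "fst (inv_letter k) = fst k"
  by (simp add: inv_letter_def)

lemma reduced_Nil [simp]: "reduced []"
  by (simp add: reduced_def)

lemma reduced_Cons: "reduced (k # w) \<longleftrightarrow> (w = [] \<or> hd w \<noteq> inv_letter k) \<and> reduced w"
  by (auto simp: reduced_def successively_Cons)

lemma reduced_cancel_Cons: "reduced w \<Longrightarrow> reduced (cancel_Cons k w)"
  by (cases w) (auto simp: reduced_Cons)

lemma reduced_mult: "reduced v \<Longrightarrow> reduced (foldr cancel_Cons u v)"
  by (induction u) (auto intro: reduced_cancel_Cons)

lemma cancel_Cons_cancel_Cons_inv:
  "reduced w \<Longrightarrow> cancel_Cons k (cancel_Cons (inv_letter k) w) = w"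
  by (cases w) (auto simp: reduced_Cons, case_tac list, auto)

lemma set_cancel_Cons: "set (cancel_Cons k w) \<subseteq> insert k (set w)"
  by (cases w) auto

lemma set_mult: "set (foldr cancel_Cons u v) \<subseteq> set u \<union> set v"
  by (induction u) (use set_cancel_Cons in fastforce)+

lemma foldr_cancel_Cons:
  assumes "reduced w"
  shows "foldr cancel_Cons (cancel_Cons k v) w = cancel_Cons k (foldr cancel_Cons v w)"
proof (cases v)
  case (Cons l v')
  then show ?thesis
    using cancel_Cons_cancel_Cons_inv [OF reduced_mult [OF assms]] by auto
qed simp

lemma mult_assoc_words:
  "reduced w \<Longrightarrow>
    foldr cancel_Cons (foldr cancel_Cons u v) w = foldr cancel_Cons u (foldr cancel_Cons v w)"
  by (induction u) (auto simp: foldr_cancel_Cons)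

lemma mult_Nil_right: "reduced w \<Longrightarrow> foldr cancel_Cons w [] = w"
proof (induction w)
  case (Cons k w)
  then show ?case by (cases w) (auto simp: reduced_Cons)
qed simp

lemma mult_inverse_word:
  "reduced v \<Longrightarrow> foldr cancel_Cons (map inv_letter (rev u)) (foldr cancel_Cons u v) = v"
proof (induction u arbitrary: v)
  case (Cons k u)
  show ?case
    using Cons cancel_Cons_cancel_Cons_inv [of "foldr cancel_Cons u v" "inv_letter k"]
    by (simp add: reduced_mult)
qed simp

theorem group_free_group: "group (free_group X)"
proof (rule groupI)
  fix u assume u: "u \<in> carrier (free_group X)"
  let ?v = "foldr cancel_Cons (map inv_letter (rev u)) []"
  have "set ?v \<subseteq> set (map inv_letter (rev u))"
    using set_mult [of "map inv_letter (rev u)" "[]"] by simp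
  then have "fst ` set ?v \<subseteq> fst ` set (map inv_letter (rev u))"
    by (rule image_mono)
  then have "?v \<in> carrier (free_group X)"
    using u by (auto simp: free_group_def reduced_mult image_image)
  moreover have "foldr cancel_Cons ?v u = []"
    using u mult_inverse_word [of "[]" u]
    by (auto simp: free_group_def mult_assoc_words mult_Nil_right)
  ultimately show "\<exists>v\<in>carrier (free_group X). v \<otimes>\<^bsub>free_group X\<^esub> u = \<one>\<^bsub>free_group X\<^esub>"
    by (auto simp: free_group_def)
next
  fix u v assume "u \<in> carrier (free_group X)" "v \<in> carrier (free_group X)"
  then show "u \<otimes>\<^bsub>free_group X\<^esub> v \<in> carrier (free_group X)"
    using set_mult [of u v] by (fastforce simp: free_group_def reduced_mult)
qed (auto simp: free_group_def mult_assoc_words)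

theorem free_group_universal:
  fixes H (structure)
  assumes "group H" and f: "f \<in> X \<rightarrow> carrier H"
  shows "\<exists>!h \<in> extensional (carrier (free_group X)).
           h \<in> hom (free_group X) H \<and> (\<forall>x\<in>X. h [(x, True)] = f x)"
proof -
  interpret H: group H by fact
  interpret F: group "free_group X" by (rule group_free_group)
  define g where "g l = (if snd l then f (fst l) else inv (f (fst l)))" for l
  define ev where "ev w = foldr (\<lambda>l a. g l \<otimes> a) w \<one>" for w
  have ev_simps: "ev [] = \<one>" "ev (l # w) = g l \<otimes> ev w" for l w
    by (simp_all add: ev_def)
  have gC: "g l \<in> carrier H" if "fst l \<in> X" for l
    using f that by (auto simp: g_def)
  have evC: "ev w \<in> carrier H" if "fst ` set w \<subseteq> X" for w
    using that by (induction w) (auto simp: ev_simps gC)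
  have g_inv: "g (inv_letter l) = inv (g l)" if "fst l \<in> X" for l
    using funcset_mem [OF f that] by (simp add: g_def inv_letter_def)
  have ev_cancel: "ev (cancel_Cons l w) = g l \<otimes> ev w"
    if "fst l \<in> X" "fst ` set w \<subseteq> X" for l w
    using that evC gC
    by (cases w) (auto simp: ev_simps g_inv H.m_assoc [symmetric])
  have ev_mult: "ev (foldr cancel_Cons u v) = ev u \<otimes> ev v"
    if "fst ` set u \<subseteq> X" "fst ` set v \<subseteq> X" for u v
    using that
  proof (induction u)
    case (Cons l u)
    have "fst ` set (foldr cancel_Cons u v) \<subseteq> X"
      using Cons.prems set_mult [of u v] by fastforce
    with Cons show ?case
      by (simp add: ev_cancel ev_simps H.m_assoc gC evC)
  qed (auto simp: ev_simps evC)
  let ?h = "restrict ev (carrier (free_group X))"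
  have hom: "?h \<in> hom (free_group X) H"
  proof (rule homI)
    fix u v assume uv: "u \<in> carrier (free_group X)" "v \<in> carrier (free_group X)"
    then have "u \<otimes>\<^bsub>free_group X\<^esub> v \<in> carrier (free_group X)" by simp
    with uv show "?h (u \<otimes>\<^bsub>free_group X\<^esub> v) = ?h u \<otimes> ?h v"
      by (simp add: ev_mult free_group_def)
  qed (simp add: evC free_group_def)
  have gen: "[(x, b)] \<in> carrier (free_group X)" if "x \<in> X" for x b
    using that by (simp add: free_group_def reduced_Cons)
  have h_gen: "?h [(x, True)] = f x" if "x \<in> X" for x
    using funcset_mem [OF f that] gen [OF that] by (simp add: ev_simps g_def)
  have uniq: "k = ?h"
    if k: "k \<in> extensional (carrier (free_group X))" "k \<in> hom (free_group X) H"
      and kf: "\<And>x. x \<in> X \<Longrightarrow> k [(x, True)] = f x" for k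
  proof (rule extensionalityI)
    interpret k: group_hom "free_group X" H k
      using k by unfold_locales
    have letter: "k [(x, b)] = g (x, b)" if x: "x \<in> X" for x b
    proof (cases b)
      case True then show ?thesis using kf x by (simp add: g_def)
    next
      case False
      have "[(x, False)] \<otimes>\<^bsub>free_group X\<^esub> [(x, True)] = \<one>\<^bsub>free_group X\<^esub>"
        by (simp add: free_group_def inv_letter_def)
      then have "inv\<^bsub>free_group X\<^esub> [(x, True)] = [(x, False)]"
        using x gen by (intro F.inv_equality) auto
      then show ?thesis
        using k.hom_inv [OF gen [OF x, of True]] x False kf by (simp add: g_def)
    qed
    show "k w = ?h w" if "w \<in> carrier (free_group X)" for w
    proof -
      have "k w = ev w" if "w \<in> carrier (free_group X)" for w
        using that
      proof (induction w)
        case Nil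
        then show ?case using k.hom_one by (simp add: free_group_def ev_simps)
      next
        case (Cons l w)
        have w: "w \<in> carrier (free_group X)" and l: "fst l \<in> X"
          using Cons.prems by (auto simp: free_group_def reduced_Cons)
        have "l # w = [l] \<otimes>\<^bsub>free_group X\<^esub> w"
          using Cons.prems by (cases w) (auto simp: free_group_def reduced_Cons)
        then have "k (l # w) = k [l] \<otimes> k w"
          using k.hom_mult [of "[l]" w] w l gen [of "fst l" "snd l"] by simp
        then show ?case
          using w l letter [of "fst l" "snd l"] Cons.IH by (simp add: ev_simps)
      qed
      with that show ?thesis by simp
    qed
  qed (use k in auto)
  show ?thesis
    using hom h_gen uniq by (intro ex1I [of _ ?h]) auto
qed


section \<open>Semidirect products\<close>

definition semidirect_product ::
  "('a, 'c) monoid_scheme \<Rightarrow> ('b, 'd) monoid_scheme \<Rightarrow> ('b \<Rightarrow> 'a \<Rightarrow> 'a) \<Rightarrow> ('a \<times> 'b) monoid"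
  where
  "semidirect_product N H \<phi> =
     \<lparr>carrier = carrier N \<times> carrier H,
      monoid.mult = (\<lambda>(a, s) (b, t). (a \<otimes>\<^bsub>N\<^esub> \<phi> s b, s \<otimes>\<^bsub>H\<^esub> t)),
      one = (\<one>\<^bsub>N\<^esub>, \<one>\<^bsub>H\<^esub>)\<rparr>"

theorem group_semidirect_product:
  assumes "group N" "group H" and \<phi>: "\<phi> \<in> hom H (AutoGroup N)"
  shows "group (semidirect_product N H \<phi>)"
proof -
  interpret N: group N by fact
  interpret H: group H by fact
  interpret \<phi>: group_hom H "AutoGroup N" \<phi>
    using assms N.AutoGroup by (simp add: group_hom_def group_hom_axioms_def)
  have aut: "\<phi> s \<in> auto N" if "s \<in> carrier H" for s
    using \<phi>.hom_closed [OF that] by (simp add: AutoGroup_def)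
  then have C: "\<phi> s a \<in> carrier N" if "s \<in> carrier H" "a \<in> carrier N" for s a
    using that by (auto simp: auto_def hom_def)
  have M: "\<phi> s (a \<otimes>\<^bsub>N\<^esub> b) = \<phi> s a \<otimes>\<^bsub>N\<^esub> \<phi> s b"
    if "s \<in> carrier H" "a \<in> carrier N" "b \<in> carrier N" for s a b
    using that aut by (auto simp: auto_def hom_def)
  have \<phi>_mult: "\<phi> (s \<otimes>\<^bsub>H\<^esub> t) a = \<phi> s (\<phi> t a)"
    if "s \<in> carrier H" "t \<in> carrier H" "a \<in> carrier N" for s t a
    using that \<phi>.hom_mult [of s t] aut
    by (auto simp: AutoGroup_def BijGroup_def auto_def compose_def)
  have \<phi>_one: "\<phi> \<one>\<^bsub>H\<^esub> a = a" if "a \<in> carrier N" for a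
    using that \<phi>.hom_one by (simp add: AutoGroup_def BijGroup_def)
  show ?thesis
  proof (rule groupI)
    fix x assume "x \<in> carrier (semidirect_product N H \<phi>)"
    then obtain a s where x: "x = (a, s)" "a \<in> carrier N" "s \<in> carrier H"
      by (auto simp: semidirect_product_def)
    let ?t = "inv\<^bsub>H\<^esub> s"
    have "\<phi> ?t (inv\<^bsub>N\<^esub> a) \<otimes>\<^bsub>N\<^esub> \<phi> ?t a = \<phi> ?t \<one>\<^bsub>N\<^esub>"
      using x M [of ?t "inv\<^bsub>N\<^esub> a" a, symmetric] by (simp del: \<phi>.hom_inv)
    also have "\<dots> = \<one>\<^bsub>N\<^esub>"
      using x M [of ?t "\<one>\<^bsub>N\<^esub>" "\<one>\<^bsub>N\<^esub>"] C by (simp del: \<phi>.hom_inv)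
    finally show "\<exists>y\<in>carrier (semidirect_product N H \<phi>).
        y \<otimes>\<^bsub>semidirect_product N H \<phi>\<^esub> x = \<one>\<^bsub>semidirect_product N H \<phi>\<^esub>"
      using x C by (intro bexI [of _ "(\<phi> ?t (inv\<^bsub>N\<^esub> a), ?t)"]) (auto simp: semidirect_product_def simp del: \<phi>.hom_inv)
  qed (auto simp: semidirect_product_def C M \<phi>_mult \<phi>_one N.m_assoc H.m_assoc
         simp del: \<phi>.hom_mult \<phi>.hom_one)
qed


section \<open>Cayley graphs and quasi-isometry\<close>

definition cayley_adj :: "('a, 'c) monoid_scheme \<Rightarrow> 'a set \<Rightarrow> 'a \<Rightarrow> 'a \<Rightarrow> bool" where
  "cayley_adj G S g h \<longleftrightarrow>
     g \<in> carrier G \<and> h \<in> carrier G \<and> (\<exists>s\<in>S. h = g \<otimes>\<^bsub>G\<^esub> s \<or> g = h \<otimes>\<^bsub>G\<^esub> s)"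

text \<open>
  The edge-path metric on the vertex set of the Cayley graph. The \<open>LEAST\<close> is
  meaningful because the Cayley graph of a generating set is connected.
\<close>

definition cayley_dist :: "('a, 'c) monoid_scheme \<Rightarrow> 'a set \<Rightarrow> 'a \<Rightarrow> 'a \<Rightarrow> real" where
  "cayley_dist G S g h = real (LEAST k. (cayley_adj G S ^^ k) g h)"

definition quasi_isometric ::
  "'a set \<Rightarrow> ('a \<Rightarrow> 'a \<Rightarrow> real) \<Rightarrow> 'b set \<Rightarrow> ('b \<Rightarrow> 'b \<Rightarrow> real) \<Rightarrow> bool" where
  "quasi_isometric M d N e \<longleftrightarrow>
     (\<exists>f \<in> M \<rightarrow> N. \<exists>K\<ge>1. \<exists>C\<ge>0.
        (\<forall>x\<in>M. \<forall>y\<in>M. d x y / K - C \<le> e (f x) (f y) \<and> e (f x) (f y) \<le> K * d x y + C) \<and>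
        (\<forall>z\<in>N. \<exists>x\<in>M. e (f x) z \<le> C))"

definition finite_generating_set :: "('a, 'c) monoid_scheme \<Rightarrow> 'a set \<Rightarrow> bool" where
  "finite_generating_set G S \<longleftrightarrow> finite S \<and> S \<subseteq> carrier G \<and> generate G S = carrier G"

definition quasi_isometric_groups ::
  "('a, 'c) monoid_scheme \<Rightarrow> ('b, 'd) monoid_scheme \<Rightarrow> bool" where
  "quasi_isometric_groups G H \<longleftrightarrow>
     (\<exists>S T. finite_generating_set G S \<and> finite_generating_set H T \<and>
        quasi_isometric (carrier G) (cayley_dist G S) (carrier H) (cayley_dist H T))"

lemma cayley_adj_sym: "cayley_adj G S g h \<Longrightarrow> cayley_adj G S h g"
  by (auto simp: cayley_adj_def)

lemma cayley_path_sym: "(cayley_adj G S ^^ k) g h \<Longrightarrow> (cayley_adj G S ^^ k) h g"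
proof (induction k arbitrary: h)
  case (Suc k)
  then show ?case by (metis cayley_adj_sym relpowp_Suc_E relpowp_Suc_I2)
qed simp

lemma cayley_connected:
  assumes "group G" and S: "S \<subseteq> carrier G" and gen: "generate G S = carrier G"
    and "g \<in> carrier G" "h \<in> carrier G"
  shows "\<exists>k. (cayley_adj G S ^^ k) g h"
proof -
  interpret group G by fact
  have SG: "generate G S \<subseteq> carrier G" using gen by simp
  have *: "\<forall>g\<in>carrier G. (cayley_adj G S)\<^sup>*\<^sup>* g (g \<otimes>\<^bsub>G\<^esub> x)" if "x \<in> generate G S" for x
    using that
  proof induction
    case one
    then show ?case by simp
  next
    case (incl s)
    then show ?case using S by (auto intro!: r_into_rtranclp simp: cayley_adj_def)
  next
    case (inv s)
    show ?case
    proof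
      fix g assume g: "g \<in> carrier G"
      have s: "s \<in> carrier G" using inv S by auto
      then have "g = g \<otimes>\<^bsub>G\<^esub> inv\<^bsub>G\<^esub> s \<otimes>\<^bsub>G\<^esub> s" using g by (simp add: m_assoc)
      with s g inv have "cayley_adj G S g (g \<otimes>\<^bsub>G\<^esub> inv\<^bsub>G\<^esub> s)"
        by (auto simp: cayley_adj_def)
      then show "(cayley_adj G S)\<^sup>*\<^sup>* g (g \<otimes>\<^bsub>G\<^esub> inv\<^bsub>G\<^esub> s)" by blast
    qed
  next
    case (eng x y)
    show ?case
    proof
      fix g assume g: "g \<in> carrier G"
      have xy: "x \<in> carrier G" "y \<in> carrier G" using eng SG by auto
      have "(cayley_adj G S)\<^sup>*\<^sup>* (g \<otimes>\<^bsub>G\<^esub> x) (g \<otimes>\<^bsub>G\<^esub> x \<otimes>\<^bsub>G\<^esub> y)"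
        using eng.IH(2) g xy by blast
      then show "(cayley_adj G S)\<^sup>*\<^sup>* g (g \<otimes>\<^bsub>G\<^esub> (x \<otimes>\<^bsub>G\<^esub> y))"
        using eng.IH(1) g xy by (metis m_assoc rtranclp_trans)
    qed
  qed
  have "inv\<^bsub>G\<^esub> g \<otimes>\<^bsub>G\<^esub> h \<in> generate G S" using assms gen by simp
  from * [OF this] have "(cayley_adj G S)\<^sup>*\<^sup>* g (g \<otimes>\<^bsub>G\<^esub> (inv\<^bsub>G\<^esub> g \<otimes>\<^bsub>G\<^esub> h))"
    using assms by blast
  then have "(cayley_adj G S)\<^sup>*\<^sup>* g h"
    using assms by (simp flip: m_assoc)
  then show ?thesis by (simp add: rtranclp_power)
qed

theorem Metric_space_cayley:
  assumes "group G" and S: "S \<subseteq> carrier G" and gen: "generate G S = carrier G"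
  shows "Metric_space (carrier G) (cayley_dist G S)"
proof
  let ?A = "cayley_adj G S"
  have path: "(?A ^^ (LEAST k. (?A ^^ k) x y)) x y" if "x \<in> carrier G" "y \<in> carrier G" for x y
    using cayley_connected [OF assms that] by (auto intro: LeastI)
  show "0 \<le> cayley_dist G S x y" for x y by (simp add: cayley_dist_def)
  have "(?A ^^ k) x y \<longleftrightarrow> (?A ^^ k) y x" for k x y by (blast intro: cayley_path_sym)
  then show "cayley_dist G S x y = cayley_dist G S y x" for x y
    unfolding cayley_dist_def by metis
  fix x y assume xy: "x \<in> carrier G" "y \<in> carrier G"
  show "cayley_dist G S x y = 0 \<longleftrightarrow> x = y"
  proof
    assume "cayley_dist G S x y = 0"
    then show "x = y" using path [OF xy] by (simp add: cayley_dist_def)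
  next
    assume "x = y"
    then have "(LEAST k. (?A ^^ k) x y) \<le> 0" by (intro Least_le) simp
    then show "cayley_dist G S x y = 0" by (simp add: cayley_dist_def)
  qed
  fix z assume z: "z \<in> carrier G"
  have "(LEAST k. (?A ^^ k) x z) \<le> (LEAST k. (?A ^^ k) x y) + (LEAST k. (?A ^^ k) y z)"
    using path [OF xy] path [OF xy(2) z] by (intro Least_le) (auto simp: relpowp_add)
  then show "cayley_dist G S x z \<le> cayley_dist G S x y + cayley_dist G S y z"
    by (simp add: cayley_dist_def flip: of_nat_add)
qed


section \<open>Finite-index subgroups\<close>

definition virtually :: "('a, 'c) monoid_scheme \<Rightarrow> ('b, 'd) monoid_scheme \<Rightarrow> bool" where
  "virtually G K \<longleftrightarrow>
     (\<exists>H. subgroup H G \<and> finite (rcosets\<^bsub>G\<^esub> H) \<and> G\<lparr>carrier := H\<rparr> \<cong> K)"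

end

theory Submission
  imports Defs "HOL-Library.Sublist"
begin

text \<open>
  Write \<open>F\<close> for the free group and \<open>G\<close> for the semidirect product \<open>F \<rtimes> \<int>\<close>. Everything comes down to
  the question whether some power \<open>\<phi> m\<close>, \<open>m \<noteq> 0\<close>, is an inner automorphism. If it is, then some
  element of height \<open>m\<close> centralises \<open>F\<close> and generates together with \<open>F\<close> a copy of \<open>F \<times> \<int>\<close> of finite
  index (\<open>inner_power_imp_virtually_product\<close>); and a finite-index subgroup is quasi-isometric to the
  whole group (\<open>virtually_imp_quasi_isometric_groups\<close>). What remains is to find an inner power when \<open>G\<close>
  is quasi-isometric to \<open>F \<times> \<int>\<close>. In rank one \<open>\<phi> 2\<close> is the identity. In higher rank this is
  \<open>power_is_inner\<close>, and the reason is the following.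

  The Cayley graph of \<open>F \<times> \<int>\<close> is a tree times a line. In such a complex, the number of times that a
  loop winds around a square, an edge of the tree times a unit interval, is a signed count of the
  crossings of that edge above that height. A loop that stays away from a vertical strip therefore
  winds equally often around all squares of the strip.

  Now let \<open>f\<close> be a quasi-isometry from \<open>G\<close> to \<open>F \<times> \<int>\<close> and let \<open>g\<close> be a coarse inverse. Each level of
  \<open>G\<close> is a tree on the vertex set \<open>F\<close> too, where the edges at level \<open>k\<close> are given by the \<open>\<phi> k\<close>-images
  of the generators. For two points \<open>a\<close>, \<open>b\<close> of \<open>F\<close>, the geodesics from \<open>b\<close> to \<open>a\<close> at the levels
  from \<open>- m\<close> to \<open>m\<close> sweep out a disc. If the edge at the origin of level \<open>0\<close> separates \<open>a\<close> from \<open>b\<close>,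
  the boundary of this disc winds around the origin. Its image under \<open>f\<close> then winds around some
  square from a fixed finite set; and around any given vertical translate of that square, provided
  that the disc is large enough. So for every point of the quasi-line \<open>g ` ({1} \<times> \<int>)\<close>, all sufficiently
  large discs of this kind pass near that point, within a distance that is the same for all points
  (\<open>disc_meets_vertical_line\<close>).

  Apply this to three points that leave the origin in different directions. A point \<open>q = g (1, r)\<close> is
  then close, in the tree at its level, to all three sides of the triangle which they span, hence to
  their median. The same holds for the triangle translated by an element \<open>w\<close> of \<open>F\<close>, whose median is
  the translate of the first one. So \<open>w\<close> moves \<open>q\<close> by a distance that is bounded independently of \<open>r\<close>
  (\<open>bounded_conjugates\<close>). Consequently the infinitely many points \<open>q\<close> conjugate every generator
  of \<open>F\<close> to finitely many elements only, and by the pigeonhole principle two of them do so in the same way.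
  Their quotient centralises \<open>F\<close>. As \<open>F\<close> has trivial centre, the quotient lies at some height \<open>m \<noteq> 0\<close>,
  which makes \<open>\<phi> m\<close> inner.

  Winding numbers are expressed by integrals of discrete one-forms \<open>\<beta> d\<alpha>\<close> for functions \<open>\<alpha>\<close> and \<open>\<beta>\<close> on the
  vertices. Such a form is exact on every set on which \<open>\<alpha>\<close> or \<open>\<beta>\<close> is constant, and this property is
  easily transported through \<open>f\<close> and \<open>g\<close>, whereas cells are not.
\<close>

section \<open>Reduced words as vertices of a tree\<close>

type_synonym 'a word = "('a \<times> bool) list"
type_synonym 'a point = "('a \<times> bool) list \<times> int"
type_synonym 'a form = "'a point \<Rightarrow> 'a point \<Rightarrow> real"

lemma free_group_mult: "u \<otimes>\<^bsub>free_group X\<^esub> v = foldr cancel_Cons u v"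
  by (simp add: free_group_def)

lemma free_group_one [simp]: "\<one>\<^bsub>free_group X\<^esub> = []"
  by (simp add: free_group_def)

lemma Nil_free_group [simp]: "[] \<in> carrier (free_group X)"
  by (simp add: free_group_def)

lemma carrier_free_group_iff:
  "w \<in> carrier (free_group X) \<longleftrightarrow> reduced w \<and> fst ` set w \<subseteq> X"
  by (simp add: free_group_def)

lemma single_free_group [simp]: "[l] \<in> carrier (free_group X) \<longleftrightarrow> fst l \<in> X"
  by (simp add: carrier_free_group_iff reduced_Cons)

lemma reduced_append: "reduced (u @ v) \<longleftrightarrow>
    reduced u \<and> reduced v \<and> (u \<noteq> [] \<longrightarrow> v \<noteq> [] \<longrightarrow> hd v \<noteq> inv_letter (last u))"
  by (auto simp: reduced_def successively_append_iff)

lemma Nil_free_group_mult [simp]: "[] \<otimes>\<^bsub>free_group X\<^esub> v = v"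
  by (simp add: free_group_mult)

lemma free_group_mult_Nil [simp]:
  "u \<in> carrier (free_group X) \<Longrightarrow> u \<otimes>\<^bsub>free_group X\<^esub> [] = u"
  by (simp add: free_group_mult mult_Nil_right carrier_free_group_iff)

lemma append_free_groupD:
  "u @ v \<in> carrier (free_group X) \<Longrightarrow> u \<in> carrier (free_group X) \<and> v \<in> carrier (free_group X)"
  by (auto simp: carrier_free_group_iff reduced_append)

lemma take_free_group: "w \<in> carrier (free_group X) \<Longrightarrow> take i w \<in> carrier (free_group X)"
  using append_free_groupD [of "take i w" "drop i w"] by simp

lemma drop_free_group: "w \<in> carrier (free_group X) \<Longrightarrow> drop i w \<in> carrier (free_group X)"
  using append_free_groupD [of "take i w" "drop i w"] by simp

lemma free_group_append:
  "u @ v \<in> carrier (free_group X) \<Longrightarrow> u \<otimes>\<^bsub>free_group X\<^esub> v = u @ v"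
  unfolding free_group_mult
proof (induction u)
  case (Cons k u)
  then have "u @ v \<in> carrier (free_group X)"
    by (auto simp: carrier_free_group_iff reduced_Cons)
  with Cons show ?case
    by (cases "u @ v") (auto simp: carrier_free_group_iff reduced_Cons)
qed simp

lemma replicate_free_group: "fst l \<in> X \<Longrightarrow> replicate m l \<in> carrier (free_group X)"
proof (induction m)
  case (Suc m)
  then show ?case
    by (cases m) (auto simp: carrier_free_group_iff reduced_Cons inv_letter_def prod_eq_iff)
qed simp

lemma reduced_inverse_word: "reduced (map inv_letter (rev u)) \<longleftrightarrow> reduced u"
proof -
  have "inv_letter k \<noteq> inv_letter (inv_letter l) \<longleftrightarrow> l \<noteq> inv_letter k" for k l :: "'a \<times> bool"
    by (metis inv_letter_inv_letter)
  then show ?thesis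
    unfolding reduced_def successively_map successively_rev by simp
qed

lemma inv_free_group:
  assumes "u \<in> carrier (free_group X)"
  shows "inv\<^bsub>free_group X\<^esub> u = map inv_letter (rev u)"
proof -
  interpret group "free_group X" by (rule group_free_group)
  have v: "map inv_letter (rev u) \<in> carrier (free_group X)"
    using assms by (auto simp: carrier_free_group_iff reduced_inverse_word)
  have "map inv_letter (rev u) \<otimes>\<^bsub>free_group X\<^esub> u = \<one>\<^bsub>free_group X\<^esub>"
    using assms mult_inverse_word [of "[]" u]
    by (simp add: free_group_mult carrier_free_group_iff mult_Nil_right)
  then show ?thesis using inv_equality assms v by blast
qed

lemma length_inv_free_group:
  "u \<in> carrier (free_group X) \<Longrightarrow> length (inv\<^bsub>free_group X\<^esub> u) = length u"
  by (simp add: inv_free_group)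

text \<open>
  The cancellation in a product happens in one block, a suffix of the left factor against a prefix
  of the right factor. All estimates in the tree are read off from this normal form.
\<close>
lemma free_group_mult_cases:
  assumes "u \<in> carrier (free_group X)"
  obtains p s q where "u = p @ s" "v = map inv_letter (rev s) @ q"
    "u \<otimes>\<^bsub>free_group X\<^esub> v = p @ q"
proof -
  have "reduced u \<Longrightarrow> \<exists>p s q. u = p @ s \<and> v = map inv_letter (rev s) @ q \<and> foldr cancel_Cons u v = p @ q"
  proof (induction u)
    case Nil
    then show ?case by auto
  next
    case (Cons k u)
    then obtain p s q where *: "u = p @ s" "v = map inv_letter (rev s) @ q"
        "foldr cancel_Cons u v = p @ q"
      by (auto simp: reduced_Cons)
    show ?case
    proof (cases p)
      case (Cons k' p')
      then have "k' \<noteq> inv_letter k" using Cons.prems * by (auto simp: reduced_Cons)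
      then have "k # u = (k # p) @ s \<and> v = map inv_letter (rev s) @ q \<and>
          foldr cancel_Cons (k # u) v = (k # p) @ q"
        using * Cons by simp
      then show ?thesis by blast
    next
      case Nil
      show ?thesis
      proof (cases "q \<noteq> [] \<and> hd q = inv_letter k")
        case True
        then have "k # u = [] @ (k # s) \<and> v = map inv_letter (rev (k # s)) @ tl q \<and>
            foldr cancel_Cons (k # u) v = [] @ tl q"
          using * Nil by (cases q) auto
        then show ?thesis by blast
      next
        case False
        then have "k # u = [k] @ s \<and> v = map inv_letter (rev s) @ q \<and>
            foldr cancel_Cons (k # u) v = [k] @ q"
          using * Nil by (cases q) auto
        then show ?thesis by blast
      qed
    qed
  qed
  then show thesis using assms that by (auto simp: carrier_free_group_iff free_group_mult)
qed

lemma length_free_group_mult: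
  assumes "u \<in> carrier (free_group X)"
  shows "length (u \<otimes>\<^bsub>free_group X\<^esub> v) \<le> length u + length v"
  by (rule free_group_mult_cases [OF assms, of v]) simp

lemma prefix_mult:
  assumes "u \<in> carrier (free_group X)" "prefix p u" "length p + length c \<le> length u"
  shows "prefix p (u \<otimes>\<^bsub>free_group X\<^esub> c)"
proof (rule free_group_mult_cases [OF assms(1), of c])
  fix p' s q
  assume *: "u = p' @ s" "c = map inv_letter (rev s) @ q" "u \<otimes>\<^bsub>free_group X\<^esub> c = p' @ q"
  then have "length p \<le> length p'" using assms(3) by simp
  then have "prefix p p'" using assms(2) * by (metis prefix_length_prefix prefixI)
  then show ?thesis using * by simp
qed

text \<open>
  The words with a given prefix \<open>p\<close> form one side of an edge of the tree. A step can cross that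
  edge only if it starts close to it, because a product with \<open>c\<close> cancels at most \<open>length c\<close> letters.
\<close>
lemma crossing_near_edge:
  assumes u: "u \<in> carrier (free_group X)" and c: "c \<in> carrier (free_group X)"
    and p: "p \<in> carrier (free_group X)"
    and cross: "prefix p u \<noteq> prefix p (u \<otimes>\<^bsub>free_group X\<^esub> c)"
  shows "length (inv\<^bsub>free_group X\<^esub> u \<otimes>\<^bsub>free_group X\<^esub> p) \<le> 2 * length c"
proof -
  interpret group "free_group X" by (rule group_free_group)
  have *: "length (inv\<^bsub>free_group X\<^esub> u \<otimes>\<^bsub>free_group X\<^esub> p) < length c"
    if "u \<in> carrier (free_group X)" "prefix p u" "\<not> prefix p (u \<otimes>\<^bsub>free_group X\<^esub> c)" for u c
  proof -
    from that obtain s where s: "u = p @ s" by (auto simp: prefix_def)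
    with that have s': "s \<in> carrier (free_group X)" "u = p \<otimes>\<^bsub>free_group X\<^esub> s"
      using append_free_groupD [of p s] free_group_append [of p s] by auto
    then have "inv\<^bsub>free_group X\<^esub> u \<otimes>\<^bsub>free_group X\<^esub> p = inv\<^bsub>free_group X\<^esub> s" using p by (simp add: inv_mult_group m_assoc)
    then have "length (inv\<^bsub>free_group X\<^esub> u \<otimes>\<^bsub>free_group X\<^esub> p) = length s" using s' by (simp add: length_inv_free_group)
    moreover have "length s < length c"
      using prefix_mult [OF that(1,2), of c] that(3) s by force
    ultimately show ?thesis by simp
  qed
  show ?thesis
  proof (cases "prefix p u")
    case True
    with * [OF u] cross show ?thesis by force
  next
    case False
    let ?u = "u \<otimes>\<^bsub>free_group X\<^esub> c"
    have "?u \<otimes>\<^bsub>free_group X\<^esub> inv\<^bsub>free_group X\<^esub> c = u" using u c by (simp add: m_assoc)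
    then have "length (inv\<^bsub>free_group X\<^esub> ?u \<otimes>\<^bsub>free_group X\<^esub> p) < length (inv\<^bsub>free_group X\<^esub> c)"
      using * [of ?u "inv\<^bsub>free_group X\<^esub> c"] u c False cross by force
    moreover have "inv\<^bsub>free_group X\<^esub> u \<otimes>\<^bsub>free_group X\<^esub> p = c \<otimes>\<^bsub>free_group X\<^esub> (inv\<^bsub>free_group X\<^esub> ?u \<otimes>\<^bsub>free_group X\<^esub> p)"
      using u c p by (simp add: inv_mult_group m_assoc [symmetric])
    ultimately show ?thesis
      using length_free_group_mult [OF c, of "inv\<^bsub>free_group X\<^esub> ?u \<otimes>\<^bsub>free_group X\<^esub> p"] c
      by (simp add: length_inv_free_group)
  qed
qed

lemma finite_words_length_le:
  assumes "finite X"
  shows "finite {w \<in> carrier (free_group X). length w \<le> N}"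
proof (rule finite_subset)
  show "{w \<in> carrier (free_group X). length w \<le> N} \<subseteq> {w. set w \<subseteq> X \<times> UNIV \<and> length w \<le> N}"
    by (force simp: carrier_free_group_iff)
  show "finite {w. set w \<subseteq> X \<times> (UNIV::bool set) \<and> length w \<le> N}"
    using assms by (intro finite_lists_length_le) auto
qed

text \<open>
  The geodesic between two words passes through the base vertex.
\<close>
definition diverge :: "'b list \<Rightarrow> 'b list \<Rightarrow> bool" where
  "diverge u v \<longleftrightarrow> (\<forall>k. \<not> (prefix [k] u \<and> prefix [k] v))"

text \<open>
  Seen from the base vertex, \<open>A\<close>, \<open>B\<close> and \<open>C\<close> lie in pairwise different directions, up to an error
  \<open>D\<close>, so the base vertex is within \<open>D\<close> of the median of the three; the second half of the
  hypothesis says the same of the vertex \<open>inv y\<close>. Since the median is unique, the two vertices are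
  close. In words: for each of \<open>A\<close>, \<open>B\<close>, \<open>C\<close> either much of \<open>y\<close> is cancelled or much of it
  survives, and two of the three must behave alike.
\<close>
lemma near_median_imp_close:
  assumes y: "y \<in> carrier (free_group X)"
    and lcp: "\<And>a b p. \<lbrakk>a \<in> {A, B, C}; b \<in> {A, B, C}; a \<noteq> b; prefix p a; prefix p b\<rbrakk> \<Longrightarrow> length p \<le> D"
    and lcp_y: "\<And>a b p. \<lbrakk>a \<in> {A, B, C}; b \<in> {A, B, C}; a \<noteq> b; prefix p (y \<otimes>\<^bsub>free_group X\<^esub> a);
        prefix p (y \<otimes>\<^bsub>free_group X\<^esub> b)\<rbrakk> \<Longrightarrow> length p \<le> D"
    and neq: "A \<noteq> B" "B \<noteq> C" "A \<noteq> C"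
  shows "length y \<le> 2 * D"
proof (rule ccontr)
  assume long: "\<not> length y \<le> 2 * D"
  let ?y' = "map inv_letter (rev y)"
  have *: "prefix (take (Suc D) y) (y \<otimes>\<^bsub>free_group X\<^esub> a) \<or> prefix (take (Suc D) ?y') a" for a
  proof (rule free_group_mult_cases [OF y, of a])
    fix p s q
    assume h: "y = p @ s" "a = map inv_letter (rev s) @ q" "y \<otimes>\<^bsub>free_group X\<^esub> a = p @ q"
    show ?thesis
    proof (cases "length s \<le> D")
      case True
      then have "take (Suc D) y = take (Suc D) p" using h long by simp
      then have "prefix (take (Suc D) y) (p @ q)" by (metis prefix_prefix take_is_prefix)
      then show ?thesis using h(3) by simp
    next
      case False
      then have "take (Suc D) ?y' = take (Suc D) (map inv_letter (rev s))" using h by simp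
      then show ?thesis using h by (metis prefix_prefix take_is_prefix)
    qed
  qed
  have no1: "\<not> (prefix (take (Suc D) y) (y \<otimes>\<^bsub>free_group X\<^esub> a) \<and> prefix (take (Suc D) y) (y \<otimes>\<^bsub>free_group X\<^esub> b))"
    if "a \<in> {A, B, C}" "b \<in> {A, B, C}" "a \<noteq> b" for a b
    using lcp_y [OF that, of "take (Suc D) y"] long by auto
  have no2: "\<not> (prefix (take (Suc D) ?y') a \<and> prefix (take (Suc D) ?y') b)"
    if "a \<in> {A, B, C}" "b \<in> {A, B, C}" "a \<noteq> b" for a b
    using lcp [OF that, of "take (Suc D) ?y'"] long by auto
  show False
    using * [of A] * [of B] * [of C] no1 [of A B] no1 [of A C] no1 [of B C]
      no2 [of A B] no2 [of A C] no2 [of B C] neq by blast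
qed

text \<open>
  The map \<open>\<theta> (u \<otimes> -)\<close> takes the geodesic from \<open>A\<close> to \<open>B\<close> to a path with steps of bounded length
  \<open>L\<close>. If \<open>A\<close> and \<open>B\<close> share a long prefix, then that geodesic stays far from the preimage of the
  \<open>L\<close>-ball about the base vertex, so its image never gets close enough to the base vertex to
  change its first letter.
\<close>
lemma bounded_common_prefix:
  assumes X: "finite X" and \<theta>: "\<theta> \<in> hom (free_group X) (free_group X)"
    and inj: "inj_on \<theta> (carrier (free_group X))" and u: "u \<in> carrier (free_group X)"
  shows "\<exists>D. \<forall>A\<in>carrier (free_group X). \<forall>B\<in>carrier (free_group X). \<forall>p.
      diverge (\<theta> (u \<otimes>\<^bsub>free_group X\<^esub> A)) (\<theta> (u \<otimes>\<^bsub>free_group X\<^esub> B)) \<longrightarrow>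
      prefix p A \<longrightarrow> prefix p B \<longrightarrow> length p \<le> D"
proof -
  interpret group "free_group X" by (rule group_free_group)
  have \<theta>C: "\<theta> a \<in> carrier (free_group X)" if "a \<in> carrier (free_group X)" for a
    using \<theta> that by (auto simp: hom_def)
  have \<theta>M: "\<theta> (a \<otimes>\<^bsub>free_group X\<^esub> b) = \<theta> a \<otimes>\<^bsub>free_group X\<^esub> \<theta> b" if "a \<in> carrier (free_group X)" "b \<in> carrier (free_group X)" for a b
    using \<theta> that by (auto simp: hom_def)
  have fin: "finite ((\<lambda>l. length (\<theta> [l])) ` (X \<times> UNIV))" using X by simp
  obtain L where L: "length (\<theta> [l]) \<le> L" if "fst l \<in> X" for l
  proof (rule that [of "Max ((\<lambda>l. length (\<theta> [l])) ` (X \<times> UNIV))"])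
    fix l :: "'a \<times> bool" assume "fst l \<in> X"
    then have "l \<in> X \<times> UNIV" by (cases l) auto
    with fin show "length (\<theta> [l]) \<le> Max ((\<lambda>l. length (\<theta> [l])) ` (X \<times> UNIV))" by simp
  qed
  define K where "K = {a \<in> carrier (free_group X). length (\<theta> (u \<otimes>\<^bsub>free_group X\<^esub> a)) \<le> L}"
  have "(\<lambda>a. \<theta> (u \<otimes>\<^bsub>free_group X\<^esub> a)) ` K \<subseteq> {w \<in> carrier (free_group X). length w \<le> L}"
    using u \<theta>C by (auto simp: K_def)
  moreover have "inj_on (\<lambda>a. \<theta> (u \<otimes>\<^bsub>free_group X\<^esub> a)) K"
    using inj u by (auto simp: K_def inj_on_def) (metis Units_eq Units_l_cancel m_closed)
  ultimately have "finite K"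
    using finite_words_length_le [OF X, of L] by (meson finite_imageD finite_subset)
  then obtain D where D: "length a \<le> D" if "a \<in> K" for a
    using that [of "Max (length ` K)"] by simp
  have "length p \<le> D"
    if A: "A \<in> carrier (free_group X)" and B: "B \<in> carrier (free_group X)"
      and div: "diverge (\<theta> (u \<otimes>\<^bsub>free_group X\<^esub> A)) (\<theta> (u \<otimes>\<^bsub>free_group X\<^esub> B))" and p: "prefix p A" "prefix p B" for A B p
  proof (rule ccontr)
    assume long: "\<not> length p \<le> D"
    have far: "length (\<theta> (u \<otimes>\<^bsub>free_group X\<^esub> a)) > L" if "a \<in> carrier (free_group X)" "prefix p a" for a
      using D [of a] that long prefix_length_le [OF that(2)] by (force simp: K_def)
    have pC: "p \<in> carrier (free_group X)" using p A append_free_groupD by (auto simp: prefix_def)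
    obtain k where k: "prefix [k] (\<theta> (u \<otimes>\<^bsub>free_group X\<^esub> p))"
      using far [OF pC] by (cases "\<theta> (u \<otimes>\<^bsub>free_group X\<^esub> p)") auto
    have same: "prefix [k] (\<theta> (u \<otimes>\<^bsub>free_group X\<^esub> (p @ s)))" if "p @ s \<in> carrier (free_group X)" for s
      using that
    proof (induction s rule: rev_induct)
      case Nil
      then show ?case using k by simp
    next
      case (snoc l s)
      have C: "p @ s \<in> carrier (free_group X)" "[l] \<in> carrier (free_group X)"
        using append_free_groupD [of "p @ s" "[l]"] snoc.prems by auto
      have "\<theta> (u \<otimes>\<^bsub>free_group X\<^esub> (p @ s @ [l])) = \<theta> (u \<otimes>\<^bsub>free_group X\<^esub> (p @ s)) \<otimes>\<^bsub>free_group X\<^esub> \<theta> [l]"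
        using snoc.prems C u free_group_append [of "p @ s" "[l]"]
        by (simp add: \<theta>M [symmetric] m_assoc)
      moreover have "length [k] + length (\<theta> [l]) \<le> length (\<theta> (u \<otimes>\<^bsub>free_group X\<^esub> (p @ s)))"
        using far [OF C(1)] L [of l] C by simp
      ultimately show ?case
        using prefix_mult [OF _ snoc.IH [OF C(1)]] C u \<theta>C by simp
    qed
    obtain s t where "A = p @ s" "B = p @ t" using p by (auto simp: prefix_def)
    then show False using same [of s] same [of t] A B div unfolding diverge_def by blast
  qed
  then show ?thesis by blast
qed

text \<open>
  Appending a letter \<open>k\<close> that does not cancel must give the same word as putting it in front, so \<open>k\<close> is
  the first letter of \<open>w\<close>. With two generators there is more than one such letter.
\<close>
lemma centre_free_group_trivial:
  assumes w: "w \<in> carrier (free_group X)" and x: "x \<in> X" "x' \<in> X" "x \<noteq> x'"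
    and comm: "\<And>l. fst l \<in> X \<Longrightarrow> w \<otimes>\<^bsub>free_group X\<^esub> [l] = [l] \<otimes>\<^bsub>free_group X\<^esub> w"
  shows "w = []"
proof (rule ccontr)
  assume ne: "w \<noteq> []"
  have hd: "k = hd w" if "fst k \<in> X" "k \<noteq> inv_letter (last w)" for k
  proof -
    have "w @ [k] \<in> carrier (free_group X)"
      using w that ne by (auto simp: carrier_free_group_iff reduced_append reduced_Cons)
    then have "w @ [k] = cancel_Cons k w"
      using comm [OF that(1)] by (simp add: free_group_append) (simp add: free_group_mult)
    then show ?thesis
      using ne by (cases w) (auto split: if_splits dest: arg_cong [where f = length])
  qed
  obtain y b where yb: "inv_letter (last w) = (y, b)" by force
  have "(x, \<not> b) = hd w" "(x', \<not> b) = hd w" using hd x yb by auto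
  then show False using x by (metis fst_conv)
qed

section \<open>Discrete one-forms\<close>

text \<open>
  The one-form \<open>\<beta> d\<alpha>\<close>, evaluated on a pair of points. Averaging \<open>\<beta>\<close> over the two points makes the
  form antisymmetric.
\<close>
definition wedge :: "('p \<Rightarrow> real) \<Rightarrow> ('p \<Rightarrow> real) \<Rightarrow> 'p \<Rightarrow> 'p \<Rightarrow> real" where
  "wedge \<beta> \<alpha> x y = (\<beta> x + \<beta> y) / 2 * (\<alpha> y - \<alpha> x)"

definition exact_on :: "'p set \<Rightarrow> ('p \<Rightarrow> 'p \<Rightarrow> real) \<Rightarrow> bool" where
  "exact_on U \<omega> \<longleftrightarrow> (\<exists>H. \<forall>p\<in>U. \<forall>q\<in>U. \<omega> p q = H q - H p)"

definition constant_on_set :: "'p set \<Rightarrow> ('p \<Rightarrow> real) \<Rightarrow> bool" where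
  "constant_on_set U h \<longleftrightarrow> (\<forall>p\<in>U. \<forall>q\<in>U. h p = h q)"

definition antisymmetric :: "('p \<Rightarrow> 'p \<Rightarrow> real) \<Rightarrow> bool" where
  "antisymmetric \<omega> \<longleftrightarrow> (\<forall>x y. \<omega> y x = - \<omega> x y)"

lemma antisymmetric_wedge: "antisymmetric (wedge \<beta> \<alpha>)"
  by (simp add: antisymmetric_def wedge_def algebra_simps add_divide_distrib diff_divide_distrib)

lemma exact_on_wedge:
  assumes "constant_on_set U \<beta> \<or> constant_on_set U \<alpha>"
  shows "exact_on U (wedge \<beta> \<alpha>)"
  using assms
proof
  assume a: "constant_on_set U \<beta>"
  show ?thesis
  proof (cases "U = {}")
    case False
    then obtain p0 where "p0 \<in> U" by blast
    have "wedge \<beta> \<alpha> p q = \<beta> p0 * \<alpha> q - \<beta> p0 * \<alpha> p" if "p \<in> U" "q \<in> U" for p q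
    proof -
      have "\<beta> p = \<beta> p0" "\<beta> q = \<beta> p0"
        using a that \<open>p0 \<in> U\<close> unfolding constant_on_set_def by blast+
      then show ?thesis unfolding wedge_def by (simp add: algebra_simps)
    qed
    then show ?thesis unfolding exact_on_def by (intro exI [of _ "\<lambda>p. \<beta> p0 * \<alpha> p"]) blast
  qed (simp add: exact_on_def)
next
  assume a: "constant_on_set U \<alpha>"
  have "wedge \<beta> \<alpha> p q = 0" if "p \<in> U" "q \<in> U" for p q
  proof -
    have "\<alpha> p = \<alpha> q" using a that unfolding constant_on_set_def by blast
    then show ?thesis by (simp add: wedge_def)
  qed
  then show ?thesis unfolding exact_on_def by (intro exI [of _ "\<lambda>_. 0"]) simp
qed

definition height_above :: "int \<Rightarrow> 'a point \<Rightarrow> real" where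
  "height_above k = (\<lambda>(u, j). of_bool (k < j))"

definition beyond :: "'a word \<Rightarrow> 'a point \<Rightarrow> real" where
  "beyond v = (\<lambda>(u, j). of_bool (prefix v u))"

text \<open>
  The integral of this form around a loop in the product of the tree with a line is, up to sign, the
  winding number of the loop around the square that joins the edge ending at \<open>v\<close> to its translate
  one level above, between the heights \<open>k\<close> and \<open>k + 1\<close>.
\<close>
definition dual_form :: "'a point \<Rightarrow> 'a form" where
  "dual_form = (\<lambda>(v, k). wedge (height_above k) (beyond v))"

lemma antisymmetric_dual_form: "antisymmetric (dual_form \<sigma>)"
  by (cases \<sigma>) (simp add: dual_form_def antisymmetric_wedge)

lemma exact_on_subset: "exact_on U \<omega> \<Longrightarrow> V \<subseteq> U \<Longrightarrow> exact_on V \<omega>"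
  unfolding exact_on_def by (meson subsetD)

lemma exact_on_pullback:
  assumes "exact_on (g ` U) \<omega>"
  shows "exact_on U (\<lambda>x y. \<omega> (g x) (g y))"
proof -
  obtain H where "\<forall>p\<in>g ` U. \<forall>q\<in>g ` U. \<omega> p q = H q - H p"
    using assms unfolding exact_on_def ..
  then show ?thesis unfolding exact_on_def by (intro exI [of _ "\<lambda>x. H (g x)"]) simp
qed

section \<open>Semidirect products of a free group with the integers\<close>

text \<open>
  The action is constrained on the carrier only. This admits both the homomorphisms into the
  automorphism group, which are extensional, and the trivial action \<open>\<lambda>_ x. x\<close>, for which the semidirect
  product is literally the direct product.
\<close>
locale free_by_int =
  fixes X :: "'a set" and \<phi> :: "int \<Rightarrow> 'a word \<Rightarrow> 'a word"
  assumes X_finite: "finite X"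
    and \<phi>_closed: "a \<in> carrier (free_group X) \<Longrightarrow> \<phi> k a \<in> carrier (free_group X)"
    and \<phi>_mult: "\<lbrakk>a \<in> carrier (free_group X); b \<in> carrier (free_group X)\<rbrakk> \<Longrightarrow>
        \<phi> k (a \<otimes>\<^bsub>free_group X\<^esub> b) = \<phi> k a \<otimes>\<^bsub>free_group X\<^esub> \<phi> k b"
    and \<phi>_add: "a \<in> carrier (free_group X) \<Longrightarrow> \<phi> (k + l) a = \<phi> k (\<phi> l a)"
    and \<phi>_0: "a \<in> carrier (free_group X) \<Longrightarrow> \<phi> 0 a = a"
begin

abbreviation F where "F \<equiv> free_group X"
abbreviation G where "G \<equiv> semidirect_product F integer_group \<phi>"
abbreviation multG (infixl "\<cdot>" 70) where "x \<cdot> y \<equiv> x \<otimes>\<^bsub>G\<^esub> y"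

sublocale F: group F by (rule group_free_group)

lemma carrier_G: "carrier G = carrier F \<times> UNIV"
  by (simp add: semidirect_product_def)

lemma mem_G [simp]: "(a, k) \<in> carrier G \<longleftrightarrow> a \<in> carrier F"
  by (simp add: carrier_G)

lemma mult_G [simp]: "(a, k) \<cdot> (b, l) = (a \<otimes>\<^bsub>F\<^esub> \<phi> k b, k + l)"
  by (simp add: semidirect_product_def)

lemma one_G: "\<one>\<^bsub>G\<^esub> = ([], 0)"
  by (simp add: semidirect_product_def)

lemma \<phi>_Nil: "\<phi> k [] = []"
proof -
  have "\<phi> k [] \<otimes>\<^bsub>F\<^esub> \<phi> k [] = \<phi> k []" using \<phi>_mult [of "[]" "[]" k] by simp
  then show ?thesis using F.l_cancel_one [of "\<phi> k []" "\<phi> k []"] \<phi>_closed [of "[]" k] by simp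
qed

lemma \<phi>_hom: "\<phi> k \<in> hom F F"
  by (simp add: hom_def \<phi>_closed \<phi>_mult)

lemma \<phi>_inv: "a \<in> carrier F \<Longrightarrow> \<phi> k (inv\<^bsub>F\<^esub> a) = inv\<^bsub>F\<^esub> \<phi> k a"
  using \<phi>_mult [of "inv\<^bsub>F\<^esub> a" a k] \<phi>_closed [of _ k]
  by (intro F.inv_equality [symmetric]) (auto simp: \<phi>_Nil)

lemma \<phi>_minus: "a \<in> carrier F \<Longrightarrow> \<phi> k (\<phi> (- k) a) = a"
  "a \<in> carrier F \<Longrightarrow> \<phi> (- k) (\<phi> k a) = a"
  by (simp_all add: \<phi>_0 flip: \<phi>_add)

lemma inj_\<phi>: "inj_on (\<phi> k) (carrier F)"
  by (rule inj_on_inverseI [of _ "\<phi> (- k)"]) (rule \<phi>_minus)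

sublocale G: group G
proof (rule groupI)
  fix x y z assume "x \<in> carrier G" "y \<in> carrier G" "z \<in> carrier G"
  then show "x \<cdot> y \<cdot> z = x \<cdot> (y \<cdot> z)"
    by (auto simp: carrier_G \<phi>_closed \<phi>_mult \<phi>_add F.m_assoc)
next
  fix x assume "x \<in> carrier G"
  then obtain a k where x: "x = (a, k)" "a \<in> carrier F" by (auto simp: carrier_G)
  then show "\<exists>y\<in>carrier G. y \<cdot> x = \<one>\<^bsub>G\<^esub>"
    by (intro bexI [of _ "(\<phi> (- k) (inv\<^bsub>F\<^esub> a), - k)"])
      (auto simp: one_G carrier_G \<phi>_closed \<phi>_inv \<phi>_minus)
  show "\<one>\<^bsub>G\<^esub> \<cdot> x = x" using x F.l_one [of a] by (simp add: one_G \<phi>_0)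
qed (auto simp: carrier_G \<phi>_closed one_G \<phi>_Nil)

lemma inv_G: "a \<in> carrier F \<Longrightarrow> inv\<^bsub>G\<^esub> (a, k) = (\<phi> (- k) (inv\<^bsub>F\<^esub> a), - k)"
  by (rule G.inv_equality) (auto simp: one_G carrier_G \<phi>_closed \<phi>_inv \<phi>_minus)

lemma G_mult_Nil [simp]: "q \<in> carrier G \<Longrightarrow> q \<cdot> ([], 0) = q"
  using G.r_one [of q] unfolding one_G .

definition steps :: "'a point set" where
  "steps = insert ([], 1) ((\<lambda>l. ([l], 0)) ` (X \<times> UNIV))"

lemma finite_steps: "finite steps"
  using X_finite by (simp add: steps_def)

lemma steps_G: "steps \<subseteq> carrier G"
  by (auto simp: steps_def carrier_G)

lemma steps_cases:
  assumes "s \<in> steps"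
  obtains "s = ([], 1)" | l where "s = ([l], 0)" "fst l \<in> X"
proof -
  from assms have "s = ([], 1) \<or> (\<exists>l\<in>X \<times> UNIV. s = ([l], 0))"
    unfolding steps_def by (simp only: insert_iff image_iff)
  then show thesis
  proof (elim disjE bexE)
    fix l assume "l \<in> X \<times> (UNIV :: bool set)" "s = ([l], 0)"
    then show thesis using that(2) [of l] by (simp add: mem_Times_iff)
  qed (rule that(1))
qed

lemma steps_mem: "([], 1) \<in> steps" "fst l \<in> X \<Longrightarrow> ([l], 0) \<in> steps"
  by (simp_all add: steps_def mem_Times_iff)

text \<open>
  The integral of a form along the horizontal path that starts at \<open>q\<close> and spells \<open>w\<close>.
\<close>
primrec hint :: "'a form \<Rightarrow>
    'a point \<Rightarrow> 'a word \<Rightarrow> real" where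
  "hint \<omega> q [] = 0"
| "hint \<omega> q (l # w) = \<omega> q (q \<cdot> ([l], 0)) + hint \<omega> (q \<cdot> ([l], 0)) w"

definition vint :: "'a form \<Rightarrow>
    'a word \<Rightarrow> int \<Rightarrow> nat \<Rightarrow> real" where
  "vint \<omega> a k n = (\<Sum>i<n. \<omega> (a, k + int i) (a, k + int i + 1))"

lemma Cons_F:
  assumes "k # w \<in> carrier F"
  shows "fst k \<in> X" "w \<in> carrier F" "[k] \<in> carrier F" "k # w = [k] \<otimes>\<^bsub>F\<^esub> w"
    "k # w = cancel_Cons k w"
  using append_free_groupD [of "[k]" w X] free_group_append [of "[k]" w X] assms
  by (auto simp: free_group_mult)

lemma right_mult_inv_letter:
  assumes "q \<in> carrier G" "fst l \<in> X"
  shows "q \<cdot> ([l], 0) \<cdot> ([inv_letter l], 0) = q"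
proof -
  have "([l], 0) \<cdot> ([inv_letter l], 0) = \<one>\<^bsub>G\<^esub>"
    using assms by (simp add: one_G \<phi>_0 free_group_mult)
  then show ?thesis using assms by (simp add: G.m_assoc)
qed

lemma horizontal_mult:
  assumes "q \<in> carrier G" "u \<in> carrier F" "v \<in> carrier F"
  shows "q \<cdot> (u, 0) \<cdot> (v, 0) = q \<cdot> (u \<otimes>\<^bsub>F\<^esub> v, 0)"
  using assms by (simp add: G.m_assoc \<phi>_0)

text \<open>
  A level of \<open>G\<close> is a tree, so the integral along a horizontal path depends only on the group
  element that the path spells. This is the one place where antisymmetry of the form is used: it
  makes a backtrack contribute nothing.
\<close>
lemma hint_mult:
  assumes \<omega>: "antisymmetric \<omega>" and u: "u \<in> carrier F" and v: "v \<in> carrier F"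
  shows "q \<in> carrier G \<Longrightarrow> hint \<omega> q (u \<otimes>\<^bsub>F\<^esub> v) = hint \<omega> q u + hint \<omega> (q \<cdot> (u, 0)) v"
  using u
proof (induction u arbitrary: q)
  case Nil
  then show ?case by simp
next
  case (Cons k u)
  note ku = Cons_F [OF Cons.prems(2)]
  have cancel: "hint \<omega> q (cancel_Cons k w) = \<omega> q (q \<cdot> ([k], 0)) + hint \<omega> (q \<cdot> ([k], 0)) w" for w
  proof (cases w)
    case (Cons l w')
    have "\<omega> (q \<cdot> ([k], 0)) q = - \<omega> q (q \<cdot> ([k], 0))"
      using \<omega> unfolding antisymmetric_def by blast
    then show ?thesis
      using Cons right_mult_inv_letter [OF Cons.prems(1) ku(1)] by simp
  qed simp
  let ?q = "q \<cdot> ([k], 0)"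
  have qC: "?q \<in> carrier G" using Cons.prems(1) ku by (simp del: mult_G)
  have "(k # u) \<otimes>\<^bsub>F\<^esub> v = cancel_Cons k (u \<otimes>\<^bsub>F\<^esub> v)" by (simp add: free_group_mult)
  then have "hint \<omega> q ((k # u) \<otimes>\<^bsub>F\<^esub> v) = \<omega> q ?q + hint \<omega> ?q u + hint \<omega> (?q \<cdot> (u, 0)) v"
    using cancel Cons.IH [OF qC ku(2)] by simp
  also have "?q \<cdot> (u, 0) = q \<cdot> (k # u, 0)"
    using horizontal_mult [OF Cons.prems(1) ku(3,2)] ku(4) by simp
  finally show ?case by simp
qed

text \<open>
  Changing a form by the coboundary of \<open>h\<close> along a path changes its integral by the difference of
  \<open>h\<close> at the two ends. With \<open>\<omega>' = 0\<close> this evaluates the integral of an exact form.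
\<close>
lemma hint_cong:
  assumes "q \<in> carrier G" "w \<in> carrier F"
    and "\<And>i l. i < length w \<Longrightarrow> l = w ! i \<Longrightarrow> fst l \<in> X \<Longrightarrow>
      \<omega> (q \<cdot> (take i w, 0)) (q \<cdot> (take i w, 0) \<cdot> ([l], 0)) =
      \<omega>' (q \<cdot> (take i w, 0)) (q \<cdot> (take i w, 0) \<cdot> ([l], 0)) +
      h (q \<cdot> (take i w, 0) \<cdot> ([l], 0)) - h (q \<cdot> (take i w, 0))"
  shows "hint \<omega> q w = hint \<omega>' q w + h (q \<cdot> (w, 0)) - h q"
  using assms
proof (induction w arbitrary: q)
  case Nil
  then show ?case by simp
next
  case (Cons k w)
  note kw = Cons_F [OF Cons.prems(2)]
  let ?q = "q \<cdot> ([k], 0)"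
  have qC: "?q \<in> carrier G" using Cons.prems(1) kw by (simp del: mult_G)
  have eq: "?q \<cdot> (take i w, 0) = q \<cdot> (take (Suc i) (k # w), 0)" for i
  proof -
    have "take (Suc i) (k # w) \<in> carrier F" using Cons.prems(2) by (rule take_free_group)
    then have "k # take i w \<in> carrier F" by simp
    from Cons_F [OF this] show ?thesis
      using horizontal_mult [OF Cons.prems(1) kw(3), of "take i w"] by simp
  qed
  have "hint \<omega> ?q w = hint \<omega>' ?q w + h (?q \<cdot> (w, 0)) - h ?q"
  proof (rule Cons.IH [OF qC kw(2)])
    fix i l assume "i < length w" "l = w ! i" "fst l \<in> X"
    then show "\<omega> (?q \<cdot> (take i w, 0)) (?q \<cdot> (take i w, 0) \<cdot> ([l], 0)) =
      \<omega>' (?q \<cdot> (take i w, 0)) (?q \<cdot> (take i w, 0) \<cdot> ([l], 0)) +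
      h (?q \<cdot> (take i w, 0) \<cdot> ([l], 0)) - h (?q \<cdot> (take i w, 0))"
      unfolding eq using Cons.prems(3) [of "Suc i" l] by simp
  qed
  moreover have "\<omega> q ?q = \<omega>' q ?q + h ?q - h q"
    using Cons.prems(3) [of 0 k] kw(1) Cons.prems(1) by simp
  moreover have "?q \<cdot> (w, 0) = q \<cdot> (k # w, 0)"
    using eq [of "length w"] by simp
  ultimately show ?case by simp
qed

lemma hint_zero [simp]: "hint (\<lambda>_ _. 0) q w = 0"
  by (induction w arbitrary: q) auto

lemma hint_sum: "hint (\<lambda>x y. \<Sum>s\<in>S. c s * \<omega> s x y) q w = (\<Sum>s\<in>S. c s * hint (\<omega> s) q w)"
  by (induction w arbitrary: q) (auto simp: sum.distrib algebra_simps)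

lemma vint_sum: "vint (\<lambda>x y. \<Sum>s\<in>S. c s * \<omega> s x y) a k n = (\<Sum>s\<in>S. c s * vint (\<omega> s) a k n)"
  unfolding vint_def by (subst sum.swap) (simp add: sum_distrib_left)

lemma vint_zero [simp]: "vint (\<lambda>_ _. 0) a k n = 0"
  by (simp add: vint_def)

lemma vint_cong:
  assumes "\<And>i. i < n \<Longrightarrow> \<omega> (a, k + int i) (a, k + int i + 1) =
      \<omega>' (a, k + int i) (a, k + int i + 1) + h (a, k + int i + 1) - h (a, k + int i)"
  shows "vint \<omega> a k n = vint \<omega>' a k n + h (a, k + int n) - h (a, k)"
  using assms unfolding vint_def by (induction n) (auto simp: add_ac)

text \<open>
  The relation between the vertical generator and a letter \<open>l\<close> gives a small loop at every point. The
  translate of \<open>cell\<close> to that point contains all these loops.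
\<close>
definition cell :: "'a point set" where
  "cell = (\<lambda>l. ([l], 0)) ` (X \<times> UNIV) \<union> (\<lambda>l. ([l], 0) \<cdot> ([], 1)) ` (X \<times> UNIV) \<union> {([], 0), ([], 1)} \<union>
    (\<Union>l\<in>X \<times> UNIV. (\<lambda>i. ([], 1) \<cdot> (take i (\<phi> (- 1) [l]), 0)) ` {..length (\<phi> (- 1) [l])})"

lemma finite_cell: "finite cell"
  unfolding cell_def using X_finite by auto

lemma cell_G: "cell \<subseteq> carrier G"
  unfolding cell_def by (auto simp: carrier_G \<phi>_closed take_free_group)

lemma cell_mem:
  "fst l \<in> X \<Longrightarrow> ([l], 0) \<in> cell"
  "fst l \<in> X \<Longrightarrow> ([l], 0) \<cdot> ([], 1) \<in> cell"
  "([], 0) \<in> cell" "([], 1) \<in> cell"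
  "fst l \<in> X \<Longrightarrow> ([], 1) \<cdot> (take i (\<phi> (- 1) [l]), 0) \<in> cell"
proof -
  assume "fst l \<in> X"
  then have l: "l \<in> X \<times> UNIV" by (cases l) auto
  show "([l], 0) \<in> cell" "([l], 0) \<cdot> ([], 1) \<in> cell"
    unfolding cell_def by (intro UnI1 imageI l UnI2 | rule UnI1)+
  have "take i (\<phi> (- 1) [l]) = take (min i (length (\<phi> (- 1) [l]))) (\<phi> (- 1) [l])"
    by (simp add: min_def)
  moreover have "([], 1) \<cdot> (take (min i (length (\<phi> (- 1) [l]))) (\<phi> (- 1) [l]), 0) \<in> cell"
    unfolding cell_def by (intro UnI2 UN_I [OF l] imageI) simp
  ultimately show "([], 1) \<cdot> (take i (\<phi> (- 1) [l]), 0) \<in> cell" by (simp del: mult_G)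
qed (simp_all add: cell_def)

text \<open>
  When a horizontal path from \<open>q\<close> that spells \<open>w\<close> is moved up by one level, it becomes the path that
  spells \<open>\<phi> (- 1) w\<close>. The strip between the two is a union of the loops just mentioned, one for each letter
  of \<open>w\<close>.
\<close>
lemma strip:
  assumes \<omega>: "antisymmetric \<omega>" and "q \<in> carrier G" "w \<in> carrier F"
    and ex: "\<And>i. i \<le> length w \<Longrightarrow> exact_on ((\<lambda>c. q \<cdot> (take i w, 0) \<cdot> c) ` cell) \<omega>"
  shows "hint \<omega> q w + \<omega> (q \<cdot> (w, 0)) (q \<cdot> (w, 0) \<cdot> ([], 1)) =
    \<omega> q (q \<cdot> ([], 1)) + hint \<omega> (q \<cdot> ([], 1)) (\<phi> (- 1) w)"
  using assms(2-)
proof (induction w arbitrary: q)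
  case Nil
  then show ?case by (simp add: \<phi>_Nil)
next
  case (Cons l w)
  note lw = Cons_F [OF Cons.prems(2)]
  let ?q = "q \<cdot> ([l], 0)" and ?t = "([], 1) :: 'a point"
  have C: "?q \<in> carrier G" "q \<cdot> ?t \<in> carrier G" "?t \<in> carrier G" "([l], 0) \<in> carrier G"
    using Cons.prems(1) lw by (simp_all del: mult_G)
  have eq: "?q \<cdot> (take i w, 0) = q \<cdot> (take (Suc i) (l # w), 0)" for i
  proof -
    have "take (Suc i) (l # w) \<in> carrier F" using Cons.prems(2) by (rule take_free_group)
    then have "l # take i w \<in> carrier F" by simp
    from Cons_F [OF this] show ?thesis
      using horizontal_mult [OF Cons.prems(1) lw(3), of "take i w"] by simp
  qed
  have IH: "hint \<omega> ?q w + \<omega> (?q \<cdot> (w, 0)) (?q \<cdot> (w, 0) \<cdot> ?t) =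
      \<omega> ?q (?q \<cdot> ?t) + hint \<omega> (?q \<cdot> ?t) (\<phi> (- 1) w)"
    using Cons.IH [OF C(1) lw(2)] Cons.prems(3) [of "Suc _"] eq by simp
  have up: "q \<cdot> ?t \<cdot> (\<phi> (- 1) [l], 0) = ?q \<cdot> ?t"
  proof -
    have "?t \<cdot> (\<phi> (- 1) [l], 0) = ([l], 0) \<cdot> ?t"
      using lw(3) \<phi>_minus(1) [of "[l]" 1] F.l_one [of "[l]"] F.r_one [of "[l]"] by (simp add: \<phi>_Nil)
    then show ?thesis
      using Cons.prems(1) C lw(3) by (simp add: G.m_assoc \<phi>_closed del: mult_G)
  qed
  have "exact_on ((\<lambda>c. q \<cdot> c) ` cell) \<omega>"
    using Cons.prems(1) Cons.prems(3) [of 0] by simp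
  then obtain H where H': "\<forall>p\<in>(\<lambda>c. q \<cdot> c) ` cell. \<forall>r\<in>(\<lambda>c. q \<cdot> c) ` cell. \<omega> p r = H r - H p"
    unfolding exact_on_def ..
  have H: "\<omega> (q \<cdot> c) (q \<cdot> d) = H (q \<cdot> d) - H (q \<cdot> c)"
    if "c \<in> cell" "d \<in> cell" for c d
    using bspec [OF bspec [OF H' imageI [OF that(1)]] imageI [OF that(2)]] .
  note mem = cell_mem(1) [OF lw(1)] cell_mem(2) [OF lw(1)] cell_mem(3,4)
  note mem' = cell_mem(5) [OF lw(1)]
  have [simp]: "q \<cdot> ([], 0) = q" using Cons.prems(1) by (rule G_mult_Nil)
  have assoc: "q \<cdot> (c \<cdot> d) = q \<cdot> c \<cdot> d" if "c \<in> carrier G" "d \<in> carrier G" for c d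
    using Cons.prems(1) that by (simp add: G.m_assoc)
  have "hint \<omega> (q \<cdot> ?t) (\<phi> (- 1) [l]) =
      hint (\<lambda>_ _. 0) (q \<cdot> ?t) (\<phi> (- 1) [l]) + H (q \<cdot> ?t \<cdot> (\<phi> (- 1) [l], 0)) - H (q \<cdot> ?t)"
  proof (rule hint_cong [OF C(2)])
    show vC: "\<phi> (- 1) [l] \<in> carrier F" using lw(3) by (rule \<phi>_closed)
    fix i k assume i: "i < length (\<phi> (- 1) [l])" "k = \<phi> (- 1) [l] ! i" "fst k \<in> X"
    let ?v = "\<phi> (- 1) [l]"
    have tk: "take i ?v \<in> carrier F" "take (Suc i) ?v \<in> carrier F" using vC by (auto intro: take_free_group)
    then have "take i ?v \<otimes>\<^bsub>F\<^esub> [k] = take (Suc i) ?v"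
      using free_group_append [of "take i ?v" "[k]"] i by (simp add: take_Suc_conv_app_nth)
    then have e: "q \<cdot> ?t \<cdot> (take i ?v, 0) \<cdot> ([k], 0) = q \<cdot> ?t \<cdot> (take (Suc i) ?v, 0)"
      using horizontal_mult [OF C(2) tk(1), of "[k]"] i by simp
    have "\<omega> (q \<cdot> ?t \<cdot> (take i ?v, 0)) (q \<cdot> ?t \<cdot> (take (Suc i) ?v, 0)) =
        H (q \<cdot> ?t \<cdot> (take (Suc i) ?v, 0)) - H (q \<cdot> ?t \<cdot> (take i ?v, 0))"
      using H [OF mem' [of i] mem' [of "Suc i"]] assoc [OF C(3)] tk by (simp del: mult_G)
    then show "\<omega> (q \<cdot> ?t \<cdot> (take i ?v, 0)) (q \<cdot> ?t \<cdot> (take i ?v, 0) \<cdot> ([k], 0)) =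
      0 + H (q \<cdot> ?t \<cdot> (take i ?v, 0) \<cdot> ([k], 0)) - H (q \<cdot> ?t \<cdot> (take i ?v, 0))"
      unfolding e by simp
  qed
  then have side: "hint \<omega> (q \<cdot> ?t) (\<phi> (- 1) [l]) = H (?q \<cdot> ?t) - H (q \<cdot> ?t)"
    by (simp add: up del: mult_G)
  have "\<omega> q ?q = H ?q - H q" using H [OF mem(3) mem(1)] by (simp del: mult_G)
  moreover have "\<omega> ?q (?q \<cdot> ?t) = H (?q \<cdot> ?t) - H ?q"
    using H [OF mem(1) mem(2)] assoc [OF C(4,3)] by (simp del: mult_G)
  moreover have "\<omega> q (q \<cdot> ?t) = H (q \<cdot> ?t) - H q"
    using H [OF mem(3) mem(4)] by (simp del: mult_G)
  moreover have "hint \<omega> (q \<cdot> ?t) (\<phi> (- 1) (l # w)) =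
      hint \<omega> (q \<cdot> ?t) (\<phi> (- 1) [l]) + hint \<omega> (?q \<cdot> ?t) (\<phi> (- 1) w)"
    unfolding lw(4) \<phi>_mult [OF lw(3,2)] hint_mult [OF \<omega> \<phi>_closed [OF lw(3)] \<phi>_closed [OF lw(2)] C(2)] up ..
  moreover have "?q \<cdot> (w, 0) = q \<cdot> (l # w, 0)" using eq [of "length w"] by simp
  ultimately show ?case using IH side unfolding hint.simps by simp
qed

end

section \<open>Discs swept out by geodesics\<close>

context free_by_int
begin

text \<open>
  The geodesic from \<open>b\<close> to \<open>a\<close> in the tree at level \<open>k\<close>. A letter \<open>l\<close> read at this level is a right
  multiplication by \<open>\<phi> k [l]\<close>, so the path spells \<open>\<phi> (- k)\<close> of the quotient.
\<close>
definition row_word :: "'a word \<Rightarrow> 'a word \<Rightarrow> int \<Rightarrow> 'a word" where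
  "row_word b a k = \<phi> (- k) (inv\<^bsub>F\<^esub> b \<otimes>\<^bsub>F\<^esub> a)"

definition row :: "'a word \<Rightarrow> 'a word \<Rightarrow> int \<Rightarrow> 'a point set" where
  "row b a k = (\<lambda>i. (b, k) \<cdot> (take i (row_word b a k), 0)) ` {..length (row_word b a k)}"

text \<open>
  The integral around the boundary of the disc formed by the rows between the levels \<open>k\<close> and \<open>k + n\<close>.
\<close>
definition loop_int :: "'a form \<Rightarrow>
    'a word \<Rightarrow> 'a word \<Rightarrow> int \<Rightarrow> nat \<Rightarrow> real" where
  "loop_int \<omega> b a k n =
     hint \<omega> (b, k) (row_word b a k) + vint \<omega> a k n
     - hint \<omega> (b, k + int n) (row_word b a (k + int n)) - vint \<omega> b k n"

lemma row_word_F: "\<lbrakk>a \<in> carrier F; b \<in> carrier F\<rbrakk> \<Longrightarrow> row_word b a k \<in> carrier F"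
  by (simp add: row_word_def \<phi>_closed)

lemma row_end: "\<lbrakk>a \<in> carrier F; b \<in> carrier F\<rbrakk> \<Longrightarrow> (b, k) \<cdot> (row_word b a k, 0) = (a, k)"
  by (simp add: row_word_def \<phi>_minus(1) [of _ "k"] F.m_assoc [symmetric])

lemma \<phi>_row_word:
  "\<lbrakk>a \<in> carrier F; b \<in> carrier F\<rbrakk> \<Longrightarrow> \<phi> (- 1) (row_word b a k) = row_word b a (k + 1)"
proof -
  assume C: "a \<in> carrier F" "b \<in> carrier F"
  have k: "- (k + 1) = - 1 + - k" by simp
  show ?thesis unfolding row_word_def k using C by (intro \<phi>_add [symmetric]) simp
qed

lemma row_G: "\<lbrakk>a \<in> carrier F; b \<in> carrier F\<rbrakk> \<Longrightarrow> row b a k \<subseteq> carrier G"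
  by (auto simp: row_def \<phi>_closed take_free_group row_word_F)

lemma row_ends:
  assumes "a \<in> carrier F" "b \<in> carrier F"
  shows "(a, k) \<in> row b a k" "(b, k) \<in> row b a k"
proof -
  show "(a, k) \<in> row b a k"
    unfolding row_def using row_end [OF assms, of k] by (intro image_eqI [of _ _ "length (row_word b a k)"]) auto
  show "(b, k) \<in> row b a k"
    unfolding row_def using assms by (intro image_eqI [of _ _ 0]) (auto simp: \<phi>_Nil)
qed

lemma loop_int_cong:
  assumes a: "a \<in> carrier F" and b: "b \<in> carrier F"
    and eq: "\<And>x s. \<lbrakk>x \<in> row b a k \<union> row b a (k + int n) \<union> {a, b} \<times> {k..k + int n}; s \<in> steps\<rbrakk> \<Longrightarrow>
      \<omega> x (x \<cdot> s) = \<omega>' x (x \<cdot> s) + h (x \<cdot> s) - h x"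
  shows "loop_int \<omega> b a k n = loop_int \<omega>' b a k n"
proof -
  have letter: "([l], 0) \<in> steps" if "fst l \<in> X" for l :: "'a \<times> bool"
    using that by (rule steps_mem)
  have h: "hint \<omega> (b, j) (row_word b a j) = hint \<omega>' (b, j) (row_word b a j) + h (a, j) - h (b, j)"
    if j: "j = k \<or> j = k + int n" for j
  proof -
    have "hint \<omega> (b, j) (row_word b a j) = hint \<omega>' (b, j) (row_word b a j) +
        h ((b, j) \<cdot> (row_word b a j, 0)) - h (b, j)"
    proof (rule hint_cong)
      fix i and l :: "'a \<times> bool" assume i: "i < length (row_word b a j)" and l: "fst l \<in> X"
      have "(b, j) \<cdot> (take i (row_word b a j), 0) \<in> row b a j"
        unfolding row_def using i by (intro imageI) simp
      then show "\<omega> ((b, j) \<cdot> (take i (row_word b a j), 0)) ((b, j) \<cdot> (take i (row_word b a j), 0) \<cdot> ([l], 0)) =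
         \<omega>' ((b, j) \<cdot> (take i (row_word b a j), 0)) ((b, j) \<cdot> (take i (row_word b a j), 0) \<cdot> ([l], 0)) +
         h ((b, j) \<cdot> (take i (row_word b a j), 0) \<cdot> ([l], 0)) - h ((b, j) \<cdot> (take i (row_word b a j), 0))"
        using j by (intro eq letter l) auto
    qed (use a b row_word_F in auto)
    then show ?thesis unfolding row_end [OF a b] .
  qed
  have v: "vint \<omega> c k n = vint \<omega>' c k n + h (c, k + int n) - h (c, k)" if c: "c \<in> {a, b}" for c
  proof (rule vint_cong)
    fix i assume i: "i < n"
    have e: "(c, k + int i) \<cdot> ([], 1) = (c, k + int i + 1)" using c a b by (auto simp: \<phi>_Nil)
    have "([], 1) \<in> steps" by (rule steps_mem)
    moreover have "(c, k + int i) \<in> row b a k \<union> row b a (k + int n) \<union> {a, b} \<times> {k..k + int n}"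
      using c i by auto
    ultimately show "\<omega> (c, k + int i) (c, k + int i + 1) =
      \<omega>' (c, k + int i) (c, k + int i + 1) + h (c, k + int i + 1) - h (c, k + int i)"
      using eq [of "(c, k + int i)" "([], 1)"] unfolding e by blast
  qed
  show ?thesis
    unfolding loop_int_def using h [of k] h [of "k + int n"] v [of a] v [of b] by simp
qed

lemma loop_int_zero [simp]: "loop_int (\<lambda>_ _. 0) b a k n = 0"
  by (simp add: loop_int_def)

lemma loop_int_sum:
  "loop_int (\<lambda>x y. \<Sum>s\<in>S. c s * \<omega> s x y) b a k n = (\<Sum>s\<in>S. c s * loop_int (\<omega> s) b a k n)"
  by (simp add: loop_int_def hint_sum vint_sum algebra_simps sum.distrib sum_subtractf)

text \<open>
  The rows between two levels form a disc that is tiled by cells. So a form that is exact on every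
  cell of the disc has integral zero around its boundary.
\<close>
lemma loop_int_exact_disc:
  assumes \<omega>: "antisymmetric \<omega>" and a: "a \<in> carrier F" and b: "b \<in> carrier F"
    and ex: "\<And>j s. \<lbrakk>k \<le> j; j \<le> k + int n; s \<in> row b a j\<rbrakk> \<Longrightarrow> exact_on ((\<lambda>c. s \<cdot> c) ` cell) \<omega>"
  shows "loop_int \<omega> b a k n = 0"
  using ex
proof (induction n)
  case 0
  show ?case by (simp add: loop_int_def vint_def)
next
  case (Suc n)
  let ?j = "k + int n" and ?w = "row_word b a (k + int n)"
  have IH: "loop_int \<omega> b a k n = 0" by (rule Suc.IH, rule Suc.prems) auto
  have w: "?w \<in> carrier F" by (rule row_word_F [OF a b])
  have up: "(c, ?j) \<cdot> ([], 1) = (c, ?j + 1)" if "c \<in> carrier F" for c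
    using that by (simp add: \<phi>_Nil)
  have "hint \<omega> (b, ?j) ?w + \<omega> (a, ?j) (a, ?j + 1) =
      \<omega> (b, ?j) (b, ?j + 1) + hint \<omega> (b, ?j + 1) (row_word b a (?j + 1))"
    using strip [OF \<omega> _ w, of "(b, ?j)"] Suc.prems [of ?j] b
    unfolding row_def row_end [OF a b] up [OF a] up [OF b] \<phi>_row_word [OF a b] by (simp del: mult_G)
  then show ?case using IH by (simp add: loop_int_def vint_def add_ac)
qed

text \<open>
  If \<open>\<beta>\<close> vanishes on the lowest row and is one on the highest, only the latter contributes, and
  along it the form is \<open>d\<alpha>\<close>.
\<close>
lemma loop_int_wedge:
  assumes a: "a \<in> carrier F" and b: "b \<in> carrier F"
    and low: "\<And>u. \<beta> (u, k) = 0" and high: "\<And>u. \<beta> (u, k + int n) = 1"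
    and \<alpha>: "\<And>u j. \<alpha> (u, j) = \<gamma> u"
  shows "loop_int (wedge \<beta> \<alpha>) b a k n = \<gamma> b - \<gamma> a"
proof -
  have h: "hint (wedge \<beta> \<alpha>) (b, j) (row_word b a j) = \<beta> ([], j) * (\<gamma> a - \<gamma> b)"
    if j: "\<And>u. \<beta> (u, j) = \<beta> ([], j)" for j
  proof -
    have "hint (wedge \<beta> \<alpha>) (b, j) (row_word b a j) = hint (\<lambda>_ _. 0) (b, j) (row_word b a j) +
        \<beta> ([], j) * \<gamma> (fst ((b, j) \<cdot> (row_word b a j, 0))) - \<beta> ([], j) * \<gamma> (fst (b, j))"
    proof (rule hint_cong)
      fix i l
      obtain u where u: "(b, j) \<cdot> (take i (row_word b a j), 0) = (u, j)" by simp
      show "wedge \<beta> \<alpha> ((b, j) \<cdot> (take i (row_word b a j), 0)) ((b, j) \<cdot> (take i (row_word b a j), 0) \<cdot> ([l], 0)) =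
          0 + \<beta> ([], j) * \<gamma> (fst ((b, j) \<cdot> (take i (row_word b a j), 0) \<cdot> ([l], 0)))
          - \<beta> ([], j) * \<gamma> (fst ((b, j) \<cdot> (take i (row_word b a j), 0)))"
        unfolding u by (simp add: wedge_def \<alpha> j [of u] j [of "u \<otimes>\<^bsub>F\<^esub> \<phi> j [l]"] algebra_simps)
    qed (use a b row_word_F in auto)
    then show ?thesis unfolding row_end [OF a b] by (simp add: algebra_simps)
  qed
  have "vint (wedge \<beta> \<alpha>) c k n = 0" for c by (simp add: vint_def wedge_def \<alpha>)
  then show ?thesis using h [of k] h [of "k + int n"] low high by (simp add: loop_int_def)
qed

end


section \<open>Stokes' theorem in the product of a tree and a line\<close>

locale free_times_int =
  fixes X :: "'a set"
  assumes finite_X: "finite X"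
begin

sublocale free_by_int X "\<lambda>_ x. x"
  using finite_X by unfold_locales (simp_all add: group.is_monoid group_free_group monoid.m_closed)

abbreviation multT (infixl "\<cdot>" 70) where "x \<cdot> y \<equiv> x \<otimes>\<^bsub>G\<^esub> y"

definition vert :: "'a form \<Rightarrow>
    'a word \<Rightarrow> int \<Rightarrow> int \<Rightarrow> real" where
  "vert \<omega> a k k' = (\<Sum>j\<in>{k..<k'}. \<omega> (a, j) (a, j + 1)) - (\<Sum>j\<in>{k'..<k}. \<omega> (a, j) (a, j + 1))"

lemma vert_add1: "vert \<omega> a k (j + 1) = vert \<omega> a k j + \<omega> (a, j) (a, j + 1)"
proof (cases "k \<le> j")
  case True
  then have "{k..<j + 1} = insert j {k..<j}" by auto
  then show ?thesis using True by (simp add: vert_def)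
next
  case False
  then have "{j..<k} = insert j {j + 1..<k}" by auto
  then show ?thesis using False by (simp add: vert_def)
qed

lemma vert_refl [simp]: "vert \<omega> a k k = 0"
  by (simp add: vert_def)

text \<open>
  The square \<open>(v, k)\<close> has the edge from \<open>butlast v\<close> to \<open>v\<close> as its base, at height \<open>k\<close>. Every edge of the tree
  is of this form for exactly one nonempty reduced word \<open>v\<close>. The curvature is the integral around the
  boundary of the square.
\<close>
definition curvature :: "'a form \<Rightarrow>
    'a point \<Rightarrow> real" where
  "curvature \<omega> = (\<lambda>(v, k). \<omega> (butlast v, k) (v, k) + \<omega> (v, k) (v, k + 1)
     - \<omega> (butlast v, k + 1) (v, k + 1) - \<omega> (butlast v, k) (butlast v, k + 1))"

definition squares :: "'a point set" where
  "squares = (carrier F - {[]}) \<times> UNIV"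

text \<open>
  A potential is obtained by integrating first within level \<open>0\<close> and then vertically. It is a
  potential along the edges of level \<open>0\<close> because the level is a tree, and vanishing curvature carries
  this property from each level to the neighbouring ones.
\<close>
lemma closed_imp_exact:
  assumes \<omega>: "antisymmetric \<omega>" and closed: "\<And>\<sigma>. \<sigma> \<in> squares \<Longrightarrow> curvature \<omega> \<sigma> = 0"
  shows "\<exists>H. \<forall>y\<in>carrier G. \<forall>s\<in>steps. \<omega> y (y \<cdot> s) = H (y \<cdot> s) - H y"
proof -
  define H where "H = (\<lambda>(u, k). hint \<omega> ([], 0) u + vert \<omega> u 0 k)"
  have anti: "\<omega> y x = - \<omega> x y" for x y using \<omega> unfolding antisymmetric_def by blast
  have "\<omega> y (y \<cdot> s) = H (y \<cdot> s) - H y" if y: "y \<in> carrier G" and s: "s \<in> steps" for y s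
  proof -
    obtain u k where y': "y = (u, k)" "u \<in> carrier F" using y by (cases y) simp
    from s show ?thesis
    proof (cases rule: steps_cases)
      case 1
      then have "y \<cdot> s = (u, k + 1)" using y' by simp
      then show ?thesis unfolding H_def y'(1) using vert_add1 [of \<omega> u 0 k] by simp
    next
      case (2 l)
      define u' where "u' = u \<otimes>\<^bsub>F\<^esub> [l]"
      have u': "u' \<in> carrier F" using y' 2 by (simp add: u'_def)
      have base: "hint \<omega> ([], 0) u' = hint \<omega> ([], 0) u + \<omega> (u, 0) (u', 0)"
        using hint_mult [OF \<omega> y'(2), of "[l]" "([], 0)"] 2 by (simp add: u'_def)
      have square: "\<omega> (u, j) (u', j) + \<omega> (u', j) (u', j + 1) = \<omega> (u, j) (u, j + 1) + \<omega> (u, j + 1) (u', j + 1)" for j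
      proof (rule free_group_mult_cases [OF y'(2), of "[l]"])
        fix p r q assume h: "u = p @ r" "[l] = map inv_letter (rev r) @ q" "u \<otimes>\<^bsub>F\<^esub> [l] = p @ q"
        show ?thesis
        proof (cases r)
          case Nil
          then have "u' = u @ [l]" using h by (simp add: u'_def)
          then show ?thesis using closed [of "(u', j)"] u' by (simp add: squares_def curvature_def)
        next
          case (Cons k' r')
          then have "u = u' @ [k']" using h by (simp add: u'_def append_eq_Cons_conv Cons_eq_append_conv)
          then have "\<omega> (u', j) (u, j) + \<omega> (u, j) (u, j + 1) - \<omega> (u', j + 1) (u, j + 1) - \<omega> (u', j) (u', j + 1) = 0"
            using closed [of "(u, j)"] y'(2) by (simp add: squares_def curvature_def)
          then show ?thesis using anti [of "(u', j)" "(u, j)"] anti [of "(u', j + 1)" "(u, j + 1)"] by linarith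
        qed
      qed
      define d where "d j = \<omega> (u, j) (u', j) + vert \<omega> u 0 j - vert \<omega> u' 0 j" for j
      have d1: "d (j + 1) = d j" for j
        using square [of j] by (simp add: d_def vert_add1)
      have "d k = d 0"
      proof (induction k rule: int_induct [where k = 0])
        case (step2 i)
        then show ?case using d1 [of "i - 1"] by simp
      qed (use d1 in auto)
      then show ?thesis
        using 2 y' base by (simp add: H_def d_def u'_def)
    qed
  qed
  then show ?thesis by blast
qed

lemma curvature_dual_form:
  assumes "\<sigma>' \<in> squares"
  shows "curvature (dual_form \<sigma>) \<sigma>' = - of_bool (\<sigma> = \<sigma>')"
proof -
  obtain v k v' k' where [simp]: "\<sigma> = (v, k)" "\<sigma>' = (v', k')" by force
  have "v' \<noteq> []" using assms by (simp add: squares_def)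
  then obtain u x where [simp]: "v' = u @ [x]" by (metis append_butlast_last_id)
  have "prefix v (u @ [x]) \<longleftrightarrow> v = u @ [x] \<or> prefix v u" by (rule prefix_snoc)
  moreover have "\<not> prefix (u @ [x]) u" by (auto simp: prefix_def)
  ultimately show ?thesis
    by (auto simp: curvature_def dual_form_def wedge_def height_above_def beyond_def)
qed

text \<open>
  Stokes' theorem on \<open>F \<times> \<int>\<close>. The form \<open>dual_form \<sigma>\<close> has curvature at the square \<open>\<sigma>\<close> only, so a form
  with finitely many curved squares becomes closed, hence exact, after adding multiples of these.
\<close>
lemma exact_up_to_dual_forms:
  assumes \<omega>: "antisymmetric \<omega>" and fin: "finite {\<sigma> \<in> squares. curvature \<omega> \<sigma> \<noteq> 0}"
  shows "\<exists>H. \<forall>y\<in>carrier G. \<forall>s\<in>steps. \<omega> y (y \<cdot> s) =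
      (\<Sum>\<sigma>\<in>{\<sigma> \<in> squares. curvature \<omega> \<sigma> \<noteq> 0}. - curvature \<omega> \<sigma> * dual_form \<sigma> y (y \<cdot> s)) + H (y \<cdot> s) - H y"
proof -
  let ?S = "{\<sigma> \<in> squares. curvature \<omega> \<sigma> \<noteq> 0}"
  define \<omega>' where "\<omega>' x y = \<omega> x y + (\<Sum>\<sigma>\<in>?S. curvature \<omega> \<sigma> * dual_form \<sigma> x y)" for x y
  have anti: "antisymmetric \<omega>'"
    unfolding antisymmetric_def
  proof (intro allI)
    fix x y
    have "\<omega> y x = - \<omega> x y" "dual_form \<sigma> y x = - dual_form \<sigma> x y" for \<sigma>
      using \<omega> antisymmetric_dual_form unfolding antisymmetric_def by blast+
    then have "\<omega>' y x = - \<omega> x y + (\<Sum>\<sigma>\<in>?S. curvature \<omega> \<sigma> * - dual_form \<sigma> x y)"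
      unfolding \<omega>'_def by presburger
    then show "\<omega>' y x = - \<omega>' x y" by (simp add: \<omega>'_def sum_negf)
  qed
  have "curvature \<omega>' \<sigma>' = 0" if \<sigma>': "\<sigma>' \<in> squares" for \<sigma>'
  proof -
    have "curvature \<omega>' \<sigma>' = curvature \<omega> \<sigma>' + (\<Sum>\<sigma>\<in>?S. curvature \<omega> \<sigma> * curvature (dual_form \<sigma>) \<sigma>')"
      unfolding \<omega>'_def
      by (cases \<sigma>') (simp add: curvature_def sum.distrib sum_subtractf algebra_simps)
    also have "(\<Sum>\<sigma>\<in>?S. curvature \<omega> \<sigma> * curvature (dual_form \<sigma>) \<sigma>') = (\<Sum>\<sigma>\<in>?S. if \<sigma> = \<sigma>' then - curvature \<omega> \<sigma>' else 0)"
      by (rule sum.cong) (auto simp: curvature_dual_form [OF \<sigma>'])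
    also have "\<dots> = (if \<sigma>' \<in> ?S then - curvature \<omega> \<sigma>' else 0)"
      by (rule sum.delta [OF fin])
    finally show ?thesis using \<sigma>' by (auto split: if_splits)
  qed
  from closed_imp_exact [OF anti this] obtain H where
    "\<And>y s. \<lbrakk>y \<in> carrier G; s \<in> steps\<rbrakk> \<Longrightarrow> \<omega>' y (y \<cdot> s) = H (y \<cdot> s) - H y"
    by blast
  then have "\<omega> y (y \<cdot> s) =
      (\<Sum>\<sigma>\<in>?S. - curvature \<omega> \<sigma> * dual_form \<sigma> y (y \<cdot> s)) + H (y \<cdot> s) - H y"
    if "y \<in> carrier G" "s \<in> steps" for y s
    using that by (simp add: \<omega>'_def sum_negf algebra_simps)
  then show ?thesis by blast
qed

text \<open>
  The integral along the path from \<open>y\<close> to the product of \<open>y\<close> and \<open>b\<close> that goes horizontally first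
  and then vertically; \<open>trail b\<close> is this path for \<open>y = 1\<close>.
\<close>
definition segment_int :: "'a form \<Rightarrow>
    'a point \<Rightarrow> 'a point \<Rightarrow> real" where
  "segment_int \<omega> y b = hint \<omega> y (fst b) + vert \<omega> (fst y \<otimes>\<^bsub>F\<^esub> fst b) (snd y) (snd y + snd b)"

definition trail :: "'a point \<Rightarrow> 'a point set" where
  "trail b = (\<lambda>i. (take i (fst b), 0)) ` {..length (fst b)} \<union> {fst b} \<times> {min 0 (snd b)..max 0 (snd b)}"

lemma finite_trail: "finite (trail b)"
  by (simp add: trail_def)

lemma trail_G: "b \<in> carrier G \<Longrightarrow> trail b \<subseteq> carrier G"
  by (auto simp: trail_def carrier_G take_free_group)

lemma vert_cong:
  assumes "\<And>j. \<lbrakk>min k k' \<le> j; j \<le> max k k'\<rbrakk> \<Longrightarrow>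
    \<omega> (a, j) (a, j + 1) = \<omega>' (a, j) (a, j + 1) + h (a, j + 1) - h (a, j)"
  shows "vert \<omega> a k k' = vert \<omega>' a k k' + h (a, k') - h (a, k)"
proof -
  have tele: "(\<Sum>j\<in>{k..<k'}. g (j + 1) - g j) = g k' - g k" if "k \<le> k'" for g :: "int \<Rightarrow> real" and k k'
    using that
  proof (induction k' rule: int_ge_induct)
    case (step i)
    then have "{k..<i + 1} = insert i {k..<i}" by auto
    then show ?case using step by simp
  qed simp
  have *: "(\<Sum>j\<in>{m..<m'}. \<omega> (a, j) (a, j + 1)) = (\<Sum>j\<in>{m..<m'}. \<omega>' (a, j) (a, j + 1)) + (\<Sum>j\<in>{m..<m'}. h (a, j + 1) - h (a, j))"
    if "min k k' \<le> m" "m' \<le> max k k'" for m m'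
    unfolding sum.distrib [symmetric] using assms that by (intro sum.cong) auto
  show ?thesis
    using *[of k k'] * [of k' k] tele [of k k' "\<lambda>j. h (a, j)"] tele [of k' k "\<lambda>j. h (a, j)"]
    by (cases "k \<le> k'") (auto simp: vert_def)
qed

lemma segment_int_cong:
  assumes y: "y \<in> carrier G" and b: "b \<in> carrier G"
    and eq: "\<And>p s. \<lbrakk>p \<in> trail b; s \<in> steps\<rbrakk> \<Longrightarrow> \<omega> (y \<cdot> p) (y \<cdot> p \<cdot> s) =
      \<omega>' (y \<cdot> p) (y \<cdot> p \<cdot> s) + h (y \<cdot> p \<cdot> s) - h (y \<cdot> p)"
  shows "segment_int \<omega> y b = segment_int \<omega>' y b + h (y \<cdot> b) - h y"
proof -
  obtain u k c j where [simp]: "y = (u, k)" "b = (c, j)" and C: "u \<in> carrier F" "c \<in> carrier F"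
    using y b by (auto simp: carrier_G)
  have "hint \<omega> y c = hint \<omega>' y c + h (y \<cdot> (c, 0)) - h y"
  proof (rule hint_cong [OF y C(2)])
    fix i and l :: "'a \<times> bool" assume "i < length c" "fst l \<in> X"
    then have "(take i c, 0) \<in> trail b" "([l], 0) \<in> steps"
      by (simp_all add: trail_def steps_mem)
    then show "\<omega> (y \<cdot> (take i c, 0)) (y \<cdot> (take i c, 0) \<cdot> ([l], 0)) =
         \<omega>' (y \<cdot> (take i c, 0)) (y \<cdot> (take i c, 0) \<cdot> ([l], 0)) +
         h (y \<cdot> (take i c, 0) \<cdot> ([l], 0)) - h (y \<cdot> (take i c, 0))"
      by (rule eq)
  qed
  moreover have "vert \<omega> (u \<otimes>\<^bsub>F\<^esub> c) k (k + j) = vert \<omega>' (u \<otimes>\<^bsub>F\<^esub> c) k (k + j) + h (u \<otimes>\<^bsub>F\<^esub> c, k + j) - h (u \<otimes>\<^bsub>F\<^esub> c, k)"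
  proof (rule vert_cong)
    fix i assume "min k (k + j) \<le> i" "i \<le> max k (k + j)"
    then have "(c, i - k) \<in> trail b" "([], 1) \<in> steps" by (auto simp: trail_def steps_mem)
    from eq [OF this] show "\<omega> (u \<otimes>\<^bsub>F\<^esub> c, i) (u \<otimes>\<^bsub>F\<^esub> c, i + 1) = \<omega>' (u \<otimes>\<^bsub>F\<^esub> c, i) (u \<otimes>\<^bsub>F\<^esub> c, i + 1) +
        h (u \<otimes>\<^bsub>F\<^esub> c, i + 1) - h (u \<otimes>\<^bsub>F\<^esub> c, i)"
      using C by simp
  qed
  ultimately show ?thesis by (simp add: segment_int_def)
qed

lemma segment_int_sum:
  "segment_int (\<lambda>x y. \<Sum>s\<in>S. c s * \<omega> s x y) y b = (\<Sum>s\<in>S. c s * segment_int (\<omega> s) y b)"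
proof -
  have v: "vert (\<lambda>x y. \<Sum>s\<in>S. c s * \<omega> s x y) a k k' = (\<Sum>s\<in>S. c s * vert (\<omega> s) a k k')" for a k k'
    unfolding vert_def right_diff_distrib sum_subtractf sum_distrib_left
    by (subst (1 2) sum.swap) simp
  show ?thesis unfolding segment_int_def v hint_sum by (simp add: sum.distrib algebra_simps)
qed

end


section \<open>Exactness of the winding forms\<close>

context free_by_int
begin

lemma not_exact_dual_form:
  assumes x: "(u, m) \<in> carrier G" and B: "B \<subseteq> carrier G" and v: "v \<in> carrier F"
    and nex: "\<not> exact_on (insert (u, m) ((\<lambda>b. (u, m) \<cdot> b) ` B)) (dual_form (v, k))"
  shows "\<exists>b\<in>B. \<exists>c\<in>B. \<bar>k - m\<bar> \<le> \<bar>snd b\<bar> \<and> length (inv\<^bsub>F\<^esub> u \<otimes>\<^bsub>F\<^esub> v) \<le> 2 * length (\<phi> m (fst c))"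
proof -
  let ?U = "insert (u, m) ((\<lambda>b. (u, m) \<cdot> b) ` B)"
  have *: "\<exists>b\<in>B. h ((u, m) \<cdot> b) \<noteq> h (u, m)" if "\<not> constant_on_set ?U h" for h
    using that unfolding constant_on_set_def by (metis (no_types, lifting) image_iff insert_iff)
  have nc: "\<not> constant_on_set ?U (height_above k)" "\<not> constant_on_set ?U (beyond v)"
    using nex exact_on_wedge [of ?U "height_above k" "beyond v"] by (auto simp: dual_form_def)
  obtain b where b: "b \<in> B" "height_above k ((u, m) \<cdot> b) \<noteq> height_above k (u, m)"
    using * [OF nc(1)] by blast
  obtain c where c: "c \<in> B" "beyond v ((u, m) \<cdot> c) \<noteq> beyond v (u, m)"
    using * [OF nc(2)] by blast
  have "\<bar>k - m\<bar> \<le> \<bar>snd b\<bar>"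
    using b(2) by (cases b) (auto simp: height_above_def of_bool_def split: if_splits)
  moreover have "length (inv\<^bsub>F\<^esub> u \<otimes>\<^bsub>F\<^esub> v) \<le> 2 * length (\<phi> m (fst c))"
  proof (rule crossing_near_edge)
    show "\<phi> m (fst c) \<in> carrier F" using c(1) B by (cases c) (auto simp: \<phi>_closed)
    show "prefix v u \<noteq> prefix v (u \<otimes>\<^bsub>F\<^esub> \<phi> m (fst c))"
      using c(2) by (cases c) (auto simp: beyond_def of_bool_def split: if_splits)
  qed (use x v in auto)
  ultimately show ?thesis using b(1) c(1) by blast
qed

text \<open>
  The two functions whose wedge is \<open>dual_form (v, k)\<close> vary near a level and near an edge
  translated along the \<open>\<int>\<close>-direction, and these two regions of \<open>G\<close> meet in a bounded set. Hence
  the form is closed outside a finite set.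
\<close>
lemma finite_not_exact_dual_form:
  assumes "finite B" "B \<subseteq> carrier G" "v \<in> carrier F"
  shows "finite {x \<in> carrier G. \<not> exact_on (insert x ((\<lambda>b. x \<cdot> b) ` B)) (dual_form (v, k))}"
    (is "finite ?Z")
proof -
  define ball where "ball N = {w \<in> carrier F. length w \<le> N}" for N
  define R where "R = (\<Union>b\<in>B. \<Union>m\<in>{k - \<bar>snd b\<bar>..k + \<bar>snd b\<bar>}. \<Union>c\<in>B.
      ball (length v + 2 * length (\<phi> m (fst c))) \<times> {m})"
  have "?Z \<subseteq> R"
  proof
    fix x assume x: "x \<in> ?Z"
    obtain u m where [simp]: "x = (u, m)" by (cases x)
    have u: "u \<in> carrier F" using x by simp
    obtain b c where bc: "b \<in> B" "c \<in> B" "\<bar>k - m\<bar> \<le> \<bar>snd b\<bar>"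
        "length (inv\<^bsub>F\<^esub> u \<otimes>\<^bsub>F\<^esub> v) \<le> 2 * length (\<phi> m (fst c))"
      using not_exact_dual_form [of u m B v k] x assms by auto
    let ?w = "inv\<^bsub>F\<^esub> u \<otimes>\<^bsub>F\<^esub> v"
    have "u = v \<otimes>\<^bsub>F\<^esub> inv\<^bsub>F\<^esub> ?w"
      using u assms(3) by (simp add: F.inv_mult_group F.m_assoc [symmetric])
    then have "length u \<le> length v + length (inv\<^bsub>F\<^esub> ?w)"
      using length_free_group_mult [OF assms(3)] by metis
    then have "length u \<le> length v + 2 * length (\<phi> m (fst c))"
      using bc(4) u assms(3) by (simp add: length_inv_free_group)
    then have "x \<in> ball (length v + 2 * length (\<phi> m (fst c))) \<times> {m}" using u by (simp add: ball_def)
    moreover have "m \<in> {k - \<bar>snd b\<bar>..k + \<bar>snd b\<bar>}" using bc(3) by auto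
    ultimately show "x \<in> R" unfolding R_def using bc(1,2) by blast
  qed
  moreover have "finite R"
    using assms(1) finite_words_length_le [OF X_finite] by (auto simp: R_def ball_def)
  ultimately show ?thesis by (rule finite_subset)
qed

end

context free_times_int
begin

text \<open>
  In the product \<open>F \<times> \<int>\<close> the same bound is uniform: it depends neither on the edge nor on the
  level.
\<close>
lemma uniformly_exact_dual_form:
  assumes "finite B" "B \<subseteq> carrier G"
  shows "\<exists>E. finite E \<and> E \<subseteq> carrier G \<and> (\<forall>y\<in>carrier G. \<forall>v\<in>carrier F. \<forall>k.
      \<not> exact_on (insert y ((\<lambda>b. y \<cdot> b) ` B)) (dual_form (v, k)) \<longrightarrow>
      (\<exists>e\<in>E. (v, k) = y \<cdot> e))"
proof -
  define E where "E = (\<Union>b\<in>B. \<Union>c\<in>B. {w \<in> carrier F. length w \<le> 2 * length (fst c)} \<times> {- \<bar>snd b\<bar>..\<bar>snd b\<bar>})"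
  have "finite E" using assms(1) finite_words_length_le [OF X_finite] by (auto simp: E_def)
  moreover have "E \<subseteq> carrier G" by (auto simp: E_def)
  moreover have "\<exists>e\<in>E. (v, k) = y \<cdot> e"
    if y: "y \<in> carrier G" and v: "v \<in> carrier F"
      and nex: "\<not> exact_on (insert y ((\<lambda>b. y \<cdot> b) ` B)) (dual_form (v, k))" for y v k
  proof -
    obtain u m where [simp]: "y = (u, m)" by (cases y)
    have u: "u \<in> carrier F" using y by simp
    obtain b c where bc: "b \<in> B" "c \<in> B" "\<bar>k - m\<bar> \<le> \<bar>snd b\<bar>"
        "length (inv\<^bsub>F\<^esub> u \<otimes>\<^bsub>F\<^esub> v) \<le> 2 * length (fst c)"
      using not_exact_dual_form [of u m B v k] y v nex assms by auto
    have "(inv\<^bsub>F\<^esub> u \<otimes>\<^bsub>F\<^esub> v, k - m) \<in> {w \<in> carrier F. length w \<le> 2 * length (fst c)} \<times> {- \<bar>snd b\<bar>..\<bar>snd b\<bar>}"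
      using bc u v by auto
    then have "(inv\<^bsub>F\<^esub> u \<otimes>\<^bsub>F\<^esub> v, k - m) \<in> E" unfolding E_def using bc(1,2) by blast
    moreover have "(v, k) = y \<cdot> (inv\<^bsub>F\<^esub> u \<otimes>\<^bsub>F\<^esub> v, k - m)"
      using u v by (simp add: F.m_assoc [symmetric])
    ultimately show ?thesis by blast
  qed
  ultimately show ?thesis by (intro exI [of _ E] conjI ballI allI impI)
qed

end

section \<open>Coarse equivalences\<close>

text \<open>
  In the word metric of a finite generating set, a family of pairs of points is at bounded distance if and
  only if the pairs differ by right multiplication with the elements of some finite set. Stating coarse notions in these terms
  keeps them free of generating sets and of constants.
\<close>
definition coarse_map :: "('a, 'c) monoid_scheme \<Rightarrow> ('b, 'd) monoid_scheme \<Rightarrow> ('a \<Rightarrow> 'b) \<Rightarrow> bool" where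
  "coarse_map G H f \<longleftrightarrow> f \<in> carrier G \<rightarrow> carrier H \<and>
     (\<forall>B. finite B \<longrightarrow> B \<subseteq> carrier G \<longrightarrow>
       (\<exists>C. finite C \<and> C \<subseteq> carrier H \<and> (\<forall>x\<in>carrier G. \<forall>b\<in>B. \<exists>c\<in>C. f (x \<otimes>\<^bsub>G\<^esub> b) = f x \<otimes>\<^bsub>H\<^esub> c)))"

definition close_to_id :: "('a, 'c) monoid_scheme \<Rightarrow> ('a \<Rightarrow> 'a) \<Rightarrow> bool" where
  "close_to_id G h \<longleftrightarrow> (\<exists>C. finite C \<and> C \<subseteq> carrier G \<and> (\<forall>x\<in>carrier G. \<exists>c\<in>C. h x = x \<otimes>\<^bsub>G\<^esub> c))"

lemma finite_mult_set:
  "finite A \<Longrightarrow> finite B \<Longrightarrow> finite {a \<otimes>\<^bsub>G\<^esub> b | a b. a \<in> A \<and> b \<in> B}"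
  using finite_image_set2 [of "\<lambda>a. a \<in> A" "\<lambda>b. b \<in> B"] by simp

text \<open>
  A map with a coarse left inverse is finite-to-one.
\<close>
lemma finite_vimage_coarse:
  assumes "group H" and hom: "h \<in> carrier G \<rightarrow> carrier H" and id: "close_to_id G (\<lambda>x. k (h x))"
    and "group G" and k: "k \<in> carrier H \<rightarrow> carrier G" and Z: "finite Z"
  shows "finite {x \<in> carrier G. h x \<in> Z}"
proof -
  interpret G: group G by fact
  obtain C where C: "finite C" "C \<subseteq> carrier G" "\<And>x. x \<in> carrier G \<Longrightarrow> \<exists>c\<in>C. k (h x) = x \<otimes>\<^bsub>G\<^esub> c"
    using id unfolding close_to_id_def by blast
  have "{x \<in> carrier G. h x \<in> Z} \<subseteq> (\<lambda>(z, c). k z \<otimes>\<^bsub>G\<^esub> inv\<^bsub>G\<^esub> c) ` (Z \<times> C)"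
  proof
    fix x assume x: "x \<in> {x \<in> carrier G. h x \<in> Z}"
    then obtain c where c: "c \<in> C" "k (h x) = x \<otimes>\<^bsub>G\<^esub> c" using C(3) by blast
    have "c \<in> carrier G" "x \<in> carrier G" using c(1) C(2) x by auto
    then have "k (h x) \<otimes>\<^bsub>G\<^esub> inv\<^bsub>G\<^esub> c = x" unfolding c(2) by (simp add: G.m_assoc)
    then show "x \<in> (\<lambda>(z, c). k z \<otimes>\<^bsub>G\<^esub> inv\<^bsub>G\<^esub> c) ` (Z \<times> C)"
      using x c(1) by (intro image_eqI [of _ _ "(h x, c)"]) auto
  qed
  then show ?thesis by (rule finite_subset) (use Z C in auto)
qed

lemma coarse_mapD:
  assumes "coarse_map G H f" "finite B" "B \<subseteq> carrier G"
  obtains C where "finite C" "C \<subseteq> carrier H"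
    "\<And>x b. \<lbrakk>x \<in> carrier G; b \<in> B\<rbrakk> \<Longrightarrow> \<exists>c\<in>C. f (x \<otimes>\<^bsub>G\<^esub> b) = f x \<otimes>\<^bsub>H\<^esub> c"
proof -
  have "\<exists>C. finite C \<and> C \<subseteq> carrier H \<and>
      (\<forall>x\<in>carrier G. \<forall>b\<in>B. \<exists>c\<in>C. f (x \<otimes>\<^bsub>G\<^esub> b) = f x \<otimes>\<^bsub>H\<^esub> c)"
    using assms unfolding coarse_map_def by simp
  then show thesis using that by (elim exE conjE) simp
qed

lemma image_star:
  assumes "\<And>b. b \<in> B \<Longrightarrow> \<exists>c\<in>C. g (m b) = m' c"
  shows "g ` insert y (m ` B) \<subseteq> insert (g y) (m' ` C)"
  using assms by auto

text \<open>
  A coarse equivalence \<open>f\<close> from a semidirect product to the product, with a coarse inverse \<open>g\<close>.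
\<close>
locale coarse_pair = X: free_by_int A \<phi> + Y: free_times_int A
  for A :: "'a set" and \<phi> :: "int \<Rightarrow> 'a word \<Rightarrow> 'a word" +
  fixes f g :: "'a point \<Rightarrow> 'a point"
  assumes f_coarse: "coarse_map X.G Y.G f" and g_coarse: "coarse_map Y.G X.G g"
    and gf_close: "close_to_id X.G (\<lambda>x. g (f x))" and fg_close: "close_to_id Y.G (\<lambda>y. f (g y))"
begin

abbreviation multX (infixl "\<cdot>\<^sub>X" 70) where "x \<cdot>\<^sub>X y \<equiv> x \<otimes>\<^bsub>X.G\<^esub> y"
abbreviation multY (infixl "\<cdot>\<^sub>Y" 70) where "x \<cdot>\<^sub>Y y \<equiv> x \<otimes>\<^bsub>Y.G\<^esub> y"

lemma f_closed: "x \<in> carrier X.G \<Longrightarrow> f x \<in> carrier Y.G"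
  using f_coarse by (auto simp: coarse_map_def)

lemma g_closed: "y \<in> carrier Y.G \<Longrightarrow> g y \<in> carrier X.G"
  using g_coarse by (auto simp: coarse_map_def)

lemma finite_f_vimage: "finite Z \<Longrightarrow> finite {x \<in> carrier X.G. f x \<in> Z}"
  by (rule finite_vimage_coarse [where k = g and H = Y.G])
    (use gf_close f_closed g_closed X.G.is_group Y.G.is_group in auto)

lemma finite_g_vimage: "finite Z \<Longrightarrow> finite {y \<in> carrier Y.G. g y \<in> Z}"
  by (rule finite_vimage_coarse [where k = f and H = X.G])
    (use fg_close f_closed g_closed X.G.is_group Y.G.is_group in auto)

text \<open>
  A path is mapped by \<open>f\<close> to a sequence of points with bounded gaps, which is completed to a path by
  horizontal and vertical segments. The integral over the segment between the images of two
  points is a form on the source again.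
\<close>
definition pull :: "'a form \<Rightarrow>
    'a point \<Rightarrow> 'a point \<Rightarrow> real" where
  "pull \<omega> x x' = Y.segment_int \<omega> (f x) (inv\<^bsub>Y.G\<^esub> f x \<cdot>\<^sub>Y f x')"

text \<open>
  The corners of a curved square have images under \<open>g\<close> that are close together and on which the original
  form is not exact. There are finitely many such places, and \<open>g\<close> is finite-to-one.
\<close>
lemma finite_curved:
  assumes l: "fst l \<in> A"
  defines "\<omega> \<equiv> (\<lambda>p q. dual_form ([l], 0) (g p) (g q))"
  shows "finite {\<sigma> \<in> Y.squares. Y.curvature \<omega> \<sigma> \<noteq> 0}" (is "finite ?S")
proof -
  define B :: "'a point set" where "B = (\<Union>x\<in>A \<times> UNIV. {([x], 0), ([x], 1)}) \<union> {([], 1)}"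
  have "finite B" "B \<subseteq> carrier Y.G" using X.X_finite by (auto simp: B_def)
  from coarse_mapD [OF g_coarse this] obtain C where C: "finite C" "C \<subseteq> carrier X.G"
    "\<And>y b. \<lbrakk>y \<in> carrier Y.G; b \<in> B\<rbrakk> \<Longrightarrow> \<exists>c\<in>C. g (y \<cdot>\<^sub>Y b) = g y \<cdot>\<^sub>X c" by metis
  define Z where "Z = {x \<in> carrier X.G. \<not> exact_on (insert x ((\<lambda>c. x \<cdot>\<^sub>X c) ` C)) (dual_form ([l], 0))}"
  have Z: "finite Z" unfolding Z_def using C l by (intro X.finite_not_exact_dual_form) auto
  have "?S \<subseteq> (\<lambda>((u, k), x). (u @ [x], k)) ` ({y \<in> carrier Y.G. g y \<in> Z} \<times> (A \<times> UNIV))"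
  proof
    fix \<sigma> assume \<sigma>: "\<sigma> \<in> ?S"
    obtain v k where [simp]: "\<sigma> = (v, k)" by (cases \<sigma>)
    have v: "v \<in> carrier Y.F" "v \<noteq> []" using \<sigma> by (auto simp: Y.squares_def)
    define u x where "u = butlast v" and "x = last v"
    have vux: "v = u @ [x]" using v by (simp add: u_def x_def)
    have ux: "u \<in> carrier Y.F" "fst x \<in> A" "u \<otimes>\<^bsub>Y.F\<^esub> [x] = v"
      using v append_free_groupD [of u "[x]" A] free_group_append [of u "[x]" A] by (auto simp: vux)
    have x: "x \<in> A \<times> UNIV" using ux by (simp add: mem_Times_iff)
    let ?y = "(u, k)"
    have y: "?y \<in> carrier Y.G" using ux by simp
    have "g ?y \<in> Z"
    proof (rule ccontr)
      assume "g ?y \<notin> Z"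
      then have "exact_on (insert (g ?y) ((\<lambda>c. g ?y \<cdot>\<^sub>X c) ` C)) (dual_form ([l], 0))"
        using g_closed [OF y] by (simp add: Z_def)
      moreover have "g ` (insert ?y ((\<lambda>b. ?y \<cdot>\<^sub>Y b) ` B)) \<subseteq> insert (g ?y) ((\<lambda>c. g ?y \<cdot>\<^sub>X c) ` C)"
        by (rule image_star [where m = "\<lambda>b. ?y \<cdot>\<^sub>Y b" and m' = "\<lambda>c. g ?y \<cdot>\<^sub>X c"])
          (rule C(3) [OF y])
      ultimately have "exact_on (insert ?y ((\<lambda>b. ?y \<cdot>\<^sub>Y b) ` B)) \<omega>"
        unfolding \<omega>_def by (intro exact_on_pullback [where g = g]) (rule exact_on_subset)
      then obtain H where H: "\<forall>p\<in>insert ?y ((\<lambda>b. ?y \<cdot>\<^sub>Y b) ` B).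
          \<forall>q\<in>insert ?y ((\<lambda>b. ?y \<cdot>\<^sub>Y b) ` B). \<omega> p q = H q - H p"
        unfolding exact_on_def ..
      have "([x], 0) \<in> B" "([x], 1) \<in> B" "([], 1) \<in> B" using x by (auto simp: B_def)
      from imageI [OF this(1), of "\<lambda>b. ?y \<cdot>\<^sub>Y b"] imageI [OF this(2), of "\<lambda>b. ?y \<cdot>\<^sub>Y b"]
        imageI [OF this(3), of "\<lambda>b. ?y \<cdot>\<^sub>Y b"]
      have mem: "(v, k) \<in> insert ?y ((\<lambda>b. ?y \<cdot>\<^sub>Y b) ` B)" "(v, k + 1) \<in> insert ?y ((\<lambda>b. ?y \<cdot>\<^sub>Y b) ` B)"
        "(u, k + 1) \<in> insert ?y ((\<lambda>b. ?y \<cdot>\<^sub>Y b) ` B)" "(u, k) \<in> insert ?y ((\<lambda>b. ?y \<cdot>\<^sub>Y b) ` B)"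
        using ux by simp_all
      note H' = bspec [OF bspec [OF H]]
      have "Y.curvature \<omega> \<sigma> = 0"
        using H' [OF mem(4) mem(1)] H' [OF mem(1) mem(2)] H' [OF mem(3) mem(2)] H' [OF mem(4) mem(3)]
        by (simp add: Y.curvature_def u_def [symmetric])
      then show False using \<sigma> by simp
    qed
    then show "\<sigma> \<in> (\<lambda>((u, k), x). (u @ [x], k)) ` ({y \<in> carrier Y.G. g y \<in> Z} \<times> (A \<times> UNIV))"
      using y x by (intro image_eqI [of _ _ "(?y, x)"]) (auto simp: vux)
  qed
  then show ?thesis
    by (rule finite_subset) (use finite_g_vimage [OF Z] X.X_finite in auto)
qed

lemma pull_cong:
  assumes x: "x \<in> carrier X.G" "x' \<in> carrier X.G"
    and b: "b \<in> carrier Y.G" "f x' = f x \<cdot>\<^sub>Y b"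
    and eq: "\<And>p s. \<lbrakk>p \<in> Y.trail b; s \<in> Y.steps\<rbrakk> \<Longrightarrow> \<omega> (f x \<cdot>\<^sub>Y p) (f x \<cdot>\<^sub>Y p \<cdot>\<^sub>Y s) =
      \<omega>' (f x \<cdot>\<^sub>Y p) (f x \<cdot>\<^sub>Y p \<cdot>\<^sub>Y s) + h (f x \<cdot>\<^sub>Y p \<cdot>\<^sub>Y s) - h (f x \<cdot>\<^sub>Y p)"
  shows "pull \<omega> x x' = pull \<omega>' x x' + h (f x') - h (f x)"
proof -
  have "inv\<^bsub>Y.G\<^esub> f x \<cdot>\<^sub>Y f x' = b"
    using f_closed [OF x(1)] b by (simp add: Y.G.m_assoc [symmetric])
  then show ?thesis
    unfolding pull_def using Y.segment_int_cong [OF f_closed [OF x(1)] b(1) eq] b(2) by simp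
qed

lemma pull_zero [simp]: "pull (\<lambda>_ _. 0) x x' = 0"
  by (simp add: pull_def Y.segment_int_def Y.vert_def)

lemma pull_sum: "pull (\<lambda>x y. \<Sum>s\<in>S. c s * \<omega> s x y) x y = (\<Sum>s\<in>S. c s * pull (\<omega> s) x y)"
  unfolding pull_def by (rule Y.segment_int_sum)

text \<open>
  A form that is exact near \<open>f x\<close> has the same integral along the connecting path as its value on
  the end points.
\<close>
lemma pull_exact:
  assumes x: "x \<in> carrier X.G" "x' \<in> carrier X.G"
    and b: "b \<in> carrier Y.G" "f x' = f x \<cdot>\<^sub>Y b"
    and U: "\<And>p. p \<in> Y.trail b \<Longrightarrow> f x \<cdot>\<^sub>Y p \<in> U"
      "\<And>p s. \<lbrakk>p \<in> Y.trail b; s \<in> Y.steps\<rbrakk> \<Longrightarrow> f x \<cdot>\<^sub>Y p \<cdot>\<^sub>Y s \<in> U"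
    and H: "\<And>p q. \<lbrakk>p \<in> U; q \<in> U\<rbrakk> \<Longrightarrow> \<omega> p q = H q - H p"
  shows "pull \<omega> x x' = H (f x') - H (f x)"
  using pull_cong [OF x b, where \<omega> = \<omega> and \<omega>' = "\<lambda>_ _. 0" and h = H] H U by simp

lemma trail_end: "b \<in> Y.trail b" "([], 0) \<in> Y.trail b"
  unfolding Y.trail_def by (cases b; force)+

text \<open>
  If \<open>a\<close> and \<open>b\<close> are far away and lie on different sides of an edge at the origin, then the boundary
  of a large disc of rows from \<open>b\<close> to \<open>a\<close> winds around the origin, and \<open>dual_form ([l], 0)\<close> detects this. Pulled back along \<open>g\<close> this form has
  only finitely many curved squares, so by Stokes' theorem the image of the boundary winds
  around one of these squares \<open>(v, k)\<close>, and as it is far away it winds around the translate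
  \<open>(v, r)\<close> as well. The disc therefore has to pass near the preimage of \<open>(v, r)\<close>.
\<close>
lemma disc_meets_vertical_line:
  assumes l: "fst l \<in> A"
  shows "\<exists>D. finite D \<and> D \<subseteq> carrier X.G \<and> (\<forall>r. \<exists>J. \<forall>a\<in>carrier X.F. \<forall>b\<in>carrier X.F.
      prefix [l] a \<longrightarrow> \<not> prefix [l] b \<longrightarrow> J < length a \<longrightarrow> J < length b \<longrightarrow>
      (\<exists>j. \<exists>s\<in>X.row b a j. \<exists>\<delta>\<in>D. s = g ([], r) \<cdot>\<^sub>X \<delta>))"
proof -
  define \<omega>X :: "'a point \<Rightarrow> 'a point \<Rightarrow> real" where "\<omega>X = dual_form ([l], 0)"
  define \<omega>Y where "\<omega>Y = (\<lambda>p q. \<omega>X (g p) (g q))"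
  define S where "S = {\<sigma> \<in> Y.squares. Y.curvature \<omega>Y \<sigma> \<noteq> 0}"
  have S: "finite S" unfolding S_def \<omega>Y_def \<omega>X_def using finite_curved [OF l] .
  have antiY: "antisymmetric \<omega>Y"
    using antisymmetric_dual_form [of "([l], 0)"] unfolding \<omega>Y_def \<omega>X_def antisymmetric_def by blast

  obtain B1 where B1: "finite B1" "B1 \<subseteq> carrier Y.G"
      "\<And>x s. \<lbrakk>x \<in> carrier X.G; s \<in> X.steps\<rbrakk> \<Longrightarrow> \<exists>b\<in>B1. f (x \<cdot>\<^sub>X s) = f x \<cdot>\<^sub>Y b"
    using coarse_mapD [OF f_coarse X.finite_steps X.steps_G] by metis
  define T1 where "T1 = (\<Union>b\<in>B1. Y.trail b)"
  define T2 where "T2 = T1 \<union> {t \<cdot>\<^sub>Y s | t s. t \<in> T1 \<and> s \<in> Y.steps}"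
  have T1: "finite T1" "T1 \<subseteq> carrier Y.G"
    unfolding T1_def using B1(1) Y.finite_trail subsetD [OF B1(2), THEN Y.trail_G] by blast+
  have T2: "finite T2" "T2 \<subseteq> carrier Y.G"
  proof -
    show "finite T2" unfolding T2_def using T1(1) finite_mult_set [OF T1(1) Y.finite_steps] by blast
    show "T2 \<subseteq> carrier Y.G"
      unfolding T2_def using T1(2) subsetD [OF T1(2)] subsetD [OF Y.steps_G] Y.G.m_closed by blast
  qed
  have trailT: "p \<in> T1" if "p \<in> Y.trail b" "b \<in> B1" for p b
    using that by (auto simp: T1_def)
  have trailT2: "p \<in> T2" "p \<cdot>\<^sub>Y s \<in> T2" if "p \<in> Y.trail b" "b \<in> B1" "s \<in> Y.steps" for p b s
    unfolding T2_def using trailT [OF that(1,2)] that(3) by blast+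
  have ftrail: "f x \<cdot>\<^sub>Y p \<cdot>\<^sub>Y s = f x \<cdot>\<^sub>Y (p \<cdot>\<^sub>Y s)"
    if "x \<in> carrier X.G" "p \<in> T1" "s \<in> Y.steps" for x p s
    using f_closed [OF that(1)] T1(2) Y.steps_G that by (intro Y.G.m_assoc) auto

  obtain C0 where C0: "finite C0" "C0 \<subseteq> carrier X.G"
      "\<And>x. x \<in> carrier X.G \<Longrightarrow> \<exists>c\<in>C0. g (f x) = x \<cdot>\<^sub>X c"
    using gf_close unfolding close_to_id_def by blast

  (* Away from a finite set, the form on the source and its pullback along g have integrals that
     differ by the coboundary of h. *)
  obtain C2 where C2: "finite C2" "C2 \<subseteq> carrier X.G"
      "\<And>y t. \<lbrakk>y \<in> carrier Y.G; t \<in> T2\<rbrakk> \<Longrightarrow> \<exists>c\<in>C2. g (y \<cdot>\<^sub>Y t) = g y \<cdot>\<^sub>X c"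
    using coarse_mapD [OF g_coarse T2] by metis
  define A1 where "A1 = X.steps \<union> C0 \<union> {c \<cdot>\<^sub>X d | c d. c \<in> C0 \<and> d \<in> C2}"
  have A1: "finite A1" "A1 \<subseteq> carrier X.G"
  proof -
    show "finite A1"
      unfolding A1_def using X.finite_steps C0(1) finite_mult_set [OF C0(1) C2(1)] by blast
    show "A1 \<subseteq> carrier X.G"
      unfolding A1_def
      using X.steps_G C0(2) subsetD [OF C0(2)] subsetD [OF C2(2)] X.G.m_closed by blast
  qed
  define Z1 where "Z1 = {x \<in> carrier X.G. \<not> exact_on (insert x ((\<lambda>b. x \<cdot>\<^sub>X b) ` A1)) \<omega>X}"
  have Z1: "finite Z1"
    unfolding Z1_def \<omega>X_def using A1 l by (intro X.finite_not_exact_dual_form) auto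
  define h where "h x = \<omega>X x (g (f x))" for x
  have pullY: "pull \<omega>Y x (x \<cdot>\<^sub>X s) = \<omega>X x (x \<cdot>\<^sub>X s) + h (x \<cdot>\<^sub>X s) - h x"
    if x: "x \<in> carrier X.G" "x \<notin> Z1" and s: "s \<in> X.steps" for x s
  proof -
    let ?U = "insert x ((\<lambda>b. x \<cdot>\<^sub>X b) ` A1)"
    have "exact_on ?U \<omega>X" using x by (simp add: Z1_def)
    then obtain H where "\<forall>p\<in>?U. \<forall>q\<in>?U. \<omega>X p q = H q - H p" unfolding exact_on_def ..
    then have H: "\<omega>X p q = H q - H p" if "p \<in> ?U" "q \<in> ?U" for p q using that by blast
    have inU: "x \<cdot>\<^sub>X c \<in> ?U" if "c \<in> A1" for c using that by blast
    have gU: "g (f x \<cdot>\<^sub>Y t) \<in> ?U" if t: "t \<in> T2" for t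
    proof -
      obtain c d where cd: "c \<in> C0" "g (f x) = x \<cdot>\<^sub>X c" "d \<in> C2"
          "g (f x \<cdot>\<^sub>Y t) = g (f x) \<cdot>\<^sub>X d"
        using C0(3) [OF x(1)] C2(3) [OF f_closed [OF x(1)] t] by blast
      have "c \<in> carrier X.G" "d \<in> carrier X.G" using cd C0 C2 by auto
      then have "g (f x \<cdot>\<^sub>Y t) = x \<cdot>\<^sub>X (c \<cdot>\<^sub>X d)"
        unfolding cd(4) cd(2) using x(1) by (rule X.G.m_assoc [rotated])
      moreover have "c \<cdot>\<^sub>X d \<in> A1" unfolding A1_def using cd(1,3) by blast
      ultimately show ?thesis using inU by metis
    qed
    have x': "x \<cdot>\<^sub>X s \<in> carrier X.G" using x(1) s X.steps_G by auto
    obtain b where b: "b \<in> B1" "f (x \<cdot>\<^sub>X s) = f x \<cdot>\<^sub>Y b" using B1(3) [OF x(1) s] by blast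
    have bC: "b \<in> carrier Y.G" using b B1 by auto
    have "pull \<omega>Y x (x \<cdot>\<^sub>X s) = H (g (f (x \<cdot>\<^sub>X s))) - H (g (f x))"
    proof (rule pull_exact [OF x(1) x' bC b(2), where U = "{y. g y \<in> ?U}" and H = "\<lambda>y. H (g y)"])
      fix p q assume "p \<in> {y. g y \<in> ?U}" "q \<in> {y. g y \<in> ?U}"
      then show "\<omega>Y p q = H (g q) - H (g p)" unfolding \<omega>Y_def by (intro H) simp_all
    next
      fix p assume p: "p \<in> Y.trail b"
      then show "f x \<cdot>\<^sub>Y p \<in> {y. g y \<in> ?U}" using gU trailT2(1) [OF p b(1) Y.steps_mem(1)] by simp
      fix t assume t: "t \<in> Y.steps"
      show "f x \<cdot>\<^sub>Y p \<cdot>\<^sub>Y t \<in> {y. g y \<in> ?U}"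
        unfolding ftrail [OF x(1) trailT [OF p b(1)] t] using gU [OF trailT2(2) [OF p b(1) t]] by simp
    qed
    moreover have "x \<in> ?U" by blast
    moreover have "x \<cdot>\<^sub>X s \<in> ?U" using s by (intro inU) (simp add: A1_def)
    moreover have "g (f (x \<cdot>\<^sub>X s)) \<in> ?U"
      using gU [OF trailT2(1) [OF trail_end(1) b(1) Y.steps_mem(1)]] b(2) by simp
    moreover have "g (f x) \<in> ?U"
      using gU [OF trailT2(1) [OF trail_end(2) b(1) Y.steps_mem(1)]] f_closed [OF x(1)] by simp
    ultimately show ?thesis
      unfolding h_def
      using H [of x "x \<cdot>\<^sub>X s"] H [of x "g (f x)"] H [of "x \<cdot>\<^sub>X s" "g (f (x \<cdot>\<^sub>X s))"]
      by linarith
  qed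

  (* By Stokes' theorem on the target, the pulled back form is a combination of the winding forms of
     the squares in S, up to the coboundary of HY. *)
  obtain HY where HY: "\<forall>y\<in>carrier Y.G. \<forall>s\<in>Y.steps. \<omega>Y y (y \<cdot>\<^sub>Y s) =
      (\<Sum>\<sigma>\<in>S. - Y.curvature \<omega>Y \<sigma> * dual_form \<sigma> y (y \<cdot>\<^sub>Y s)) + HY (y \<cdot>\<^sub>Y s) - HY y"
    using Y.exact_up_to_dual_forms [OF antiY] S unfolding S_def by blast
  have pullS: "pull \<omega>Y x (x \<cdot>\<^sub>X s) = (\<Sum>\<sigma>\<in>S. - Y.curvature \<omega>Y \<sigma> * pull (dual_form \<sigma>) x (x \<cdot>\<^sub>X s))
      + HY (f (x \<cdot>\<^sub>X s)) - HY (f x)"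
    if x: "x \<in> carrier X.G" and s: "s \<in> X.steps" for x s
  proof -
    have x': "x \<cdot>\<^sub>X s \<in> carrier X.G" using x s X.steps_G by auto
    obtain b where b: "b \<in> B1" "f (x \<cdot>\<^sub>X s) = f x \<cdot>\<^sub>Y b" using B1(3) [OF x s] by blast
    have bC: "b \<in> carrier Y.G" using b B1 by auto
    show ?thesis
      unfolding pull_sum [symmetric]
    proof (rule pull_cong [OF x x' bC b(2)])
      fix p t assume p: "p \<in> Y.trail b" and t: "t \<in> Y.steps"
      have "f x \<cdot>\<^sub>Y p \<in> carrier Y.G" using f_closed [OF x] trailT [OF p b(1)] T1 by auto
      from bspec [OF bspec [OF HY this] t]
      show "\<omega>Y (f x \<cdot>\<^sub>Y p) (f x \<cdot>\<^sub>Y p \<cdot>\<^sub>Y t) =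
        (\<Sum>\<sigma>\<in>S. - Y.curvature \<omega>Y \<sigma> * dual_form \<sigma> (f x \<cdot>\<^sub>Y p) (f x \<cdot>\<^sub>Y p \<cdot>\<^sub>Y t)) +
        HY (f x \<cdot>\<^sub>Y p \<cdot>\<^sub>Y t) - HY (f x \<cdot>\<^sub>Y p)" .
    qed
  qed

  (* A loop that stays away from the vertical segment between two squares winds equally often
     around both. *)
  define seg where "seg v k r = {y \<in> carrier Y.G. \<exists>w i. w \<in> carrier Y.F \<and> length w \<le> 2 \<and>
      min k r \<le> i \<and> i \<le> max k r \<and> y = (v \<otimes>\<^bsub>Y.F\<^esub> inv\<^bsub>Y.F\<^esub> w, i)}" for v k r
  have seg_fin: "finite (seg v k r)" for v k r
  proof (rule finite_subset)
    show "seg v k r \<subseteq> (\<lambda>w. v \<otimes>\<^bsub>Y.F\<^esub> inv\<^bsub>Y.F\<^esub> w) ` {w \<in> carrier Y.F. length w \<le> 2} \<times> {min k r..max k r}"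
      by (auto simp: seg_def)
  qed (use finite_words_length_le [OF X.X_finite] in auto)
  have far: "dual_form (v, k) y (y \<cdot>\<^sub>Y s) = dual_form (v, r) y (y \<cdot>\<^sub>Y s)"
    if y: "y \<in> carrier Y.G" "y \<notin> seg v k r" and s: "s \<in> Y.steps" and v: "v \<in> carrier Y.F" for y s v k r
  proof -
    obtain u m where yu: "y = (u, m)" by (cases y)
    have u: "u \<in> carrier Y.F" using y(1) unfolding yu by simp
    from s show ?thesis
    proof (cases rule: Y.steps_cases)
      case 1
      then show ?thesis
        using u by (simp add: yu dual_form_def wedge_def beyond_def)
    next
      case (2 x)
      show ?thesis
      proof (cases "min k r \<le> m \<and> m \<le> max k r")
        case True
        have "prefix v u = prefix v (u \<otimes>\<^bsub>Y.F\<^esub> [x])"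
        proof (rule ccontr)
          assume "prefix v u \<noteq> prefix v (u \<otimes>\<^bsub>Y.F\<^esub> [x])"
          from crossing_near_edge [OF u _ v this] have w: "length (inv\<^bsub>Y.F\<^esub> u \<otimes>\<^bsub>Y.F\<^esub> v) \<le> 2"
            using 2 by simp
          define w where "w = inv\<^bsub>Y.F\<^esub> u \<otimes>\<^bsub>Y.F\<^esub> v"
          have "w \<in> carrier Y.F" "length w \<le> 2" "v \<otimes>\<^bsub>Y.F\<^esub> inv\<^bsub>Y.F\<^esub> w = u"
            using u v w by (simp_all add: w_def X.F.inv_mult_group X.F.m_assoc [symmetric])
          then have "y \<in> seg v k r"
            unfolding seg_def using True y(1) yu by blast
          then show False using y(2) by simp
        qed
        then show ?thesis
          using 2 by (simp add: yu dual_form_def wedge_def beyond_def)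
      next
        case False
        then have "(k < m) = (r < m)" by linarith
        then show ?thesis
          using 2 by (simp add: yu dual_form_def wedge_def height_above_def)
      qed
    qed
  qed
  define E2 where "E2 r = {e \<cdot>\<^sub>Y t | e t. e \<in> (\<Union>\<sigma>\<in>S. seg (fst \<sigma>) (snd \<sigma>) r) \<and> t \<in> (\<lambda>t. inv\<^bsub>Y.G\<^esub> t) ` T1}" for r
  define Z2 where "Z2 r = {x \<in> carrier X.G. f x \<in> E2 r}" for r
  have Z2: "finite (Z2 r)" for r
    unfolding Z2_def E2_def using S seg_fin T1 by (intro finite_f_vimage finite_mult_set) auto
  have pull_shift: "pull (dual_form (v, k)) x (x \<cdot>\<^sub>X s) = pull (dual_form (v, r)) x (x \<cdot>\<^sub>X s)"
    if x: "x \<in> carrier X.G" "x \<notin> Z2 r" and s: "s \<in> X.steps" and \<sigma>: "(v, k) \<in> S" for x s v k r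
  proof -
    have x': "x \<cdot>\<^sub>X s \<in> carrier X.G" using x s X.steps_G by auto
    obtain b where b: "b \<in> B1" "f (x \<cdot>\<^sub>X s) = f x \<cdot>\<^sub>Y b" using B1(3) [OF x(1) s] by blast
    have bC: "b \<in> carrier Y.G" using b B1 by auto
    have v: "v \<in> carrier Y.F" using \<sigma> by (simp add: S_def Y.squares_def)
    have "pull (dual_form (v, k)) x (x \<cdot>\<^sub>X s) = pull (dual_form (v, r)) x (x \<cdot>\<^sub>X s) + 0 - 0"
    proof (rule pull_cong [OF x(1) x' bC b(2), where h = "\<lambda>_. 0"])
      fix p t assume p: "p \<in> Y.trail b" and t: "t \<in> Y.steps"
      have pC: "p \<in> T1" "p \<in> carrier Y.G" using trailT [OF p b(1)] T1 by auto
      have fx: "f x \<in> carrier Y.G" using f_closed [OF x(1)] .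
      have "f x \<cdot>\<^sub>Y p \<notin> seg v k r"
      proof
        assume e: "f x \<cdot>\<^sub>Y p \<in> seg v k r"
        have "f x = f x \<cdot>\<^sub>Y p \<cdot>\<^sub>Y inv\<^bsub>Y.G\<^esub> p" using fx pC by (simp add: Y.G.m_assoc)
        moreover have "f x \<cdot>\<^sub>Y p \<in> (\<Union>\<sigma>\<in>S. seg (fst \<sigma>) (snd \<sigma>) r)"
          by (rule UN_I [OF \<sigma>]) (simp add: e)
        moreover have "inv\<^bsub>Y.G\<^esub> p \<in> (\<lambda>t. inv\<^bsub>Y.G\<^esub> t) ` T1" using pC by simp
        ultimately have "f x \<in> E2 r" unfolding E2_def by blast
        then show False using x by (simp add: Z2_def)
      qed
      from far [OF _ this t v] fx pC
      show "dual_form (v, k) (f x \<cdot>\<^sub>Y p) (f x \<cdot>\<^sub>Y p \<cdot>\<^sub>Y t) =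
        dual_form (v, r) (f x \<cdot>\<^sub>Y p) (f x \<cdot>\<^sub>Y p \<cdot>\<^sub>Y t) + 0 - 0" by simp
    qed
    then show ?thesis by simp
  qed

  (* If no point of the disc is mapped close to the square (v, r), the winding form of that square is
     exact around the image of every cell of the disc, so its integral around the boundary vanishes. *)
  obtain C5 where C5: "finite C5" "C5 \<subseteq> carrier Y.G"
      "\<And>x c. \<lbrakk>x \<in> carrier X.G; c \<in> X.cell\<rbrakk> \<Longrightarrow> \<exists>d\<in>C5. f (x \<cdot>\<^sub>X c) = f x \<cdot>\<^sub>Y d"
    using coarse_mapD [OF f_coarse X.finite_cell X.cell_G] by metis
  define B5 where "B5 = T2 \<union> C5"
  have "finite B5" "B5 \<subseteq> carrier Y.G" using T2 C5 by (auto simp: B5_def)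
  from Y.uniformly_exact_dual_form [OF this] obtain E5 where E5: "finite E5" "E5 \<subseteq> carrier Y.G"
    "\<And>y v k. \<lbrakk>y \<in> carrier Y.G; v \<in> carrier Y.F;
      \<not> exact_on (insert y ((\<lambda>b. y \<cdot>\<^sub>Y b) ` B5)) (dual_form (v, k))\<rbrakk> \<Longrightarrow> \<exists>e\<in>E5. (v, k) = y \<cdot>\<^sub>Y e"
    by metis
  have disc: "\<exists>j. \<exists>s\<in>X.row b a j. \<exists>e\<in>E5. (v, r) = f s \<cdot>\<^sub>Y e"
    if a: "a \<in> carrier X.F" and b: "b \<in> carrier X.F" and v: "v \<in> carrier X.F"
      and nz: "X.loop_int (pull (dual_form (v, r))) b a k n \<noteq> 0" for a b v r k n
  proof (rule ccontr)
    assume contr: "\<not> (\<exists>j. \<exists>s\<in>X.row b a j. \<exists>e\<in>E5. (v, r) = f s \<cdot>\<^sub>Y e)"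
    let ?\<omega> = "\<lambda>x x'. dual_form (v, r) (f x) (f x')"
    let ?U = "\<lambda>s. insert (f s) ((\<lambda>c. f s \<cdot>\<^sub>Y c) ` B5)"
    have rowC: "s \<in> carrier X.G" if "s \<in> X.row b a j" for s j using X.row_G [OF a b] that by auto
    have ex: "exact_on (?U s) (dual_form (v, r))" if s: "s \<in> X.row b a j" for s j
    proof (rule ccontr)
      assume "\<not> exact_on (?U s) (dual_form (v, r))"
      from E5(3) [OF f_closed [OF rowC [OF s]] v this] contr s show False by blast
    qed
    have "X.loop_int (pull (dual_form (v, r))) b a k n = X.loop_int ?\<omega> b a k n"
    proof (rule X.loop_int_cong [OF a b, where h = "\<lambda>_. 0"])
      fix x s assume "x \<in> X.row b a k \<union> X.row b a (k + int n) \<union> {a, b} \<times> {k..k + int n}" and s: "s \<in> X.steps"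
      then obtain j where xr: "x \<in> X.row b a j" using X.row_ends [OF a b] by blast
      note x = rowC [OF xr]
      have x': "x \<cdot>\<^sub>X s \<in> carrier X.G" using x s X.steps_G by auto
      obtain c where c: "c \<in> B1" "f (x \<cdot>\<^sub>X s) = f x \<cdot>\<^sub>Y c" using B1(3) [OF x s] by blast
      have cC: "c \<in> carrier Y.G" using c B1 by auto
      obtain H where "\<forall>p\<in>?U x. \<forall>q\<in>?U x. dual_form (v, r) p q = H q - H p"
        using ex [OF xr] unfolding exact_on_def ..
      then have H: "dual_form (v, r) p q = H q - H p" if "p \<in> ?U x" "q \<in> ?U x" for p q using that by blast
      have inU: "f x \<cdot>\<^sub>Y t \<in> ?U x" if "t \<in> T2" for t
        unfolding B5_def using that by blast
      have "pull (dual_form (v, r)) x (x \<cdot>\<^sub>X s) = H (f (x \<cdot>\<^sub>X s)) - H (f x)"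
      proof (rule pull_exact [OF x x' cC c(2), where U = "?U x"])
        fix p assume p: "p \<in> Y.trail c"
        show "f x \<cdot>\<^sub>Y p \<in> ?U x" using inU [OF trailT2(1) [OF p c(1) Y.steps_mem(1)]] .
        fix t assume t: "t \<in> Y.steps"
        show "f x \<cdot>\<^sub>Y p \<cdot>\<^sub>Y t \<in> ?U x"
          unfolding ftrail [OF x trailT [OF p c(1)] t] using inU [OF trailT2(2) [OF p c(1) t]] .
      qed (rule H)
      moreover have "f (x \<cdot>\<^sub>X s) \<in> ?U x"
        unfolding c(2) using inU [OF trailT2(1) [OF trail_end(1) c(1) Y.steps_mem(1)]] .
      ultimately show "pull (dual_form (v, r)) x (x \<cdot>\<^sub>X s) = ?\<omega> x (x \<cdot>\<^sub>X s) + 0 - 0"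
        using H [of "f x" "f (x \<cdot>\<^sub>X s)"] by simp
    qed
    also have "X.loop_int ?\<omega> b a k n = 0"
    proof (rule X.loop_int_exact_disc [OF _ a b])
      show "antisymmetric ?\<omega>"
        using antisymmetric_dual_form [of "(v, r)"] unfolding antisymmetric_def by blast
      fix j s assume s: "s \<in> X.row b a j"
      have "f ` insert s ((\<lambda>c. s \<cdot>\<^sub>X c) ` X.cell) \<subseteq> insert (f s) ((\<lambda>d. f s \<cdot>\<^sub>Y d) ` C5)"
        by (rule image_star [where m = "\<lambda>c. s \<cdot>\<^sub>X c" and m' = "\<lambda>d. f s \<cdot>\<^sub>Y d"])
          (rule C5(3) [OF rowC [OF s]])
      then have "f ` (\<lambda>c. s \<cdot>\<^sub>X c) ` X.cell \<subseteq> ?U s" unfolding B5_def by blast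
      then show "exact_on ((\<lambda>c. s \<cdot>\<^sub>X c) ` X.cell) ?\<omega>"
        using ex [OF s] by (intro exact_on_pullback [where g = f]) (rule exact_on_subset)
    qed
    finally show False using nz by simp
  qed

  (* The edge v ranges over a finite set, so being close to g (v, r) amounts to being close to
     g ([], r), with a bound that is independent of r. *)
  define E6 where "E6 = {e \<cdot>\<^sub>Y t | e t. e \<in> E5 \<and> t \<in> (\<lambda>(v, k). (inv\<^bsub>Y.F\<^esub> v, 0)) ` S}"
  have SF: "v \<in> carrier Y.F" if "(v, k) \<in> S" for v k using that by (simp add: S_def Y.squares_def)
  have E6: "finite E6" "E6 \<subseteq> carrier Y.G"
  proof -
    show "finite E6" unfolding E6_def using E5 S by (intro finite_mult_set) auto
    show "E6 \<subseteq> carrier Y.G" unfolding E6_def using E5(2) SF by force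
  qed
  obtain C6 where C6: "finite C6" "C6 \<subseteq> carrier X.G"
      "\<And>y e. \<lbrakk>y \<in> carrier Y.G; e \<in> E6\<rbrakk> \<Longrightarrow> \<exists>c\<in>C6. g (y \<cdot>\<^sub>Y e) = g y \<cdot>\<^sub>X c"
    using coarse_mapD [OF g_coarse E6] by metis
  define D where "D = (\<lambda>d. inv\<^bsub>X.G\<^esub> d) ` {c \<cdot>\<^sub>X d | c d. c \<in> C0 \<and> d \<in> C6}"
  have D: "finite D" unfolding D_def using C0 C6 by (intro finite_imageI finite_mult_set) auto
  have DC: "D \<subseteq> carrier X.G" unfolding D_def using C0(2) C6(2) by blast

  have "\<exists>J. \<forall>a\<in>carrier X.F. \<forall>b\<in>carrier X.F.
      prefix [l] a \<longrightarrow> \<not> prefix [l] b \<longrightarrow> J < length a \<longrightarrow> J < length b \<longrightarrow>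
      (\<exists>j. \<exists>s\<in>X.row b a j. \<exists>\<delta>\<in>D. s = g ([], r) \<cdot>\<^sub>X \<delta>)" for r
  proof -
    define Z where "Z = Z1 \<union> Z2 r"
    have Z: "finite Z" using Z1 Z2 by (simp add: Z_def)
    define J where "J = Max (insert 0 ((\<lambda>z. length (fst z)) ` Z))"
    (* The top and bottom rows avoid Z by their height, and the vertical sides by the length of their
       first component. *)
    define m where "m = nat (Max (insert 0 ((\<lambda>z. \<bar>snd z\<bar>) ` Z))) + 1"
    have J: "length (fst z) \<le> J" if "z \<in> Z" for z using that Z by (simp add: J_def)
    have m: "\<bar>snd z\<bar> < int m" if "z \<in> Z" for z
    proof -
      have "\<bar>snd z\<bar> \<le> Max (insert 0 ((\<lambda>z. \<bar>snd z\<bar>) ` Z))" using that Z by (intro Max_ge) auto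
      then show ?thesis unfolding m_def by linarith
    qed
    have "\<exists>j. \<exists>s\<in>X.row b a j. \<exists>\<delta>\<in>D. s = g ([], r) \<cdot>\<^sub>X \<delta>"
      if a: "a \<in> carrier X.F" and b: "b \<in> carrier X.F" and ab: "prefix [l] a" "\<not> prefix [l] b"
        and long: "J < length a" "J < length b" for a b
    proof -
      let ?k = "- int m" and ?n = "2 * m"
      let ?bd = "X.row b a ?k \<union> X.row b a (?k + int ?n) \<union> {a, b} \<times> {?k..?k + int ?n}"
      have bdC: "x \<in> carrier X.G" if "x \<in> ?bd" for x
        using that X.row_G [OF a b] a b by auto
      have bdZ: "x \<notin> Z" if "x \<in> ?bd" for x
      proof
        assume z: "x \<in> Z"
        have "snd x = ?k \<or> snd x = ?k + int ?n \<or> fst x = a \<or> fst x = b"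
          using that unfolding X.row_def by auto
        then show False using J [OF z] m [OF z] long by auto
      qed
      have "X.loop_int (pull \<omega>Y) b a ?k ?n = X.loop_int \<omega>X b a ?k ?n"
        by (rule X.loop_int_cong [OF a b, where h = h], rule pullY) (use bdC bdZ in \<open>auto simp: Z_def\<close>)
      also have "\<dots> = of_bool (prefix [l] b) - of_bool (prefix [l] a)"
        unfolding \<omega>X_def dual_form_def prod.case
        by (rule X.loop_int_wedge [OF a b]) (auto simp: height_above_def beyond_def m_def)
      also have "\<dots> \<noteq> 0" using ab by simp
      finally have nz: "X.loop_int (pull \<omega>Y) b a ?k ?n \<noteq> 0" .
      have "X.loop_int (pull \<omega>Y) b a ?k ?n =
          X.loop_int (\<lambda>x y. \<Sum>\<sigma>\<in>S. - Y.curvature \<omega>Y \<sigma> * pull (dual_form \<sigma>) x y) b a ?k ?n"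
        by (rule X.loop_int_cong [OF a b, where h = "\<lambda>x. HY (f x)"], rule pullS) (use bdC in auto)
      also have "\<dots> = (\<Sum>\<sigma>\<in>S. - Y.curvature \<omega>Y \<sigma> * X.loop_int (pull (dual_form \<sigma>)) b a ?k ?n)"
        by (rule X.loop_int_sum)
      finally have "\<exists>\<sigma>\<in>S. X.loop_int (pull (dual_form \<sigma>)) b a ?k ?n \<noteq> 0"
        using nz by (metis (no_types, lifting) mult_zero_right sum.neutral)
      then obtain v k where vk: "(v, k) \<in> S" "X.loop_int (pull (dual_form (v, k))) b a ?k ?n \<noteq> 0" by auto
      have "X.loop_int (pull (dual_form (v, k))) b a ?k ?n = X.loop_int (pull (dual_form (v, r))) b a ?k ?n"
      proof (rule X.loop_int_cong [OF a b, where h = "\<lambda>_. 0"])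
        fix x s assume x: "x \<in> ?bd" and s: "s \<in> X.steps"
        from pull_shift [OF bdC [OF x] _ s vk(1), of r] bdZ [OF x]
        show "pull (dual_form (v, k)) x (x \<cdot>\<^sub>X s) = pull (dual_form (v, r)) x (x \<cdot>\<^sub>X s) + 0 - 0"
          by (simp add: Z_def)
      qed
      with vk have "X.loop_int (pull (dual_form (v, r))) b a ?k ?n \<noteq> 0" by simp
      from disc [OF a b SF [OF vk(1)] this] obtain j s e where
        s: "s \<in> X.row b a j" and e: "e \<in> E5" "(v, r) = f s \<cdot>\<^sub>Y e" by blast
      have sC: "s \<in> carrier X.G" using X.row_G [OF a b] s by auto
      have v: "v \<in> carrier Y.F" using SF [OF vk(1)] .
      let ?t = "(inv\<^bsub>Y.F\<^esub> v, 0) :: 'a point"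
      have "([], r) = (v, r) \<cdot>\<^sub>Y ?t" using v by simp
      also have "\<dots> = f s \<cdot>\<^sub>Y (e \<cdot>\<^sub>Y ?t)"
        unfolding e(2) using f_closed [OF sC] e(1) E5(2) v by (intro Y.G.m_assoc) auto
      finally have r: "([], r) = f s \<cdot>\<^sub>Y (e \<cdot>\<^sub>Y ?t)" .
      have "?t \<in> (\<lambda>(v, k). (inv\<^bsub>Y.F\<^esub> v, 0)) ` S" using vk(1) by force
      then have "e \<cdot>\<^sub>Y ?t \<in> E6" unfolding E6_def using e(1) by blast
      from C6(3) [OF f_closed [OF sC] this] obtain d where d: "d \<in> C6" "g ([], r) = g (f s) \<cdot>\<^sub>X d"
        unfolding r by blast
      obtain c where c: "c \<in> C0" "g (f s) = s \<cdot>\<^sub>X c" using C0(3) [OF sC] by blast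
      have cd: "c \<in> carrier X.G" "d \<in> carrier X.G" using c d C0 C6 by auto
      have "g ([], r) \<cdot>\<^sub>X inv\<^bsub>X.G\<^esub> (c \<cdot>\<^sub>X d) = s"
        unfolding d(2) c(2) X.G.m_assoc [OF sC cd] using sC cd by (simp add: X.G.m_assoc del: X.mult_G)
      moreover have "inv\<^bsub>X.G\<^esub> (c \<cdot>\<^sub>X d) \<in> D" unfolding D_def using c(1) d(1) by blast
      ultimately show ?thesis using s by metis
    qed
    then show ?thesis by blast
  qed
  then show ?thesis using D DC by blast
qed

end

section \<open>Medians and centralisers\<close>

definition vertical_line :: "('a list \<times> int) set" where
  "vertical_line = (\<lambda>r. ([], r)) ` UNIV"

lemma infinite_vertical_line: "infinite vertical_line"
proof -
  have "inj_on (\<lambda>r::int. ([] :: 'a list, r)) UNIV" by (rule inj_onI) simp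
  then show ?thesis unfolding vertical_line_def by (simp add: finite_image_iff infinite_UNIV_int)
qed

context free_by_int
begin

text \<open>
  The position of \<open>a\<close> relative to \<open>q\<close>: the unique isomorphism from the tree at the level of \<open>q\<close> to the
  tree of reduced words that takes \<open>q\<close> to the base vertex and respects the labels of the edges
  takes the point \<open>a\<close> of that level to \<open>view q a\<close>.
\<close>
definition view :: "'a point \<Rightarrow> 'a word \<Rightarrow> 'a word" where
  "view q a = fst (inv\<^bsub>G\<^esub> q \<cdot> (a, 0))"

lemma view_eq: "\<lbrakk>h \<in> carrier F; a \<in> carrier F\<rbrakk> \<Longrightarrow> view (h, m) a = \<phi> (- m) (inv\<^bsub>F\<^esub> h \<otimes>\<^bsub>F\<^esub> a)"
  by (simp add: view_def inv_G \<phi>_mult)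

lemma view_closed: "\<lbrakk>q \<in> carrier G; a \<in> carrier F\<rbrakk> \<Longrightarrow> view q a \<in> carrier F"
  by (cases q) (simp add: view_eq \<phi>_closed)

lemma inj_view: "q \<in> carrier G \<Longrightarrow> inj_on (view q) (carrier F)"
proof (rule inj_onI)
  fix a b assume q: "q \<in> carrier G" and ab: "a \<in> carrier F" "b \<in> carrier F" "view q a = view q b"
  obtain h m where hm: "q = (h, m)" by (cases q)
  have h: "h \<in> carrier F" using q unfolding hm by simp
  have "inv\<^bsub>F\<^esub> h \<otimes>\<^bsub>F\<^esub> a = inv\<^bsub>F\<^esub> h \<otimes>\<^bsub>F\<^esub> b"
    using ab h inj_onD [OF inj_\<phi> [of "- m"]] unfolding hm by (simp add: view_eq)
  then show "a = b" using ab h by simp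
qed

lemma view_right_mult:
  assumes "q \<in> carrier G" "u \<in> carrier F" "a \<in> carrier F"
  shows "view (q \<cdot> (u, j)) a = \<phi> (- j) (inv\<^bsub>F\<^esub> u \<otimes>\<^bsub>F\<^esub> view q a)"
proof -
  obtain h m where hm: "q = (h, m)" by (cases q)
  have h: "h \<in> carrier F" using assms unfolding hm by simp
  have mj: "- (m + j) = - j + - m" by simp
  have "view (q \<cdot> (u, j)) a = \<phi> (- (m + j)) (inv\<^bsub>F\<^esub> (h \<otimes>\<^bsub>F\<^esub> \<phi> m u) \<otimes>\<^bsub>F\<^esub> a)"
    unfolding hm mult_G using assms h by (intro view_eq) (simp_all add: \<phi>_closed)
  also have "inv\<^bsub>F\<^esub> (h \<otimes>\<^bsub>F\<^esub> \<phi> m u) \<otimes>\<^bsub>F\<^esub> a = \<phi> m (inv\<^bsub>F\<^esub> u) \<otimes>\<^bsub>F\<^esub> (inv\<^bsub>F\<^esub> h \<otimes>\<^bsub>F\<^esub> a)"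
    using assms h by (simp add: F.inv_mult_group F.m_assoc \<phi>_closed \<phi>_inv)
  also have "\<phi> (- (m + j)) \<dots> = \<phi> (- j) (\<phi> (- m) \<dots>)"
    unfolding mj using assms h by (intro \<phi>_add) (simp add: \<phi>_closed)
  also have "\<phi> (- m) (\<phi> m (inv\<^bsub>F\<^esub> u) \<otimes>\<^bsub>F\<^esub> (inv\<^bsub>F\<^esub> h \<otimes>\<^bsub>F\<^esub> a)) = inv\<^bsub>F\<^esub> u \<otimes>\<^bsub>F\<^esub> view q a"
    unfolding hm view_eq [OF h assms(3)] using assms h by (simp add: \<phi>_mult \<phi>_closed \<phi>_minus)
  finally show ?thesis .
qed

lemma view_left_mult:
  assumes "(h, m) \<in> carrier G" "w \<in> carrier F" "a \<in> carrier F"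
  shows "view (inv\<^bsub>G\<^esub> (w, 0) \<cdot> (h, m)) a =
    \<phi> (- m) (inv\<^bsub>F\<^esub> h \<otimes>\<^bsub>F\<^esub> w \<otimes>\<^bsub>F\<^esub> h) \<otimes>\<^bsub>F\<^esub> view (h, m) a"
proof -
  have h: "h \<in> carrier F" using assms by simp
  have "inv\<^bsub>G\<^esub> (w, 0) \<cdot> (h, m) = (inv\<^bsub>F\<^esub> w \<otimes>\<^bsub>F\<^esub> h, m)"
    using assms h by (simp add: inv_G \<phi>_0)
  then have "view (inv\<^bsub>G\<^esub> (w, 0) \<cdot> (h, m)) a = \<phi> (- m) (inv\<^bsub>F\<^esub> (inv\<^bsub>F\<^esub> w \<otimes>\<^bsub>F\<^esub> h) \<otimes>\<^bsub>F\<^esub> a)"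
    using assms h by (simp add: view_eq del: mult_G)
  also have "inv\<^bsub>F\<^esub> (inv\<^bsub>F\<^esub> w \<otimes>\<^bsub>F\<^esub> h) \<otimes>\<^bsub>F\<^esub> a = (inv\<^bsub>F\<^esub> h \<otimes>\<^bsub>F\<^esub> w \<otimes>\<^bsub>F\<^esub> h) \<otimes>\<^bsub>F\<^esub> (inv\<^bsub>F\<^esub> h \<otimes>\<^bsub>F\<^esub> a)"
    using assms h by (simp add: F.inv_mult_group F.m_assoc) (simp add: F.m_assoc [symmetric])
  finally show ?thesis
    using assms h by (simp add: view_eq \<phi>_mult)
qed

lemma row_views_diverge:
  assumes a: "a \<in> carrier F" and b: "b \<in> carrier F" and s: "s \<in> row b a k"
  shows "diverge (view s a) (view s b)"
proof -
  define w where "w = row_word b a k"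
  have w: "w \<in> carrier F" unfolding w_def by (rule row_word_F [OF a b])
  obtain i where si: "s = (b, k) \<cdot> (take i w, 0)" using s unfolding row_def w_def by blast
  let ?p = "take i w" and ?q = "drop i w"
  have p: "?p \<in> carrier F" "?q \<in> carrier F" using w by (auto intro: take_free_group drop_free_group)
  have "view s a = inv\<^bsub>F\<^esub> ?p \<otimes>\<^bsub>F\<^esub> w"
    unfolding si using a b p by (simp add: view_right_mult view_eq \<phi>_0 \<phi>_closed w_def row_word_def del: mult_G)
  also have "\<dots> = inv\<^bsub>F\<^esub> ?p \<otimes>\<^bsub>F\<^esub> (?p \<otimes>\<^bsub>F\<^esub> ?q)"
    using free_group_append [of ?p ?q X] w by simp
  also have "\<dots> = ?q" using p by (simp add: F.m_assoc [symmetric])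
  finally have va: "view s a = ?q" .
  have "view s b = inv\<^bsub>F\<^esub> ?p \<otimes>\<^bsub>F\<^esub> []"
    unfolding si using a b p by (simp add: view_right_mult view_eq \<phi>_0 \<phi>_Nil del: mult_G)
  then have "view s b = inv\<^bsub>F\<^esub> ?p" using p by simp
  then have vb: "view s b = map inv_letter (rev ?p)" using p by (simp add: inv_free_group)
  have "reduced (?p @ ?q)" using w by (simp add: carrier_free_group_iff)
  then have red: "?p \<noteq> [] \<Longrightarrow> ?q \<noteq> [] \<Longrightarrow> hd ?q \<noteq> inv_letter (last ?p)"
    unfolding reduced_append by blast
  show ?thesis
    unfolding diverge_def va vb
  proof (intro allI notI)
    fix c assume c: "prefix [c] ?q \<and> prefix [c] (map inv_letter (rev ?p))"
    then have "map inv_letter (rev ?p) \<noteq> []" "?q \<noteq> []" by (metis prefix_Nil list.discI)+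
    then have ne: "?p \<noteq> []" "?q \<noteq> []" by auto
    have "hd ?q = c" using c by (cases ?q) auto
    moreover have "inv_letter (last ?p) = c"
    proof -
      have "hd (map inv_letter (rev ?p)) = c" using c by (cases "map inv_letter (rev ?p)") auto
      then show ?thesis using ne by (simp add: hd_map hd_rev)
    qed
    ultimately show False using red ne by simp
  qed
qed

text \<open>
  The points \<open>q\<close> and \<open>q \<cdot> \<delta>\<close> may lie at different levels. Passing from the tree at one level to the
  tree at the other distorts geodesics by a bounded amount, which is \<open>bounded_common_prefix\<close>.
\<close>
lemma common_prefix_near_row:
  assumes D: "finite D" "D \<subseteq> carrier G"
  shows "\<exists>N. \<forall>q\<in>carrier G. \<forall>\<delta>\<in>D. \<forall>a\<in>carrier F. \<forall>b\<in>carrier F. \<forall>p.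
    diverge (view (q \<cdot> \<delta>) a) (view (q \<cdot> \<delta>) b) \<longrightarrow>
    prefix p (view q a) \<longrightarrow> prefix p (view q b) \<longrightarrow> length p \<le> N"
proof -
  have "\<forall>\<delta>\<in>D. \<exists>N. \<forall>A\<in>carrier F. \<forall>B\<in>carrier F. \<forall>p.
      diverge (\<phi> (- snd \<delta>) (inv\<^bsub>F\<^esub> fst \<delta> \<otimes>\<^bsub>F\<^esub> A)) (\<phi> (- snd \<delta>) (inv\<^bsub>F\<^esub> fst \<delta> \<otimes>\<^bsub>F\<^esub> B)) \<longrightarrow>
      prefix p A \<longrightarrow> prefix p B \<longrightarrow> length p \<le> N"
    using D by (intro ballI bounded_common_prefix [OF X_finite \<phi>_hom inj_\<phi>]) auto
  from bchoice [OF this] obtain N where N: "\<And>\<delta> A B p. \<lbrakk>\<delta> \<in> D; A \<in> carrier F; B \<in> carrier F;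
      diverge (\<phi> (- snd \<delta>) (inv\<^bsub>F\<^esub> fst \<delta> \<otimes>\<^bsub>F\<^esub> A)) (\<phi> (- snd \<delta>) (inv\<^bsub>F\<^esub> fst \<delta> \<otimes>\<^bsub>F\<^esub> B));
      prefix p A; prefix p B\<rbrakk> \<Longrightarrow> length p \<le> N \<delta>" by metis
  have "length p \<le> Max (insert 0 (N ` D))"
    if "q \<in> carrier G" "\<delta> \<in> D" "a \<in> carrier F" "b \<in> carrier F"
      "diverge (view (q \<cdot> \<delta>) a) (view (q \<cdot> \<delta>) b)" "prefix p (view q a)" "prefix p (view q b)"
    for q \<delta> a b p
  proof -
    obtain u j where uj: "\<delta> = (u, j)" by (cases \<delta>)
    have "u \<in> carrier F" using that(2) D uj by auto
    then have "length p \<le> N \<delta>"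
      using that N [of \<delta> "view q a" "view q b" p] unfolding uj
      by (simp add: view_right_mult view_closed del: mult_G)
    also have "\<dots> \<le> Max (insert 0 (N ` D))" using that D by (intro Max_ge) auto
    finally show ?thesis .
  qed
  then show ?thesis by blast
qed

end

context coarse_pair
begin

definition seen_apart :: "'a \<times> bool \<Rightarrow> nat \<Rightarrow> int \<Rightarrow> nat \<Rightarrow> bool" where
  "seen_apart l N r J \<longleftrightarrow> (\<forall>a\<in>carrier X.F. \<forall>b\<in>carrier X.F.
     prefix [l] a \<longrightarrow> \<not> prefix [l] b \<longrightarrow> J < length a \<longrightarrow> J < length b \<longrightarrow>
     (\<forall>p. prefix p (X.view (g ([], r)) a) \<longrightarrow> prefix p (X.view (g ([], r)) b) \<longrightarrow> length p \<le> N))"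

text \<open>
  Each point \<open>g ([], r)\<close> is near any sufficiently large disc between points \<open>a\<close> and \<open>b\<close> as in
  \<open>seen_apart_def\<close>, and from a point near a disc the two ends are seen in different directions.
\<close>
lemma seen_apart_from_vertical_line:
  assumes l: "fst l \<in> A"
  shows "\<exists>N. \<forall>r. \<exists>J. seen_apart l N r J"
proof -
  obtain D where D: "finite D" "D \<subseteq> carrier X.G" "\<forall>r. \<exists>J. \<forall>a\<in>carrier X.F. \<forall>b\<in>carrier X.F.
      prefix [l] a \<longrightarrow> \<not> prefix [l] b \<longrightarrow> J < length a \<longrightarrow> J < length b \<longrightarrow>
      (\<exists>j. \<exists>s\<in>X.row b a j. \<exists>\<delta>\<in>D. s = g ([], r) \<cdot>\<^sub>X \<delta>)"
    using disc_meets_vertical_line [OF l] by (elim exE conjE)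
  obtain N where N: "\<forall>q\<in>carrier X.G. \<forall>\<delta>\<in>D. \<forall>a\<in>carrier X.F. \<forall>b\<in>carrier X.F. \<forall>p.
    diverge (X.view (q \<cdot>\<^sub>X \<delta>) a) (X.view (q \<cdot>\<^sub>X \<delta>) b) \<longrightarrow>
    prefix p (X.view q a) \<longrightarrow> prefix p (X.view q b) \<longrightarrow> length p \<le> N"
    using X.common_prefix_near_row [OF D(1,2)] ..
  have "\<exists>J. seen_apart l N r J" for r
  proof -
    have gr: "g ([], r) \<in> carrier X.G" by (rule g_closed) simp
    from D(3) obtain J where J: "\<forall>a\<in>carrier X.F. \<forall>b\<in>carrier X.F.
      prefix [l] a \<longrightarrow> \<not> prefix [l] b \<longrightarrow> J < length a \<longrightarrow> J < length b \<longrightarrow>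
      (\<exists>j. \<exists>s\<in>X.row b a j. \<exists>\<delta>\<in>D. s = g ([], r) \<cdot>\<^sub>X \<delta>)" by blast
    have "seen_apart l N r J"
      unfolding seen_apart_def
    proof (intro ballI impI allI)
      fix a b p
      assume ab: "a \<in> carrier X.F" "b \<in> carrier X.F" "prefix [l] a" "\<not> prefix [l] b" "J < length a" "J < length b"
        and p: "prefix p (X.view (g ([], r)) a)" "prefix p (X.view (g ([], r)) b)"
      from J ab obtain j s \<delta> where s: "s \<in> X.row b a j" "\<delta> \<in> D" "s = g ([], r) \<cdot>\<^sub>X \<delta>" by blast
      from X.row_views_diverge [OF ab(1,2) s(1)]
      show "length p \<le> N" unfolding s(3) using N gr s(2) ab(1,2) p by blast
    qed
    then show ?thesis ..
  qed
  then show ?thesis by blast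
qed

lemma median_near_vertical_line:
  assumes L: "finite L" "fst ` L \<subseteq> A"
  shows "\<exists>N. \<forall>r. \<exists>J. \<forall>K>J. \<forall>l\<in>L. \<forall>l'\<in>L. \<forall>p. l \<noteq> l' \<longrightarrow>
    prefix p (X.view (g ([], r)) (replicate K l)) \<longrightarrow> prefix p (X.view (g ([], r)) (replicate K l')) \<longrightarrow>
    length p \<le> N"
proof -
  have "\<forall>l\<in>L. \<exists>N. \<forall>r. \<exists>J. seen_apart l N r J"
    using L by (intro ballI seen_apart_from_vertical_line) auto
  from bchoice [OF this] obtain N where N: "\<forall>l\<in>L. \<forall>r. \<exists>J. seen_apart l (N l) r J" ..
  have "\<exists>J. \<forall>K>J. \<forall>l\<in>L. \<forall>l'\<in>L. \<forall>p. l \<noteq> l' \<longrightarrow>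
      prefix p (X.view (g ([], r)) (replicate K l)) \<longrightarrow> prefix p (X.view (g ([], r)) (replicate K l')) \<longrightarrow>
      length p \<le> Max (insert 0 (N ` L))" for r
  proof -
    from N have "\<forall>l\<in>L. \<exists>J. seen_apart l (N l) r J" by blast
    from bchoice [OF this] obtain J where J: "\<forall>l\<in>L. seen_apart l (N l) r (J l)" ..
    show ?thesis
    proof (rule exI [of _ "Max (insert 0 (J ` L))"], intro allI ballI impI)
      fix K l l' p
      assume K: "Max (insert 0 (J ` L)) < K" and l: "l \<in> L" "l' \<in> L" "l \<noteq> l'"
        and p: "prefix p (X.view (g ([], r)) (replicate K l))" "prefix p (X.view (g ([], r)) (replicate K l'))"
      have "J l \<le> Max (insert 0 (J ` L))" using l L by (intro Max_ge) auto
      with K have JK: "J l < K" by simp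
      have "0 < K" using JK by simp
      then have "prefix [l] (replicate K l)" "\<not> prefix [l] (replicate K l')" using l by (cases K; simp)+
      moreover have "replicate K l \<in> carrier X.F" "replicate K l' \<in> carrier X.F"
        using l L by (auto intro!: replicate_free_group)
      ultimately have "length p \<le> N l" using bspec [OF J l(1)] JK p unfolding seen_apart_def by simp
      also have "\<dots> \<le> Max (insert 0 (N ` L))" using l L by (intro Max_ge) auto
      finally show "length p \<le> Max (insert 0 (N ` L))" .
    qed
  qed
  then show ?thesis by blast
qed

text \<open>
  Replacing \<open>f\<close> by its composition with a left translation replaces the vertical quasi-line by a translate,
  or equivalently the three points by their translates.
\<close>
lemma coarse_pair_translate:
  assumes w: "w \<in> carrier X.G"
  shows "coarse_pair A \<phi> (\<lambda>x. f (w \<cdot>\<^sub>X x)) (\<lambda>y. inv\<^bsub>X.G\<^esub> w \<cdot>\<^sub>X g y)"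
proof unfold_locales
  have assoc: "w \<cdot>\<^sub>X (x \<cdot>\<^sub>X b) = w \<cdot>\<^sub>X x \<cdot>\<^sub>X b"
    "inv\<^bsub>X.G\<^esub> w \<cdot>\<^sub>X (x \<cdot>\<^sub>X b) = inv\<^bsub>X.G\<^esub> w \<cdot>\<^sub>X x \<cdot>\<^sub>X b"
    if "x \<in> carrier X.G" "b \<in> carrier X.G" for x b
    using w that by (simp_all add: X.G.m_assoc del: X.mult_G)
  show "coarse_map X.G Y.G (\<lambda>x. f (w \<cdot>\<^sub>X x))"
    unfolding coarse_map_def
  proof (intro conjI allI impI)
    show "(\<lambda>x. f (w \<cdot>\<^sub>X x)) \<in> carrier X.G \<rightarrow> carrier Y.G"
      using f_closed w by (auto simp del: X.mult_G)
    fix B assume B: "finite B" "B \<subseteq> carrier X.G"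
    obtain C where C: "finite C" "C \<subseteq> carrier Y.G"
        "\<And>x b. \<lbrakk>x \<in> carrier X.G; b \<in> B\<rbrakk> \<Longrightarrow> \<exists>c\<in>C. f (x \<cdot>\<^sub>X b) = f x \<cdot>\<^sub>Y c"
      using coarse_mapD [OF f_coarse B] by metis
    have "\<exists>c\<in>C. f (w \<cdot>\<^sub>X (x \<cdot>\<^sub>X b)) = f (w \<cdot>\<^sub>X x) \<cdot>\<^sub>Y c"
      if "x \<in> carrier X.G" "b \<in> B" for x b
      unfolding assoc(1) [OF that(1) subsetD [OF B(2) that(2)]]
      using that w by (intro C(3)) auto
    then show "\<exists>C. finite C \<and> C \<subseteq> carrier Y.G \<and> (\<forall>x\<in>carrier X.G. \<forall>b\<in>B.
        \<exists>c\<in>C. f (w \<cdot>\<^sub>X (x \<cdot>\<^sub>X b)) = f (w \<cdot>\<^sub>X x) \<cdot>\<^sub>Y c)"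
      using C(1,2) by (intro exI [of _ C] conjI ballI)
  qed
  show "coarse_map Y.G X.G (\<lambda>y. inv\<^bsub>X.G\<^esub> w \<cdot>\<^sub>X g y)"
    unfolding coarse_map_def
  proof (intro conjI allI impI)
    show "(\<lambda>y. inv\<^bsub>X.G\<^esub> w \<cdot>\<^sub>X g y) \<in> carrier Y.G \<rightarrow> carrier X.G"
      using g_closed w by (auto simp del: X.mult_G)
    fix B assume B: "finite B" "B \<subseteq> carrier Y.G"
    obtain C where C: "finite C" "C \<subseteq> carrier X.G"
        "\<And>y b. \<lbrakk>y \<in> carrier Y.G; b \<in> B\<rbrakk> \<Longrightarrow> \<exists>c\<in>C. g (y \<cdot>\<^sub>Y b) = g y \<cdot>\<^sub>X c"
      using coarse_mapD [OF g_coarse B] by metis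
    have "\<exists>c\<in>C. inv\<^bsub>X.G\<^esub> w \<cdot>\<^sub>X g (y \<cdot>\<^sub>Y b) = inv\<^bsub>X.G\<^esub> w \<cdot>\<^sub>X g y \<cdot>\<^sub>X c"
      if y: "y \<in> carrier Y.G" "b \<in> B" for y b
    proof -
      obtain c where c: "c \<in> C" "g (y \<cdot>\<^sub>Y b) = g y \<cdot>\<^sub>X c" using C(3) [OF y] by blast
      have "inv\<^bsub>X.G\<^esub> w \<cdot>\<^sub>X g (y \<cdot>\<^sub>Y b) = inv\<^bsub>X.G\<^esub> w \<cdot>\<^sub>X g y \<cdot>\<^sub>X c"
        unfolding c(2) by (rule assoc(2) [OF g_closed [OF y(1)] subsetD [OF C(2) c(1)]])
      with c(1) show ?thesis by (rule bexI [rotated])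
    qed
    then show "\<exists>C. finite C \<and> C \<subseteq> carrier X.G \<and> (\<forall>y\<in>carrier Y.G. \<forall>b\<in>B.
        \<exists>c\<in>C. inv\<^bsub>X.G\<^esub> w \<cdot>\<^sub>X g (y \<cdot>\<^sub>Y b) = inv\<^bsub>X.G\<^esub> w \<cdot>\<^sub>X g y \<cdot>\<^sub>X c)"
      using C(1,2) by (intro exI [of _ C] conjI ballI)
  qed
  show "close_to_id X.G (\<lambda>x. inv\<^bsub>X.G\<^esub> w \<cdot>\<^sub>X g (f (w \<cdot>\<^sub>X x)))"
  proof -
    obtain C where C: "finite C" "C \<subseteq> carrier X.G" "\<And>x. x \<in> carrier X.G \<Longrightarrow> \<exists>c\<in>C. g (f x) = x \<cdot>\<^sub>X c"
      using gf_close unfolding close_to_id_def by blast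
    have "\<exists>c\<in>C. inv\<^bsub>X.G\<^esub> w \<cdot>\<^sub>X g (f (w \<cdot>\<^sub>X x)) = x \<cdot>\<^sub>X c" if x: "x \<in> carrier X.G" for x
    proof -
      have wx: "w \<cdot>\<^sub>X x \<in> carrier X.G" using w x by (rule X.G.m_closed)
      obtain c where c: "c \<in> C" "g (f (w \<cdot>\<^sub>X x)) = w \<cdot>\<^sub>X x \<cdot>\<^sub>X c" using C(3) [OF wx] by blast
      have cC: "c \<in> carrier X.G" using c C by auto
      have "inv\<^bsub>X.G\<^esub> w \<cdot>\<^sub>X g (f (w \<cdot>\<^sub>X x)) = x \<cdot>\<^sub>X c"
        unfolding c(2) assoc(2) [OF wx cC] using w x by (simp add: X.G.m_assoc [symmetric] del: X.mult_G)
      with c(1) show ?thesis by (rule bexI [rotated])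
    qed
    then show ?thesis unfolding close_to_id_def using C(1,2) by (intro exI [of _ C] conjI ballI)
  qed
  show "close_to_id Y.G (\<lambda>y. f (w \<cdot>\<^sub>X (inv\<^bsub>X.G\<^esub> w \<cdot>\<^sub>X g y)))"
  proof -
    have "w \<cdot>\<^sub>X (inv\<^bsub>X.G\<^esub> w \<cdot>\<^sub>X g y) = g y" if "y \<in> carrier Y.G" for y
      using w g_closed [OF that] by (simp add: X.G.m_assoc [symmetric] del: X.mult_G)
    then show ?thesis using fg_close unfolding close_to_id_def by simp
  qed
qed

text \<open>
  The point \<open>q = g ([], r)\<close> is near the median of three points, and so is its translate by the inverse of \<open>w\<close>.
  The element whose length is bounded here is the displacement of \<open>q\<close> by \<open>w\<close>.
\<close>
lemma bounded_conjugates: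
  assumes x: "x \<in> A" "x' \<in> A" "x \<noteq> x'" and w: "w \<in> carrier X.F"
  shows "\<exists>N. \<forall>r h m. g ([], r) = (h, m) \<longrightarrow>
    length (\<phi> (- m) (inv\<^bsub>X.F\<^esub> h \<otimes>\<^bsub>X.F\<^esub> w \<otimes>\<^bsub>X.F\<^esub> h)) \<le> N"
proof -
  have W: "coarse_pair A \<phi> (\<lambda>x. f ((w, 0) \<cdot>\<^sub>X x)) (\<lambda>y. inv\<^bsub>X.G\<^esub> (w, 0) \<cdot>\<^sub>X g y)"
    using w by (intro coarse_pair_translate) simp
  let ?L = "{(x, True), (x, False), (x', True)}"
  have L: "finite ?L" "fst ` ?L \<subseteq> A" using x by auto
  obtain N where N: "\<forall>r. \<exists>J. \<forall>K>J. \<forall>l\<in>?L. \<forall>l'\<in>?L. \<forall>p. l \<noteq> l' \<longrightarrow>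
    prefix p (X.view (g ([], r)) (replicate K l)) \<longrightarrow> prefix p (X.view (g ([], r)) (replicate K l')) \<longrightarrow>
    length p \<le> N"
    using median_near_vertical_line [OF L] ..
  obtain M where M: "\<forall>r. \<exists>J. \<forall>K>J. \<forall>l\<in>?L. \<forall>l'\<in>?L. \<forall>p. l \<noteq> l' \<longrightarrow>
    prefix p (X.view (inv\<^bsub>X.G\<^esub> (w, 0) \<cdot>\<^sub>X g ([], r)) (replicate K l)) \<longrightarrow>
    prefix p (X.view (inv\<^bsub>X.G\<^esub> (w, 0) \<cdot>\<^sub>X g ([], r)) (replicate K l')) \<longrightarrow>
    length p \<le> M"
    using coarse_pair.median_near_vertical_line [OF W L] ..
  have "length (\<phi> (- m) (inv\<^bsub>X.F\<^esub> h \<otimes>\<^bsub>X.F\<^esub> w \<otimes>\<^bsub>X.F\<^esub> h)) \<le> 2 * max N M" if gr: "g ([], r) = (h, m)" for r h m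
  proof -
    have q: "(h, m) \<in> carrier X.G" using g_closed [of "([], r)"] gr by simp
    have h: "h \<in> carrier X.F" using q by simp
    from N obtain J where J: "\<And>K l l' p. \<lbrakk>K > J; l \<in> ?L; l' \<in> ?L; l \<noteq> l';
      prefix p (X.view (h, m) (replicate K l)); prefix p (X.view (h, m) (replicate K l'))\<rbrakk> \<Longrightarrow> length p \<le> N"
      unfolding gr [symmetric] by meson
    from M obtain J' where J': "\<And>K l l' p. \<lbrakk>K > J'; l \<in> ?L; l' \<in> ?L; l \<noteq> l';
      prefix p (X.view (inv\<^bsub>X.G\<^esub> (w, 0) \<cdot>\<^sub>X (h, m)) (replicate K l));
      prefix p (X.view (inv\<^bsub>X.G\<^esub> (w, 0) \<cdot>\<^sub>X (h, m)) (replicate K l'))\<rbrakk> \<Longrightarrow> length p \<le> M"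
      unfolding gr [symmetric] by meson
    define K where "K = Suc (max J J')"
    define P where "P l = X.view (h, m) (replicate K l)" for l
    let ?y = "\<phi> (- m) (inv\<^bsub>X.F\<^esub> h \<otimes>\<^bsub>X.F\<^esub> w \<otimes>\<^bsub>X.F\<^esub> h)"
    have y: "?y \<in> carrier X.F" using h w by (simp add: X.\<phi>_closed)
    have rep: "replicate K l \<in> carrier X.F" if "l \<in> ?L" for l
      using that x by (auto intro!: replicate_free_group)
    have inj: "P l \<noteq> P l'" if "l \<in> ?L" "l' \<in> ?L" "l \<noteq> l'" for l l'
      using inj_onD [OF X.inj_view [OF q], of "replicate K l" "replicate K l'"] rep that
      by (auto simp: P_def K_def)
    have yP: "?y \<otimes>\<^bsub>X.F\<^esub> P l = X.view (inv\<^bsub>X.G\<^esub> (w, 0) \<cdot>\<^sub>X (h, m)) (replicate K l)" if "l \<in> ?L" for l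
      unfolding P_def by (rule X.view_left_mult [OF q w rep [OF that], symmetric])
    have img: "{P (x, True), P (x, False), P (x', True)} = P ` ?L" by simp
    have KJ: "J < K" "J' < K" by (auto simp: K_def)
    show ?thesis
    proof (rule near_median_imp_close [OF y, of "P (x, True)" "P (x, False)" "P (x', True)"])
      show "P (x, True) \<noteq> P (x, False)" "P (x, False) \<noteq> P (x', True)" "P (x, True) \<noteq> P (x', True)"
        using x(3) by (intro inj; simp)+
      fix a b p
      assume ab: "a \<in> {P (x, True), P (x, False), P (x', True)}" "b \<in> {P (x, True), P (x, False), P (x', True)}" "a \<noteq> b"
      then obtain l l' where l: "l \<in> ?L" "l' \<in> ?L" "a = P l" "b = P l'" "l \<noteq> l'" unfolding img by blast
      show "length p \<le> max N M" if p: "prefix p a" "prefix p b"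
      proof -
        have "length p \<le> N"
          by (rule J [OF KJ(1) l(1,2,5)]) (use p l in \<open>simp_all add: P_def\<close>)
        then show ?thesis by simp
      qed
      show "length p \<le> max N M" if p: "prefix p (?y \<otimes>\<^bsub>X.F\<^esub> a)" "prefix p (?y \<otimes>\<^bsub>X.F\<^esub> b)"
      proof -
        have "length p \<le> M"
          by (rule J' [OF KJ(2) l(1,2,5)]) (use p in \<open>simp_all only: l yP [OF l(1)] yP [OF l(2)]\<close>)
        then show ?thesis by simp
      qed
    qed
  qed
  then show ?thesis by blast
qed


text \<open>
  There are infinitely many points \<open>g ([], r)\<close>, and they conjugate each generator to finitely many
  elements only. So two of them conjugate all generators alike, and their quotient commutes with
  the whole of \<open>F\<close>. It does not lie in \<open>F\<close> itself, since a free group of rank at least two has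
  trivial centre.
\<close>
theorem power_is_inner:
  assumes x: "x \<in> A" "x' \<in> A" "x \<noteq> x'"
  shows "\<exists>m w. m \<noteq> 0 \<and> w \<in> carrier X.F \<and> (\<forall>u\<in>carrier X.F. w \<otimes>\<^bsub>X.F\<^esub> \<phi> m u = u \<otimes>\<^bsub>X.F\<^esub> w)"
proof -
  have "\<forall>y\<in>A. \<exists>N. \<forall>r h m. g ([], r) = (h, m) \<longrightarrow>
      length (\<phi> (- m) (inv\<^bsub>X.F\<^esub> h \<otimes>\<^bsub>X.F\<^esub> [(y, True)] \<otimes>\<^bsub>X.F\<^esub> h)) \<le> N"
    by (intro ballI bounded_conjugates [OF x]) simp
  from bchoice [OF this] obtain N where N: "\<And>y r h m. \<lbrakk>y \<in> A; g ([], r) = (h, m)\<rbrakk> \<Longrightarrow>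
      length (\<phi> (- m) (inv\<^bsub>X.F\<^esub> h \<otimes>\<^bsub>X.F\<^esub> [(y, True)] \<otimes>\<^bsub>X.F\<^esub> h)) \<le> N y" by metis
  define Q where "Q = range (\<lambda>r. g ([], r))"
  have QC: "q \<in> carrier X.G" if "q \<in> Q" for q
    using that unfolding Q_def by (elim rangeE) (simp add: g_closed)
  have "infinite Q"
  proof
    assume "finite Q"
    then have "finite {y \<in> carrier Y.G. g y \<in> Q}" by (rule finite_g_vimage)
    moreover have "vertical_line \<subseteq> {y \<in> carrier Y.G. g y \<in> Q}"
      unfolding vertical_line_def
    proof (rule image_subsetI)
      fix r :: int
      have "g ([], r) \<in> Q" unfolding Q_def by (rule rangeI)
      moreover have "([], r) \<in> carrier Y.G" unfolding Y.mem_G by (rule Nil_free_group)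
      ultimately show "([], r) \<in> {y \<in> carrier Y.G. g y \<in> Q}" by (intro CollectI conjI)
    qed
    ultimately have "finite (vertical_line :: 'a point set)" by (rule finite_subset [rotated])
    then show False using infinite_vertical_line by contradiction
  qed
  define c where "c q = (\<lambda>y\<in>A. \<phi> (- snd q) (inv\<^bsub>X.F\<^esub> fst q \<otimes>\<^bsub>X.F\<^esub> [(y, True)] \<otimes>\<^bsub>X.F\<^esub> fst q))" for q
  have "c ` Q \<subseteq> (\<Pi>\<^sub>E y\<in>A. {w \<in> carrier X.F. length w \<le> N y})"
  proof
    fix d assume "d \<in> c ` Q"
    then obtain r where r: "d = c (g ([], r))" unfolding Q_def by (elim imageE) simp
    obtain h m where hm: "g ([], r) = (h, m)" by (cases "g ([], r)")
    note d = r [unfolded hm] hm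
    have h: "h \<in> carrier X.F" using g_closed [of "([], r)"] d(2) by simp
    show "d \<in> (\<Pi>\<^sub>E y\<in>A. {w \<in> carrier X.F. length w \<le> N y})"
      using N [OF _ d(2)] h by (auto simp: d(1) c_def X.\<phi>_closed)
  qed
  moreover have "finite (\<Pi>\<^sub>E y\<in>A. {w \<in> carrier X.F. length w \<le> N y})"
    by (intro finite_PiE X.X_finite finite_words_length_le)
  ultimately have "finite (c ` Q)" by (rule finite_subset)
  then have "\<not> inj_on c Q" using \<open>infinite Q\<close> finite_imageD by blast
  then obtain q q' where q: "q \<in> Q" "q' \<in> Q" "q \<noteq> q'" "c q = c q'" unfolding inj_on_def by blast
  obtain h m h' m' where hm: "q = (h, m)" "q' = (h', m')" by (cases q; cases q')
  have qC: "q \<in> carrier X.G" "q' \<in> carrier X.G" using QC q(1,2) by simp_all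
  then have h: "h \<in> carrier X.F" "h' \<in> carrier X.F" unfolding hm X.mem_G .
  have conj: "inv\<^bsub>X.G\<^esub> (k, j) \<cdot>\<^sub>X (a, 0) \<cdot>\<^sub>X (k, j) = (\<phi> (- j) (inv\<^bsub>X.F\<^esub> k \<otimes>\<^bsub>X.F\<^esub> a \<otimes>\<^bsub>X.F\<^esub> k), 0)"
    if "k \<in> carrier X.F" "a \<in> carrier X.F" for k j a
    using that by (simp add: X.inv_G X.\<phi>_mult)
  define z where "z = q' \<cdot>\<^sub>X inv\<^bsub>X.G\<^esub> q"
  have zC: "z \<in> carrier X.G" unfolding z_def using qC by (simp del: X.mult_G)
  define Cz where "Cz = {u \<in> carrier X.F. z \<cdot>\<^sub>X (u, 0) = (u, 0) \<cdot>\<^sub>X z}"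
  have gen: "[(y, True)] \<in> Cz" if y: "y \<in> A" for y
  proof -
    let ?a = "([(y, True)], 0)"
    have a: "?a \<in> carrier X.G" using y by simp
    have "c q y = c q' y" using q(4) by simp
    then have e: "inv\<^bsub>X.G\<^esub> q \<cdot>\<^sub>X ?a \<cdot>\<^sub>X q = inv\<^bsub>X.G\<^esub> q' \<cdot>\<^sub>X ?a \<cdot>\<^sub>X q'"
      using y h unfolding hm c_def by (simp add: conj del: X.mult_G)
    have "z \<cdot>\<^sub>X ?a = q' \<cdot>\<^sub>X (inv\<^bsub>X.G\<^esub> q \<cdot>\<^sub>X ?a \<cdot>\<^sub>X q) \<cdot>\<^sub>X inv\<^bsub>X.G\<^esub> q"
      using qC a unfolding z_def by (simp add: X.G.m_assoc del: X.mult_G X.mem_G)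
    also have "\<dots> = ?a \<cdot>\<^sub>X z"
      unfolding e z_def using qC a
      by (simp add: X.G.m_assoc [symmetric] del: X.mult_G X.mem_G)
    finally show ?thesis using y by (simp add: Cz_def del: X.mult_G)
  qed
  have "subgroup Cz X.F"
  proof (rule X.F.subgroupI)
    fix u v assume u: "u \<in> Cz" and v: "v \<in> Cz"
    have C: "u \<in> carrier X.F" "v \<in> carrier X.F" "(u, 0) \<in> carrier X.G" "(v, 0) \<in> carrier X.G"
      using u v by (auto simp: Cz_def)
    have uv: "(u \<otimes>\<^bsub>X.F\<^esub> v, 0) = (u, 0) \<cdot>\<^sub>X (v, 0)" using C by (simp add: X.\<phi>_0)
    have "z \<cdot>\<^sub>X ((u, 0) \<cdot>\<^sub>X (v, 0)) = (u, 0) \<cdot>\<^sub>X z \<cdot>\<^sub>X (v, 0)"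
      using u zC C by (simp add: Cz_def X.G.m_assoc [symmetric] del: X.mult_G)
    also have "\<dots> = (u, 0) \<cdot>\<^sub>X (v, 0) \<cdot>\<^sub>X z"
      using v zC C by (simp add: Cz_def X.G.m_assoc del: X.mult_G)
    finally show "u \<otimes>\<^bsub>X.F\<^esub> v \<in> Cz" using C unfolding Cz_def uv [symmetric] by simp
  next
    fix u assume u: "u \<in> Cz"
    have C: "u \<in> carrier X.F" "(u, 0) \<in> carrier X.G" using u by (auto simp: Cz_def)
    have iu: "(inv\<^bsub>X.F\<^esub> u, 0) = inv\<^bsub>X.G\<^esub> (u, 0)" using C by (simp add: X.inv_G X.\<phi>_0)
    have "z \<cdot>\<^sub>X (u, 0) = (u, 0) \<cdot>\<^sub>X z" using u by (simp add: Cz_def del: X.mult_G)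
    then have "inv\<^bsub>X.G\<^esub> (u, 0) \<cdot>\<^sub>X (z \<cdot>\<^sub>X (u, 0)) \<cdot>\<^sub>X inv\<^bsub>X.G\<^esub> (u, 0) =
        inv\<^bsub>X.G\<^esub> (u, 0) \<cdot>\<^sub>X ((u, 0) \<cdot>\<^sub>X z) \<cdot>\<^sub>X inv\<^bsub>X.G\<^esub> (u, 0)" by (simp only:)
    moreover have "inv\<^bsub>X.G\<^esub> (u, 0) \<cdot>\<^sub>X (z \<cdot>\<^sub>X (u, 0)) \<cdot>\<^sub>X inv\<^bsub>X.G\<^esub> (u, 0) = inv\<^bsub>X.G\<^esub> (u, 0) \<cdot>\<^sub>X z"
      using zC C(2) by (simp add: X.G.m_assoc del: X.mult_G X.mem_G)
    moreover have "inv\<^bsub>X.G\<^esub> (u, 0) \<cdot>\<^sub>X ((u, 0) \<cdot>\<^sub>X z) \<cdot>\<^sub>X inv\<^bsub>X.G\<^esub> (u, 0) = z \<cdot>\<^sub>X inv\<^bsub>X.G\<^esub> (u, 0)"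
      using zC C(2) by (simp add: X.G.m_assoc [symmetric] del: X.mult_G X.mem_G)
    ultimately show "inv\<^bsub>X.F\<^esub> u \<in> Cz" using C(1) unfolding Cz_def iu [symmetric] by simp
  next
    show "Cz \<subseteq> carrier X.F" unfolding Cz_def by blast
    show "Cz \<noteq> {}" using gen [OF x(1)] by blast
  qed
  then interpret Cz: subgroup Cz X.F .
  have letter: "[l] \<in> Cz" if l: "fst l \<in> A" for l
  proof (cases "snd l")
    case True
    then show ?thesis using gen [OF l] by (cases l) auto
  next
    case False
    have "inv\<^bsub>X.F\<^esub> [(fst l, True)] = [l]"
      using l False by (cases l) (simp add: inv_free_group inv_letter_def)
    then show ?thesis using Cz.m_inv_closed [OF gen [OF l]] by simp
  qed
  have all: "u \<in> Cz" if "u \<in> carrier X.F" for u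
    using that
  proof (induction u)
    case Nil
    show ?case using Cz.one_closed by simp
  next
    case (Cons l u)
    note lu = X.Cons_F [OF Cons.prems]
    show ?case unfolding lu(4) using Cz.m_closed [OF letter [OF lu(1)] Cons.IH [OF lu(2)]] .
  qed
  obtain w j where zwj: "z = (w, j)" by (cases z)
  have w: "w \<in> carrier X.F" using zC unfolding zwj by simp
  have comm: "w \<otimes>\<^bsub>X.F\<^esub> \<phi> j u = u \<otimes>\<^bsub>X.F\<^esub> w" if u: "u \<in> carrier X.F" for u
    using all [OF u] w unfolding Cz_def zwj by (simp add: X.\<phi>_0)
  have "j \<noteq> 0"
  proof
    assume j: "j = 0"
    have "w = []"
      by (rule centre_free_group_trivial [OF w x]) (use comm j in \<open>simp add: X.\<phi>_0\<close>)
    then have "z = \<one>\<^bsub>X.G\<^esub>" using j by (simp add: zwj X.one_G)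
    then have "z \<cdot>\<^sub>X q = q" using qC by simp
    moreover have "z \<cdot>\<^sub>X q = q'"
      unfolding z_def using qC by (simp add: X.G.m_assoc del: X.mult_G X.mem_G)
    ultimately have "q' = q" by simp
    then show False using q(3) by simp
  qed
  then show ?thesis using w comm by blast
qed

end

section \<open>Word metrics\<close>

lemma cayley_dist_attained:
  assumes "group G" "finite_generating_set G S" "x \<in> carrier G" "y \<in> carrier G"
  obtains k where "cayley_dist G S x y = real k" "(cayley_adj G S ^^ k) x y"
proof
  show "cayley_dist G S x y = real (LEAST k. (cayley_adj G S ^^ k) x y)" by (simp add: cayley_dist_def)
  have "\<exists>k. (cayley_adj G S ^^ k) x y"
    using assms by (intro cayley_connected) (auto simp: finite_generating_set_def)
  then show "(cayley_adj G S ^^ (LEAST k. (cayley_adj G S ^^ k) x y)) x y" by (rule LeastI_ex)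
qed

lemma cayley_dist_le: "(cayley_adj G S ^^ k) x y \<Longrightarrow> cayley_dist G S x y \<le> real k"
  by (simp add: cayley_dist_def Least_le)

lemma cayley_dist_adj: "cayley_adj G S x y \<Longrightarrow> cayley_dist G S x y \<le> 1"
  using cayley_dist_le [of 1 G S x y] by (simp only: relpowp_1 of_nat_1)

lemma Metric_space_cayley_dist:
  "\<lbrakk>group G; finite_generating_set G S\<rbrakk> \<Longrightarrow> Metric_space (carrier G) (cayley_dist G S)"
  by (rule Metric_space_cayley) (auto simp: finite_generating_set_def)

lemma cayley_lipschitz:
  assumes G: "group G" "finite_generating_set G S" and H: "group H" "finite_generating_set H T"
    and f: "f \<in> carrier G \<rightarrow> carrier H"
    and adj: "\<And>x y. cayley_adj G S x y \<Longrightarrow> cayley_dist H T (f x) (f y) \<le> L"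
    and x: "x \<in> carrier G" and y: "y \<in> carrier G"
  shows "cayley_dist H T (f x) (f y) \<le> L * cayley_dist G S x y"
proof -
  interpret H: Metric_space "carrier H" "cayley_dist H T" by (rule Metric_space_cayley_dist [OF H])
  have "(cayley_adj G S ^^ k) x y \<Longrightarrow> y \<in> carrier G \<Longrightarrow> cayley_dist H T (f x) (f y) \<le> L * real k" for k y
  proof (induction k arbitrary: y)
    case 0
    then have "f x \<in> carrier H" "y = x" using x f by auto
    then show ?case using H.zero [of "f x" "f x"] by simp
  next
    case (Suc k)
    then obtain z where z: "(cayley_adj G S ^^ k) x z" "cayley_adj G S z y" by (meson relpowp_Suc_E)
    have zC: "z \<in> carrier G" using z(2) by (simp add: cayley_adj_def)
    have "cayley_dist H T (f x) (f y) \<le> cayley_dist H T (f x) (f z) + cayley_dist H T (f z) (f y)"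
      using f x zC Suc.prems(2) by (intro H.triangle) auto
    also have "\<dots> \<le> L * real k + L" using Suc.IH [OF z(1) zC] adj [OF z(2)] by simp
    finally show ?case by (simp add: algebra_simps)
  qed
  then show ?thesis using cayley_dist_attained [OF G x y] y by metis
qed

lemma cayley_dist_left_mult:
  assumes G: "group G" "finite_generating_set G S"
    and a: "a \<in> carrier G" and x: "x \<in> carrier G" and y: "y \<in> carrier G"
  shows "cayley_dist G S (a \<otimes>\<^bsub>G\<^esub> x) (a \<otimes>\<^bsub>G\<^esub> y) = cayley_dist G S x y"
proof -
  interpret group G by fact
  have S: "S \<subseteq> carrier G" using G(2) by (simp add: finite_generating_set_def)
  have le: "cayley_dist G S (a \<otimes>\<^bsub>G\<^esub> x) (a \<otimes>\<^bsub>G\<^esub> y) \<le> 1 * cayley_dist G S x y"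
    if a: "a \<in> carrier G" and x: "x \<in> carrier G" and y: "y \<in> carrier G" for a x y
  proof (rule cayley_lipschitz [OF G G _ _ x y])
    show "(\<lambda>x. a \<otimes>\<^bsub>G\<^esub> x) \<in> carrier G \<rightarrow> carrier G" using a by auto
    fix x y assume xy: "cayley_adj G S x y"
    then have C: "x \<in> carrier G" "y \<in> carrier G" by (simp_all add: cayley_adj_def)
    from xy obtain s where s: "s \<in> S" "y = x \<otimes>\<^bsub>G\<^esub> s \<or> x = y \<otimes>\<^bsub>G\<^esub> s" unfolding cayley_adj_def by blast
    have "s \<in> carrier G" using s S by auto
    then have "a \<otimes>\<^bsub>G\<^esub> y = a \<otimes>\<^bsub>G\<^esub> x \<otimes>\<^bsub>G\<^esub> s \<or> a \<otimes>\<^bsub>G\<^esub> x = a \<otimes>\<^bsub>G\<^esub> y \<otimes>\<^bsub>G\<^esub> s"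
      using s(2) a C by (metis m_assoc)
    then have "cayley_adj G S (a \<otimes>\<^bsub>G\<^esub> x) (a \<otimes>\<^bsub>G\<^esub> y)"
      using a C s(1) unfolding cayley_adj_def by blast
    then show "cayley_dist G S (a \<otimes>\<^bsub>G\<^esub> x) (a \<otimes>\<^bsub>G\<^esub> y) \<le> 1"
      by (rule cayley_dist_adj)
  qed
  have "inv\<^bsub>G\<^esub> a \<otimes>\<^bsub>G\<^esub> (a \<otimes>\<^bsub>G\<^esub> z) = z" if "z \<in> carrier G" for z
    using a that by (simp add: m_assoc [symmetric])
  then show ?thesis
    using le [OF a x y] le [of "inv\<^bsub>G\<^esub> a" "a \<otimes>\<^bsub>G\<^esub> x" "a \<otimes>\<^bsub>G\<^esub> y"] a x y by simp
qed

lemma finite_cayley_ball: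
  assumes G: "group G" "finite_generating_set G S" and x: "x \<in> carrier G"
  shows "finite {y \<in> carrier G. cayley_dist G S x y \<le> R}"
proof -
  interpret group G by fact
  have S: "finite S" "S \<subseteq> carrier G" using G(2) by (simp_all add: finite_generating_set_def)
  have nbr: "{z. cayley_adj G S y z} \<subseteq> (\<lambda>s. y \<otimes>\<^bsub>G\<^esub> s) ` S \<union> (\<lambda>s. y \<otimes>\<^bsub>G\<^esub> inv\<^bsub>G\<^esub> s) ` S" for y
  proof
    fix z assume "z \<in> {z. cayley_adj G S y z}"
    then obtain s where s: "s \<in> S" "z = y \<otimes>\<^bsub>G\<^esub> s \<or> y = z \<otimes>\<^bsub>G\<^esub> s" "z \<in> carrier G" "y \<in> carrier G"
      unfolding cayley_adj_def by blast
    then have "z = y \<otimes>\<^bsub>G\<^esub> s \<or> z = y \<otimes>\<^bsub>G\<^esub> inv\<^bsub>G\<^esub> s"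
      using S by (metis inv_solve_right subsetD)
    then show "z \<in> (\<lambda>s. y \<otimes>\<^bsub>G\<^esub> s) ` S \<union> (\<lambda>s. y \<otimes>\<^bsub>G\<^esub> inv\<^bsub>G\<^esub> s) ` S" using s(1) by blast
  qed
  have sphere: "finite {z. (cayley_adj G S ^^ k) x z}" for k
  proof (induction k)
    case (Suc k)
    have "{z. (cayley_adj G S ^^ Suc k) x z} \<subseteq> (\<Union>y\<in>{z. (cayley_adj G S ^^ k) x z}. {z. cayley_adj G S y z})"
      by auto
    moreover have "finite {z. cayley_adj G S y z}" for y using nbr [of y] S(1) by (meson finite_Un finite_imageI finite_subset)
    ultimately show ?case using Suc by (meson finite_UN_I finite_subset)
  qed simp
  have "{y \<in> carrier G. cayley_dist G S x y \<le> R} \<subseteq> (\<Union>k\<in>{..nat \<lfloor>R\<rfloor>}. {z. (cayley_adj G S ^^ k) x z})"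
  proof
    fix y assume y: "y \<in> {y \<in> carrier G. cayley_dist G S x y \<le> R}"
    then obtain k where k: "cayley_dist G S x y = real k" "(cayley_adj G S ^^ k) x y"
      using cayley_dist_attained [OF G x, of y] by blast
    then have "k \<le> nat \<lfloor>R\<rfloor>" using y by (simp add: le_nat_floor)
    then show "y \<in> (\<Union>k\<in>{..nat \<lfloor>R\<rfloor>}. {z. (cayley_adj G S ^^ k) x z})" using k(2) by blast
  qed
  then show ?thesis by (rule finite_subset) (use sphere in blast)
qed

text \<open>
  Balls are finite and the metric is left invariant, so points at a bounded distance differ by an element of a
  finite set.
\<close>
lemma cayley_close_set:
  assumes G: "group G" "finite_generating_set G S"
  obtains C where "finite C" "C \<subseteq> carrier G"
    "\<And>x y. \<lbrakk>x \<in> carrier G; y \<in> carrier G; cayley_dist G S x y \<le> R\<rbrakk> \<Longrightarrow> \<exists>c\<in>C. y = x \<otimes>\<^bsub>G\<^esub> c"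
proof
  interpret group G by fact
  let ?C = "{y \<in> carrier G. cayley_dist G S \<one>\<^bsub>G\<^esub> y \<le> R}"
  show "finite ?C" by (rule finite_cayley_ball [OF G]) simp
  show "?C \<subseteq> carrier G" by blast
  fix x y assume xy: "x \<in> carrier G" "y \<in> carrier G" "cayley_dist G S x y \<le> R"
  have "cayley_dist G S \<one>\<^bsub>G\<^esub> (inv\<^bsub>G\<^esub> x \<otimes>\<^bsub>G\<^esub> y) = cayley_dist G S x y"
    using cayley_dist_left_mult [OF G, of "inv\<^bsub>G\<^esub> x" x y] xy by simp
  then have "inv\<^bsub>G\<^esub> x \<otimes>\<^bsub>G\<^esub> y \<in> ?C" using xy by simp
  moreover have "y = x \<otimes>\<^bsub>G\<^esub> (inv\<^bsub>G\<^esub> x \<otimes>\<^bsub>G\<^esub> y)" using xy by (simp add: m_assoc [symmetric])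
  ultimately show "\<exists>c\<in>?C. y = x \<otimes>\<^bsub>G\<^esub> c" by blast
qed

lemma cayley_bounded_steps:
  assumes G: "group G" "finite_generating_set G S" and B: "finite B" "B \<subseteq> carrier G"
  obtains R where "\<And>x b. \<lbrakk>x \<in> carrier G; b \<in> B\<rbrakk> \<Longrightarrow> cayley_dist G S x (x \<otimes>\<^bsub>G\<^esub> b) \<le> R"
proof
  interpret group G by fact
  fix x b assume xb: "x \<in> carrier G" "b \<in> B"
  then have "b \<in> carrier G" using B by auto
  then have "cayley_dist G S x (x \<otimes>\<^bsub>G\<^esub> b) = cayley_dist G S \<one>\<^bsub>G\<^esub> b"
    using cayley_dist_left_mult [OF G, of x "\<one>\<^bsub>G\<^esub>" b] xb by simp
  also have "\<dots> \<le> Max (cayley_dist G S \<one>\<^bsub>G\<^esub> ` B)" using xb B by (intro Max_ge) auto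
  finally show "cayley_dist G S x (x \<otimes>\<^bsub>G\<^esub> b) \<le> Max (cayley_dist G S \<one>\<^bsub>G\<^esub> ` B)" .
qed

lemma quasi_isometric_imp_coarse:
  assumes G: "group G" "finite_generating_set G S" and H: "group H" "finite_generating_set H T"
    and qi: "quasi_isometric (carrier G) (cayley_dist G S) (carrier H) (cayley_dist H T)"
  shows "\<exists>f g. coarse_map G H f \<and> coarse_map H G g \<and>
    close_to_id G (\<lambda>x. g (f x)) \<and> close_to_id H (\<lambda>y. f (g y))"
proof -
  let ?d = "cayley_dist G S" and ?e = "cayley_dist H T"
  interpret G: group G by fact
  interpret H: group H by fact
  interpret GM: Metric_space "carrier G" ?d by (rule Metric_space_cayley_dist [OF G])
  interpret HM: Metric_space "carrier H" ?e by (rule Metric_space_cayley_dist [OF H])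
  from qi obtain f K C where f: "f \<in> carrier G \<rightarrow> carrier H" and K: "K \<ge> 1" and C: "C \<ge> 0"
    and lower: "\<And>x y. \<lbrakk>x \<in> carrier G; y \<in> carrier G\<rbrakk> \<Longrightarrow> ?d x y / K - C \<le> ?e (f x) (f y)"
    and upper: "\<And>x y. \<lbrakk>x \<in> carrier G; y \<in> carrier G\<rbrakk> \<Longrightarrow> ?e (f x) (f y) \<le> K * ?d x y + C"
    and onto: "\<forall>z\<in>carrier H. \<exists>x\<in>carrier G. ?e (f x) z \<le> C"
    unfolding quasi_isometric_def by blast
  have fC: "f x \<in> carrier H" if "x \<in> carrier G" for x using f that by auto
  have dist: "?d x y \<le> K * (R + C)" if "x \<in> carrier G" "y \<in> carrier G" "?e (f x) (f y) \<le> R" for x y R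
  proof -
    have "?d x y / K \<le> R + C" using lower [OF that(1,2)] that(3) by linarith
    then show ?thesis using K by (simp add: pos_divide_le_eq mult.commute)
  qed
  from bchoice [OF onto [unfolded Bex_def]] obtain g where
    g: "\<And>z. z \<in> carrier H \<Longrightarrow> g z \<in> carrier G" "\<And>z. z \<in> carrier H \<Longrightarrow> ?e (f (g z)) z \<le> C" by blast
  have "coarse_map G H f"
    unfolding coarse_map_def
  proof (intro conjI allI impI f)
    fix B assume B: "finite B" "B \<subseteq> carrier G"
    obtain R where R: "\<And>x b. \<lbrakk>x \<in> carrier G; b \<in> B\<rbrakk> \<Longrightarrow> ?d x (x \<otimes>\<^bsub>G\<^esub> b) \<le> R"
      using cayley_bounded_steps [OF G B] by blast
    obtain D where D: "finite D" "D \<subseteq> carrier H"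
      "\<And>x y. \<lbrakk>x \<in> carrier H; y \<in> carrier H; ?e x y \<le> K * R + C\<rbrakk> \<Longrightarrow> \<exists>c\<in>D. y = x \<otimes>\<^bsub>H\<^esub> c"
      using cayley_close_set [OF H] by metis
    have "\<exists>c\<in>D. f (x \<otimes>\<^bsub>G\<^esub> b) = f x \<otimes>\<^bsub>H\<^esub> c" if x: "x \<in> carrier G" and b: "b \<in> B" for x b
    proof (rule D(3))
      have xb: "x \<otimes>\<^bsub>G\<^esub> b \<in> carrier G" using x b B by auto
      show "f x \<in> carrier H" "f (x \<otimes>\<^bsub>G\<^esub> b) \<in> carrier H" using fC x xb by auto
      have "K * ?d x (x \<otimes>\<^bsub>G\<^esub> b) \<le> K * R" using R [OF x b] K by (intro mult_left_mono) auto
      then show "?e (f x) (f (x \<otimes>\<^bsub>G\<^esub> b)) \<le> K * R + C" using upper [OF x xb] by linarith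
    qed
    then show "\<exists>D. finite D \<and> D \<subseteq> carrier H \<and> (\<forall>x\<in>carrier G. \<forall>b\<in>B. \<exists>c\<in>D. f (x \<otimes>\<^bsub>G\<^esub> b) = f x \<otimes>\<^bsub>H\<^esub> c)"
      using D(1,2) by blast
  qed
  moreover have "coarse_map H G g"
    unfolding coarse_map_def
  proof (intro conjI allI impI)
    show "g \<in> carrier H \<rightarrow> carrier G" using g(1) by blast
    fix B assume B: "finite B" "B \<subseteq> carrier H"
    obtain R where R: "\<And>y b. \<lbrakk>y \<in> carrier H; b \<in> B\<rbrakk> \<Longrightarrow> ?e y (y \<otimes>\<^bsub>H\<^esub> b) \<le> R"
      using cayley_bounded_steps [OF H B] by blast
    obtain D where D: "finite D" "D \<subseteq> carrier G"
      "\<And>x y. \<lbrakk>x \<in> carrier G; y \<in> carrier G; ?d x y \<le> K * ((C + R + C) + C)\<rbrakk> \<Longrightarrow> \<exists>c\<in>D. y = x \<otimes>\<^bsub>G\<^esub> c"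
      using cayley_close_set [OF G] by metis
    have "\<exists>c\<in>D. g (y \<otimes>\<^bsub>H\<^esub> b) = g y \<otimes>\<^bsub>G\<^esub> c" if y: "y \<in> carrier H" and b: "b \<in> B" for y b
    proof (rule D(3))
      have yb: "y \<otimes>\<^bsub>H\<^esub> b \<in> carrier H" using y b B by auto
      show gy: "g y \<in> carrier G" "g (y \<otimes>\<^bsub>H\<^esub> b) \<in> carrier G" using g(1) y yb by auto
      have "?e (f (g y)) (f (g (y \<otimes>\<^bsub>H\<^esub> b))) \<le> ?e (f (g y)) y + ?e y (f (g (y \<otimes>\<^bsub>H\<^esub> b)))"
        using y gy fC by (intro HM.triangle) auto
      also have "?e y (f (g (y \<otimes>\<^bsub>H\<^esub> b))) \<le> ?e y (y \<otimes>\<^bsub>H\<^esub> b) + ?e (y \<otimes>\<^bsub>H\<^esub> b) (f (g (y \<otimes>\<^bsub>H\<^esub> b)))"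
        using y yb gy fC by (intro HM.triangle) auto
      also have "?e (y \<otimes>\<^bsub>H\<^esub> b) (f (g (y \<otimes>\<^bsub>H\<^esub> b))) = ?e (f (g (y \<otimes>\<^bsub>H\<^esub> b))) (y \<otimes>\<^bsub>H\<^esub> b)"
        by (rule HM.commute)
      finally have "?e (f (g y)) (f (g (y \<otimes>\<^bsub>H\<^esub> b))) \<le> C + R + C"
        using g(2) [OF y] g(2) [OF yb] R [OF y b] by linarith
      from dist [OF gy this] show "?d (g y) (g (y \<otimes>\<^bsub>H\<^esub> b)) \<le> K * ((C + R + C) + C)" .
    qed
    then show "\<exists>D. finite D \<and> D \<subseteq> carrier G \<and> (\<forall>y\<in>carrier H. \<forall>b\<in>B. \<exists>c\<in>D. g (y \<otimes>\<^bsub>H\<^esub> b) = g y \<otimes>\<^bsub>G\<^esub> c)"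
      using D(1,2) by blast
  qed
  moreover have "close_to_id G (\<lambda>x. g (f x))"
  proof -
    obtain D where D: "finite D" "D \<subseteq> carrier G"
      "\<And>x y. \<lbrakk>x \<in> carrier G; y \<in> carrier G; ?d x y \<le> K * (C + C)\<rbrakk> \<Longrightarrow> \<exists>c\<in>D. y = x \<otimes>\<^bsub>G\<^esub> c"
      using cayley_close_set [OF G] by metis
    have "\<exists>c\<in>D. g (f x) = x \<otimes>\<^bsub>G\<^esub> c" if x: "x \<in> carrier G" for x
    proof (rule D(3) [OF x])
      show gf: "g (f x) \<in> carrier G" using x fC g(1) by blast
      have "?e (f x) (f (g (f x))) \<le> C" using g(2) [OF fC [OF x]] HM.commute by metis
      from dist [OF x gf this] show "?d x (g (f x)) \<le> K * (C + C)" .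
    qed
    then show ?thesis unfolding close_to_id_def using D(1,2) by blast
  qed
  moreover have "close_to_id H (\<lambda>y. f (g y))"
  proof -
    obtain D where D: "finite D" "D \<subseteq> carrier H"
      "\<And>x y. \<lbrakk>x \<in> carrier H; y \<in> carrier H; ?e x y \<le> C\<rbrakk> \<Longrightarrow> \<exists>c\<in>D. y = x \<otimes>\<^bsub>H\<^esub> c"
      using cayley_close_set [OF H] by metis
    have "\<exists>c\<in>D. f (g y) = y \<otimes>\<^bsub>H\<^esub> c" if y: "y \<in> carrier H" for y
      using g(2) [OF y] HM.commute [of y "f (g y)"] g(1) [OF y] by (intro D(3) [OF y] fC) auto
    then show ?thesis unfolding close_to_id_def using D(1,2) by blast
  qed
  ultimately show ?thesis by blast
qed

text \<open>
  A finite-index subgroup is quasi-isometric to the whole group: with coset representatives among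
  the generators, sending \<open>g = h r\<close> to its subgroup part \<open>h\<close> moves points by at most one edge.
\<close>
theorem virtually_imp_quasi_isometric_groups:
  assumes "group G" "group K" and T: "finite_generating_set K T" and virt: "virtually G K"
  shows "quasi_isometric_groups G K"
proof -
  interpret G: group G by fact
  interpret K: group K by fact
  obtain H where H: "subgroup H G" "finite (rcosets\<^bsub>G\<^esub> H)" "G\<lparr>carrier := H\<rparr> \<cong> K"
    using virt unfolding virtually_def by blast
  interpret H: subgroup H G by fact
  have HG: "group (G\<lparr>carrier := H\<rparr>)" by (rule H.subgroup_is_group [OF \<open>group G\<close>])
  have "K \<cong> G\<lparr>carrier := H\<rparr>" using group.iso_sym [OF HG H(3)] .
  then obtain \<theta> where \<theta>: "\<theta> \<in> iso K (G\<lparr>carrier := H\<rparr>)" unfolding is_iso_def by blast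
  have \<theta>H: "\<theta> k \<in> H" if "k \<in> carrier K" for k using \<theta> that by (auto simp: iso_def hom_def)
  have \<theta>M: "\<theta> (k \<otimes>\<^bsub>K\<^esub> l) = \<theta> k \<otimes>\<^bsub>G\<^esub> \<theta> l" if "k \<in> carrier K" "l \<in> carrier K" for k l
    using \<theta> that by (auto simp: iso_def hom_def)
  have \<theta>G: "\<theta> k \<in> carrier G" if "k \<in> carrier K" for k using \<theta>H [OF that] by simp
  have bij: "bij_betw \<theta> (carrier K) H" using \<theta> by (simp add: iso_def)
  interpret \<theta>: group_hom K G \<theta> by unfold_locales (auto simp: hom_def \<theta>G \<theta>M)
  define \<psi> where "\<psi> = inv_into (carrier K) \<theta>"
  have \<psi>K: "\<psi> h \<in> carrier K" and \<theta>\<psi>: "\<theta> (\<psi> h) = h" if "h \<in> H" for h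
    using that bij unfolding \<psi>_def bij_betw_def by (auto intro: inv_into_into f_inv_into_f)
  have \<psi>\<theta>: "\<psi> (\<theta> k) = k" if "k \<in> carrier K" for k
    using that bij unfolding \<psi>_def bij_betw_def by (simp add: inv_into_f_f)
  have T': "finite T" "T \<subseteq> carrier K" "generate K T = carrier K"
    using T by (simp_all add: finite_generating_set_def)
  define rep where "rep x = (SOME y. y \<in> H #>\<^bsub>G\<^esub> x)" for x
  have rep: "rep x \<in> H #>\<^bsub>G\<^esub> x" if "x \<in> carrier G" for x
    unfolding rep_def using G.rcos_self [OF that H(1)] by (rule someI)
  have repG: "rep x \<in> carrier G" if "x \<in> carrier G" for x
    using rep [OF that] G.r_coset_subset_G [OF H.subset that] by blast
  define R where "R = rep ` carrier G"
  have "R \<subseteq> (\<lambda>C. SOME y. y \<in> C) ` (rcosets\<^bsub>G\<^esub> H)"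
    unfolding R_def rep_def RCOSETS_def by blast
  then have R: "finite R" "R \<subseteq> carrier G" using H(2) repG by (auto simp: R_def finite_subset)
  define S where "S = \<theta> ` T \<union> R"
  have part: "x \<otimes>\<^bsub>G\<^esub> inv\<^bsub>G\<^esub> rep x \<in> H" if x: "x \<in> carrier G" for x
  proof -
    obtain h where h: "h \<in> H" "rep x = h \<otimes>\<^bsub>G\<^esub> x" using rep [OF x] unfolding r_coset_def by blast
    have "x \<otimes>\<^bsub>G\<^esub> inv\<^bsub>G\<^esub> rep x = inv\<^bsub>G\<^esub> h"
      unfolding h(2) using x h(1) by (simp add: G.inv_mult_group G.m_assoc [symmetric])
    then show ?thesis using h(1) by simp
  qed
  define part where "part x = x \<otimes>\<^bsub>G\<^esub> inv\<^bsub>G\<^esub> rep x" for x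
  have partH: "part x \<in> H" if "x \<in> carrier G" for x using part [OF that] by (simp add: part_def)
  have partG: "part x \<in> carrier G" if "x \<in> carrier G" for x using partH [OF that] by simp
  have split: "x = part x \<otimes>\<^bsub>G\<^esub> rep x" if "x \<in> carrier G" for x
    using that repG [OF that] by (simp add: part_def G.m_assoc)
  have SG: "S \<subseteq> carrier G" using R T' \<theta>G by (auto simp: S_def)
  have "\<theta> k \<in> generate G S" if "k \<in> generate K T" for k
    using that
  proof induction
    case one
    then show ?case by (simp add: generate.one)
  next
    case (incl k)
    then show ?case by (intro generate.incl) (simp add: S_def)
  next
    case (inv k)
    then have "\<theta> k \<in> S" "k \<in> carrier K" using T' by (auto simp: S_def)
    then show ?case by (simp add: generate.inv)
  next
    case (eng k l)
    then show ?case using T' by (simp add: generate.eng)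
  qed
  then have genH: "h \<in> generate G S" if "h \<in> H" for h
    using \<psi>K [OF that] \<theta>\<psi> [OF that] T'(3) by metis
  have "x \<in> generate G S" if x: "x \<in> carrier G" for x
  proof -
    have "rep x \<in> generate G S" using x by (intro generate.incl) (simp add: S_def R_def)
    from generate.eng [OF genH [OF partH [OF x]] this] split [OF x] show ?thesis by simp
  qed
  then have S: "finite_generating_set G S"
    unfolding finite_generating_set_def using G.generate_in_carrier [OF SG] SG T' R
    by (auto simp: S_def)
  note GS = \<open>group G\<close> S and KT = \<open>group K\<close> T
  let ?d = "cayley_dist G S" and ?e = "cayley_dist K T"
  interpret GM: Metric_space "carrier G" ?d by (rule Metric_space_cayley_dist [OF GS])
  interpret KM: Metric_space "carrier K" ?e by (rule Metric_space_cayley_dist [OF KT])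
  define f where "f x = \<psi> (part x)" for x
  have fK: "f x \<in> carrier K" if "x \<in> carrier G" for x
    unfolding f_def using \<psi>K [OF partH [OF that]] .
  define P where "P = \<psi> ` ((\<lambda>(r, s, r'). r \<otimes>\<^bsub>G\<^esub> s \<otimes>\<^bsub>G\<^esub> inv\<^bsub>G\<^esub> r') ` (R \<times> S \<times> R) \<inter> H)"
  have P: "finite P" "P \<subseteq> carrier K"
  proof -
    have "finite S" using S by (simp add: finite_generating_set_def)
    then show "finite P" unfolding P_def using R by (intro finite_imageI finite_Int disjI1) auto
    show "P \<subseteq> carrier K" unfolding P_def using \<psi>K by blast
  qed
  obtain L where L: "\<And>k p. \<lbrakk>k \<in> carrier K; p \<in> P\<rbrakk> \<Longrightarrow> ?e k (k \<otimes>\<^bsub>K\<^esub> p) \<le> L"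
    using cayley_bounded_steps [OF KT P] by blast
  have step: "?e (f x) (f (x \<otimes>\<^bsub>G\<^esub> s)) \<le> L" if x: "x \<in> carrier G" and s: "s \<in> S" for x s
  proof -
    have sG: "s \<in> carrier G" using s SG by auto
    let ?y = "x \<otimes>\<^bsub>G\<^esub> s"
    have y: "?y \<in> carrier G" using x sG by simp
    define p where "p = inv\<^bsub>G\<^esub> part x \<otimes>\<^bsub>G\<^esub> part ?y"
    have pH: "p \<in> H" unfolding p_def using partH [OF x] partH [OF y] by simp
    have "p = rep x \<otimes>\<^bsub>G\<^esub> s \<otimes>\<^bsub>G\<^esub> inv\<^bsub>G\<^esub> rep ?y"
      unfolding p_def part_def using x sG repG [OF x] repG [OF y]
      by (simp add: G.inv_mult_group G.m_assoc) (simp add: G.m_assoc [symmetric])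
    then have "p \<in> (\<lambda>(r, s, r'). r \<otimes>\<^bsub>G\<^esub> s \<otimes>\<^bsub>G\<^esub> inv\<^bsub>G\<^esub> r') ` (R \<times> S \<times> R)"
      using x y s by (intro image_eqI [of _ _ "(rep x, s, rep ?y)"]) (auto simp: R_def)
    then have pP: "\<psi> p \<in> P" unfolding P_def using pH by blast
    have "\<theta> (f x \<otimes>\<^bsub>K\<^esub> \<psi> p) = part x \<otimes>\<^bsub>G\<^esub> p"
      using \<theta>M [OF fK [OF x] \<psi>K [OF pH]] by (simp add: f_def \<theta>\<psi> [OF pH] \<theta>\<psi> [OF partH [OF x]])
    also have "\<dots> = part ?y"
      unfolding p_def using partG [OF x] partG [OF y] by (simp add: G.m_assoc [symmetric])
    finally have "f ?y = \<psi> (\<theta> (f x \<otimes>\<^bsub>K\<^esub> \<psi> p))" by (simp add: f_def)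
    then have "f ?y = f x \<otimes>\<^bsub>K\<^esub> \<psi> p" using \<psi>\<theta> [OF K.m_closed [OF fK [OF x] \<psi>K [OF pH]]] by (simp only:)
    then show ?thesis using L [OF fK [OF x] pP] by simp
  qed
  have upper: "?e (f x) (f y) \<le> L * ?d x y" if "x \<in> carrier G" "y \<in> carrier G" for x y
  proof (rule cayley_lipschitz [OF GS KT _ _ that])
    show "f \<in> carrier G \<rightarrow> carrier K" using fK by blast
    fix x y assume xy: "cayley_adj G S x y"
    then obtain s where s: "x \<in> carrier G" "y \<in> carrier G" "s \<in> S" "y = x \<otimes>\<^bsub>G\<^esub> s \<or> x = y \<otimes>\<^bsub>G\<^esub> s"
      unfolding cayley_adj_def by blast
    then show "?e (f x) (f y) \<le> L" using step [of x s] step [of y s] KM.commute [of "f x" "f y"] by auto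
  qed
  have \<theta>_short: "?d (\<theta> k) (\<theta> l) \<le> 1 * ?e k l" if "k \<in> carrier K" "l \<in> carrier K" for k l
  proof (rule cayley_lipschitz [OF KT GS _ _ that])
    show "\<theta> \<in> carrier K \<rightarrow> carrier G" using \<theta>G by blast
    fix k l assume kl: "cayley_adj K T k l"
    then obtain t where t: "k \<in> carrier K" "l \<in> carrier K" "t \<in> T" "l = k \<otimes>\<^bsub>K\<^esub> t \<or> k = l \<otimes>\<^bsub>K\<^esub> t"
      unfolding cayley_adj_def by blast
    then have "\<theta> l = \<theta> k \<otimes>\<^bsub>G\<^esub> \<theta> t \<or> \<theta> k = \<theta> l \<otimes>\<^bsub>G\<^esub> \<theta> t" using T'(2) \<theta>M by blast
    then have "cayley_adj G S (\<theta> k) (\<theta> l)"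
      unfolding cayley_adj_def using t \<theta>G by (auto simp: S_def)
    then show "?d (\<theta> k) (\<theta> l) \<le> 1" by (rule cayley_dist_adj)
  qed
  have near: "?d (part x) x \<le> 1" if x: "x \<in> carrier G" for x
  proof -
    have "cayley_adj G S (part x) x"
      unfolding cayley_adj_def using x partG [OF x] split [OF x] by (auto simp: S_def R_def)
    then show ?thesis by (rule cayley_dist_adj)
  qed
  have lower: "?d x y \<le> ?e (f x) (f y) + 2" if x: "x \<in> carrier G" and y: "y \<in> carrier G" for x y
  proof -
    have "?d x y \<le> ?d x (part x) + ?d (part x) y" using x y partG by (intro GM.triangle)
    also have "?d (part x) y \<le> ?d (part x) (part y) + ?d (part y) y" using x y partG by (intro GM.triangle)
    also have "?d x (part x) = ?d (part x) x" by (rule GM.commute)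
    finally have "?d x y \<le> ?d (part x) (part y) + 2" using near [OF x] near [OF y] by linarith
    also have "?d (part x) (part y) \<le> ?e (f x) (f y)"
      using \<theta>_short [OF fK [OF x] fK [OF y]] by (simp add: f_def \<theta>\<psi> partH x y)
    finally show ?thesis by simp
  qed
  have onto: "\<exists>x\<in>carrier G. ?e (f x) z \<le> 2" if z: "z \<in> carrier K" for z
  proof -
    have r1: "rep \<one>\<^bsub>G\<^esub> \<in> H" using rep [OF G.one_closed] G.coset_mult_one [OF H.subset] by simp
    define x where "x = \<theta> z \<otimes>\<^bsub>G\<^esub> rep \<one>\<^bsub>G\<^esub>"
    have xH: "x \<in> H" unfolding x_def using \<theta>H [OF z] r1 by simp
    have "H #>\<^bsub>G\<^esub> x = H" by (rule G.coset_join2 [OF _ H(1) xH]) (use xH in simp)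
    then have "rep x = rep \<one>\<^bsub>G\<^esub>" unfolding rep_def using G.coset_mult_one [OF H.subset] by simp
    then have "part x = \<theta> z" unfolding part_def x_def using \<theta>G [OF z] r1 by (simp add: G.m_assoc)
    then have "f x = z" using \<psi>\<theta> [OF z] by (simp add: f_def)
    moreover have "?e z z = 0" using z by simp
    ultimately show ?thesis using xH by (intro bexI [of _ x]) auto
  qed
  have "quasi_isometric (carrier G) ?d (carrier K) ?e"
    unfolding quasi_isometric_def
  proof (rule bexI [of _ f], rule exI [of _ "max 1 L"], rule conjI, simp, rule exI [of _ 2],
      intro conjI ballI)
    show "f \<in> carrier G \<rightarrow> carrier K" using fK by blast
    fix x y assume x: "x \<in> carrier G" and y: "y \<in> carrier G"
    have "?d x y / max 1 L \<le> ?d x y / 1" using GM.nonneg [of x y] by (intro divide_left_mono) auto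
    then show "?d x y / max 1 L - 2 \<le> ?e (f x) (f y)" using lower [OF x y] by simp
    have "L * ?d x y \<le> max 1 L * ?d x y" by (intro mult_right_mono) auto
    then show "?e (f x) (f y) \<le> max 1 L * ?d x y + 2" using upper [OF x y] by simp
  qed (use onto in auto)
  then show ?thesis unfolding quasi_isometric_groups_def using S T by blast
qed

section \<open>Groups that are virtually a product\<close>

context free_by_int
begin

lemma generate_steps: "generate G steps = carrier G"
proof
  show "generate G steps \<subseteq> carrier G" by (rule G.generate_incl [OF steps_G])
  have sub: "subgroup (generate G steps) G" by (rule G.generate_is_subgroup [OF steps_G])
  have hor: "(u, 0) \<in> generate G steps" if "u \<in> carrier F" for u
    using that
  proof (induction u)
    case Nil
    show ?case using generate.one [of G steps] by (simp add: one_G)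
  next
    case (Cons l u)
    note lu = Cons_F [OF Cons.prems]
    have "([l], 0) \<cdot> (u, 0) \<in> generate G steps"
      by (rule generate.eng [OF generate.incl [OF steps_mem(2) [OF lu(1)]] Cons.IH [OF lu(2)]])
    then show ?case using lu by (simp add: \<phi>_0)
  qed
  have ver: "([], k) \<in> generate G steps" for k :: int
  proof (induction k rule: int_induct [where k = 0])
    case base
    show ?case using generate.one [of G steps] by (simp add: one_G)
  next
    case (step1 i)
    have "([], i) \<cdot> ([], 1) \<in> generate G steps"
      by (rule generate.eng [OF step1(2) generate.incl [OF steps_mem(1)]])
    then show ?case by (simp add: \<phi>_Nil)
  next
    case (step2 i)
    have "([], i) \<cdot> inv\<^bsub>G\<^esub> ([], 1) \<in> generate G steps"
      by (rule generate.eng [OF step2(2) generate.inv [OF steps_mem(1)]])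
    moreover have "inv\<^bsub>F\<^esub> [] = []" using F.inv_one by simp
    ultimately show ?case by (simp add: inv_G \<phi>_Nil)
  qed
  show "carrier G \<subseteq> generate G steps"
  proof
    fix x assume "x \<in> carrier G"
    then obtain u k where x: "x = (u, k)" "u \<in> carrier F" by (cases x) simp
    have "(u, 0) \<cdot> ([], k) \<in> generate G steps" by (rule generate.eng [OF hor [OF x(2)] ver])
    then show "x \<in> generate G steps" using x by (simp add: \<phi>_Nil)
  qed
qed

lemma finite_generating_steps: "finite_generating_set G steps"
  by (simp add: finite_generating_set_def finite_steps steps_G generate_steps)

text \<open>
  If \<open>\<phi> m\<close> is inner, then some element \<open>(w, m)\<close> centralises \<open>F\<close>, and together with \<open>F\<close> it
  generates a copy of \<open>F \<times> \<int>\<close>, which consists of all elements whose height is divisible by \<open>m\<close>.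
\<close>
lemma inner_power_imp_virtually_product:
  assumes m: "m \<noteq> 0" and w: "w \<in> carrier F"
    and comm: "\<And>u. u \<in> carrier F \<Longrightarrow> w \<otimes>\<^bsub>F\<^esub> \<phi> m u = u \<otimes>\<^bsub>F\<^esub> w"
  shows "virtually G (F \<times>\<times> integer_group)"
proof -
  define c where "c = (w, m)"
  have c: "c \<in> carrier G" using w by (simp add: c_def)
  define H where "H = carrier F \<times> {k. m dvd k}"
  have mem: "(u, k) \<in> H \<longleftrightarrow> u \<in> carrier F \<and> m dvd k" for u k by (simp add: H_def)
  have HG: "H \<subseteq> carrier G" by (auto simp: H_def)
  have H: "subgroup H G"
  proof (rule G.subgroupI [OF HG])
    show "H \<noteq> {}" using mem [of "[]" 0] by auto
    fix x y assume "x \<in> H" "y \<in> H"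
    then show "x \<cdot> y \<in> H" by (cases x; cases y) (simp add: mem \<phi>_closed)
  next
    fix x assume "x \<in> H"
    then show "inv\<^bsub>G\<^esub> x \<in> H" by (cases x) (simp add: mem inv_G \<phi>_closed)
  qed
  have "rcosets\<^bsub>G\<^esub> H \<subseteq> (\<lambda>i. H #>\<^bsub>G\<^esub> ([], i)) ` {0..<\<bar>m\<bar>}"
  proof
    fix C assume "C \<in> rcosets\<^bsub>G\<^esub> H"
    then obtain x where x: "x \<in> carrier G" "C = H #>\<^bsub>G\<^esub> x" by (auto simp: RCOSETS_def)
    obtain u k where uk: "x = (u, k)" by (cases x)
    define i where "i = k mod \<bar>m\<bar>"
    have i: "i \<in> {0..<\<bar>m\<bar>}" using m by (simp add: i_def)
    have "([], i) \<cdot> inv\<^bsub>G\<^esub> x \<in> H"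
    proof -
      have "m dvd i - k" unfolding i_def using mod_eq_dvd_iff [of "k mod \<bar>m\<bar>" "\<bar>m\<bar>" k] by simp
      then show ?thesis using x(1) unfolding uk by (simp add: inv_G mem \<phi>_closed)
    qed
    moreover have "([], i) = ([], i) \<cdot> inv\<^bsub>G\<^esub> x \<cdot> x"
      using x(1) by (simp add: G.m_assoc del: mult_G)
    ultimately have "([], i) \<in> H #>\<^bsub>G\<^esub> x" unfolding r_coset_def by blast
    then have "C = H #>\<^bsub>G\<^esub> ([], i)" unfolding x(2) using G.repr_independence [OF _ x(1) H] by blast
    then show "C \<in> (\<lambda>i. H #>\<^bsub>G\<^esub> ([], i)) ` {0..<\<bar>m\<bar>}" using i by blast
  qed
  then have fin: "finite (rcosets\<^bsub>G\<^esub> H)" by (rule finite_subset) simp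
  have pow_snd: "snd (c [^]\<^bsub>G\<^esub> (j::int)) = m * j" for j
  proof -
    have snd_hom: "snd \<in> hom G integer_group"
      by (auto simp: hom_def semidirect_product_def)
    interpret s: group_hom G integer_group snd
      by (intro group_hom.intro group_hom_axioms.intro G.is_group group_integer_group snd_hom)
    show ?thesis using s.hom_int_pow [OF c, of j] by (simp add: c_def mult.commute)
  qed
  have pow_comm: "c [^]\<^bsub>G\<^esub> (j::int) \<cdot> (v, 0) = (v, 0) \<cdot> c [^]\<^bsub>G\<^esub> j" if v: "v \<in> carrier F" for j v
  proof -
    have vG: "(v, 0) \<in> carrier G" using v by simp
    have cv: "c \<cdot> (v, 0) = (v, 0) \<cdot> c"
      using comm [OF v] v w by (simp add: c_def \<phi>_0)
    have "(v, 0) \<cdot> c \<cdot> inv\<^bsub>G\<^esub> (v, 0) = c"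
      unfolding cv [symmetric] using c vG by (simp add: G.m_assoc del: mult_G mem_G)
    moreover have conj: "(\<lambda>z. (v, 0) \<cdot> z \<cdot> inv\<^bsub>G\<^esub> (v, 0)) \<in> hom G G"
    proof (rule homI)
      fix x y assume xy: "x \<in> carrier G" "y \<in> carrier G"
      have "inv\<^bsub>G\<^esub> (v, 0) \<cdot> ((v, 0) \<cdot> (y \<cdot> inv\<^bsub>G\<^esub> (v, 0))) = y \<cdot> inv\<^bsub>G\<^esub> (v, 0)"
        using xy vG by (simp add: G.m_assoc [symmetric] del: mult_G mem_G)
      then show "(v, 0) \<cdot> (x \<cdot> y) \<cdot> inv\<^bsub>G\<^esub> (v, 0) =
          (v, 0) \<cdot> x \<cdot> inv\<^bsub>G\<^esub> (v, 0) \<cdot> ((v, 0) \<cdot> y \<cdot> inv\<^bsub>G\<^esub> (v, 0))"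
        using xy vG by (simp add: G.m_assoc del: mult_G mem_G)
    qed (use vG in \<open>simp del: mult_G mem_G\<close>)
    interpret k: group_hom G G "\<lambda>z. (v, 0) \<cdot> z \<cdot> inv\<^bsub>G\<^esub> (v, 0)"
      by unfold_locales (rule conj)
    have "(v, 0) \<cdot> c [^]\<^bsub>G\<^esub> j \<cdot> inv\<^bsub>G\<^esub> (v, 0) = c [^]\<^bsub>G\<^esub> j"
      using k.hom_int_pow [OF c, of j] calculation by simp
    then have "(v, 0) \<cdot> c [^]\<^bsub>G\<^esub> j \<cdot> inv\<^bsub>G\<^esub> (v, 0) \<cdot> (v, 0) = c [^]\<^bsub>G\<^esub> j \<cdot> (v, 0)"
      by (simp only:)
    then show ?thesis using c vG by (simp add: G.m_assoc del: mult_G mem_G)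
  qed
  define \<Theta> where "\<Theta> = (\<lambda>(u, j). (u, 0) \<cdot> c [^]\<^bsub>G\<^esub> (j::int))"
  have powG: "c [^]\<^bsub>G\<^esub> (j::int) \<in> carrier G" for j using c by (rule G.int_pow_closed)
  have snd\<Theta>: "snd (\<Theta> (u, j)) = m * j" if "u \<in> carrier F" for u j
  proof -
    obtain a k where ak: "c [^]\<^bsub>G\<^esub> j = (a, k)" by (cases "c [^]\<^bsub>G\<^esub> j")
    then show ?thesis using pow_snd [of j] by (simp add: \<Theta>_def)
  qed
  have \<Theta>G: "\<Theta> (u, j) \<in> carrier G" if "u \<in> carrier F" for u j
    using that powG [of j] unfolding \<Theta>_def prod.case by (intro G.m_closed) simp_all
  have \<Theta>H: "\<Theta> (u, j) \<in> H" if u: "u \<in> carrier F" for u j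
    using \<Theta>G [OF u, of j] snd\<Theta> [OF u, of j] by (cases "\<Theta> (u, j)") (simp add: mem)
  have "\<Theta> \<in> iso (F \<times>\<times> integer_group) (G\<lparr>carrier := H\<rparr>)"
  proof (rule isoI)
    show "\<Theta> \<in> hom (F \<times>\<times> integer_group) (G\<lparr>carrier := H\<rparr>)"
    proof (rule homI)
      fix x assume "x \<in> carrier (F \<times>\<times> integer_group)"
      then show "\<Theta> x \<in> carrier (G\<lparr>carrier := H\<rparr>)" by (cases x) (simp add: \<Theta>H)
    next
      fix x y assume x: "x \<in> carrier (F \<times>\<times> integer_group)" and y: "y \<in> carrier (F \<times>\<times> integer_group)"
      obtain u i v j where xy: "x = (u, i)" "y = (v, j)" by (cases x; cases y)
      have u: "u \<in> carrier F" and v: "v \<in> carrier F" using x y unfolding xy by simp_all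
      have uv: "(u, 0) \<in> carrier G" "(v, 0) \<in> carrier G" using u v by simp_all
      have "\<Theta> (x \<otimes>\<^bsub>F \<times>\<times> integer_group\<^esub> y) = (u \<otimes>\<^bsub>F\<^esub> v, 0) \<cdot> c [^]\<^bsub>G\<^esub> (i + j)"
        unfolding xy \<Theta>_def by simp
      also have "(u \<otimes>\<^bsub>F\<^esub> v, 0) = (u, 0) \<cdot> (v, 0)" using v by (simp add: \<phi>_0)
      also have "c [^]\<^bsub>G\<^esub> (i + j) = c [^]\<^bsub>G\<^esub> i \<cdot> c [^]\<^bsub>G\<^esub> j" using c by (simp add: G.int_pow_mult)
      also have "(u, 0) \<cdot> (v, 0) \<cdot> (c [^]\<^bsub>G\<^esub> i \<cdot> c [^]\<^bsub>G\<^esub> j) =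
          (u, 0) \<cdot> ((v, 0) \<cdot> c [^]\<^bsub>G\<^esub> i) \<cdot> c [^]\<^bsub>G\<^esub> j"
        using uv powG by (simp add: G.m_assoc del: mult_G mem_G)
      also have "\<dots> = (u, 0) \<cdot> c [^]\<^bsub>G\<^esub> i \<cdot> ((v, 0) \<cdot> c [^]\<^bsub>G\<^esub> j)"
        unfolding pow_comm [OF v, of i, symmetric] using uv powG by (simp add: G.m_assoc del: mult_G mem_G)
      finally show "\<Theta> (x \<otimes>\<^bsub>F \<times>\<times> integer_group\<^esub> y) = \<Theta> x \<otimes>\<^bsub>G\<lparr>carrier := H\<rparr>\<^esub> \<Theta> y"
        by (simp add: xy \<Theta>_def del: mult_G)
    qed
    show "bij_betw \<Theta> (carrier (F \<times>\<times> integer_group)) (carrier (G\<lparr>carrier := H\<rparr>))"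
    proof (rule bij_betwI')
      fix x y assume x: "x \<in> carrier (F \<times>\<times> integer_group)" and y: "y \<in> carrier (F \<times>\<times> integer_group)"
      obtain u i v j where xy: "x = (u, i)" "y = (v, j)" by (cases x; cases y)
      have u: "u \<in> carrier F" and v: "v \<in> carrier F" using x y unfolding xy by simp_all
      have "x = y" if eq: "\<Theta> x = \<Theta> y"
      proof -
        have ij: "i = j" using snd\<Theta> [OF u, of i] snd\<Theta> [OF v, of j] eq m unfolding xy by simp
        have "(u, 0) \<cdot> c [^]\<^bsub>G\<^esub> j = (v, 0) \<cdot> c [^]\<^bsub>G\<^esub> j"
          using eq unfolding xy ij \<Theta>_def prod.case .
        then have "(u, 0) = ((v, 0) :: 'a point)"
          using G.right_cancel [of "c [^]\<^bsub>G\<^esub> j" "(u, 0)" "(v, 0)"] u v powG by simp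
        then show ?thesis using xy ij by simp
      qed
      then show "(\<Theta> x = \<Theta> y) = (x = y)" by blast
    next
      fix x assume "x \<in> carrier (F \<times>\<times> integer_group)"
      then show "\<Theta> x \<in> carrier (G\<lparr>carrier := H\<rparr>)" by (cases x) (simp add: \<Theta>H)
    next
      fix y assume "y \<in> carrier (G\<lparr>carrier := H\<rparr>)"
      then obtain v j where y: "y = (v, m * j)" "v \<in> carrier F" by (cases y) (auto simp: mem elim: dvdE)
      have yG: "y \<in> carrier G" using y by simp
      define z where "z = y \<cdot> inv\<^bsub>G\<^esub> (c [^]\<^bsub>G\<^esub> j)"
      have zG: "z \<in> carrier G" unfolding z_def using yG powG by (simp del: mult_G mem_G)
      obtain a where a: "a \<in> carrier F" "c [^]\<^bsub>G\<^esub> j = (a, m * j)"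
        using powG [of j] pow_snd [of j] by (cases "c [^]\<^bsub>G\<^esub> j") simp
      have "snd z = 0" unfolding z_def y(1) a(2) using a(1) by (simp add: inv_G)
      then obtain u where u: "z = (u, 0)" "u \<in> carrier F" using zG by (cases z) simp
      have "\<Theta> (u, j) = y"
        unfolding \<Theta>_def prod.case u(1) [symmetric] z_def using yG powG [of j]
        by (simp add: G.m_assoc del: mult_G mem_G)
      moreover have "(u, j) \<in> carrier (F \<times>\<times> integer_group)" using u by simp
      ultimately show "\<exists>x\<in>carrier (F \<times>\<times> integer_group). y = \<Theta> x" by metis
    qed
  qed
  then have "F \<times>\<times> integer_group \<cong> G\<lparr>carrier := H\<rparr>" by (rule is_isoI)
  then have "G\<lparr>carrier := H\<rparr> \<cong> F \<times>\<times> integer_group"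
    by (rule group.iso_sym [OF DirProd_group [OF F.is_group group_integer_group]])
  then show ?thesis unfolding virtually_def using H fin by blast
qed

text \<open>
  In rank one every word is a power of a letter, so \<open>\<phi> 1\<close> multiplies lengths by a constant, which
  is one because \<open>\<phi> 1\<close> is onto. Hence \<open>\<phi> 1\<close> fixes or inverts the generator.
\<close>
lemma rank_one_square_trivial:
  assumes X: "X = {x}" and u: "u \<in> carrier F"
  shows "\<phi> 2 u = u"
proof -
  have repl: "\<exists>l k. fst l = x \<and> v = replicate k l" if "v \<in> carrier F" for v
    using that
  proof (induction v)
    case Nil
    show ?case by (rule exI [of _ "(x, True)"]) simp
  next
    case (Cons l v)
    note lv = Cons_F [OF Cons.prems]
    then obtain l' k where v: "fst l' = x" "v = replicate k l'" using Cons.IH by blast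
    have l: "fst l = x" using lv(1) X by simp
    show ?case
    proof (cases k)
      case 0
      then show ?thesis using v l by (intro exI [of _ l] exI [of _ 1]) simp
    next
      case (Suc k')
      then have "l' \<noteq> inv_letter l"
        using Cons.prems v by (simp add: carrier_free_group_iff reduced_Cons)
      then have "l' = l" using v(1) l by (cases l; cases l') (auto simp: inv_letter_def)
      then show ?thesis using v l by (intro exI [of _ l] exI [of _ "Suc k"]) simp
    qed
  qed
  have pw: "\<phi> j (replicate k l) = replicate (k * p) l'"
    if l: "fst l = x" "fst l' = x" "\<phi> j [l] = replicate p l'" for j k p l l'
  proof (induction k)
    case 0
    show ?case by (simp add: \<phi>_Nil)
  next
    case (Suc k)
    have C: "replicate n r \<in> carrier F" if "fst r = x" for n r using that X by (simp add: replicate_free_group)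
    have "replicate (Suc k) l = [l] \<otimes>\<^bsub>F\<^esub> replicate k l"
      using free_group_append [of "[l]" "replicate k l" X] C [of l "Suc k"] l by simp
    then have "\<phi> j (replicate (Suc k) l) = replicate p l' \<otimes>\<^bsub>F\<^esub> replicate (k * p) l'"
      using Suc \<phi>_mult [of "[l]" "replicate k l" j] C [of l 1] C [of l k] l by simp
    also have "\<dots> = replicate (Suc k * p) l'"
      using free_group_append [of "replicate p l'" "replicate (k * p) l'" X] C [of l' "p + k * p"] l
      by (simp add: replicate_add)
    finally show ?case .
  qed
  have one: "\<phi> 1 [l] = [l] \<or> \<phi> 1 [l] = [inv_letter l]" if l: "fst l = x" for l
  proof -
    have lF: "[l] \<in> carrier F" using l X by simp
    obtain l' p where p: "fst l' = x" "\<phi> (- 1) [l] = replicate p l'" using repl [OF \<phi>_closed [OF lF]] by blast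
    have l'F: "[l'] \<in> carrier F" using p X by simp
    obtain r q where q: "fst r = x" "\<phi> 1 [l'] = replicate q r" using repl [OF \<phi>_closed [OF l'F]] by blast
    have "[l] = \<phi> 1 (\<phi> (- 1) [l])" using \<phi>_minus(1) [OF lF, of 1] by simp
    also have "\<dots> = replicate (p * q) r" unfolding p(2) by (rule pw [OF p(1) q(1,2)])
    finally have "p * q = 1" by (metis length_replicate length_Cons list.size(3) One_nat_def)
    then have pq: "p = 1" "q = 1" by simp_all
    have inv1: "\<phi> 1 [inv_letter k] = map inv_letter (rev (\<phi> 1 [k]))" if "fst k = x" for k
    proof -
      have kF: "[k] \<in> carrier F" using that X by simp
      have "inv\<^bsub>F\<^esub> [k] = [inv_letter k]" using kF by (simp add: inv_free_group)
      then show ?thesis using \<phi>_inv [OF kF, of 1] inv_free_group [OF \<phi>_closed [OF kF, of 1]] by simp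
    qed
    have len: "length (\<phi> 1 [l]) = 1"
    proof (cases "l = l'")
      case True
      then show ?thesis using q pq by simp
    next
      case False
      then have "l = inv_letter l'" using l p(1) by (cases l; cases l') (auto simp: inv_letter_def)
      then show ?thesis using inv1 [OF p(1)] q pq by simp
    qed
    then obtain k where k: "\<phi> 1 [l] = [k]" by (cases "\<phi> 1 [l]") auto
    have "fst k = x" using \<phi>_closed [OF lF, of 1] X unfolding k by simp
    then show ?thesis using k l by (cases l; cases k) (auto simp: inv_letter_def)
  qed
  have two: "\<phi> 2 [l] = [l]" if l: "fst l = x" for l
  proof -
    have lF: "[l] \<in> carrier F" using l X by simp
    have "\<phi> 2 [l] = \<phi> 1 (\<phi> 1 [l])" using \<phi>_add [OF lF, of 1 1] by simp
    moreover have "\<phi> 1 [inv_letter l] = inv\<^bsub>F\<^esub> \<phi> 1 [l]"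
      using \<phi>_inv [OF lF, of 1] lF by (simp add: inv_free_group)
    ultimately show ?thesis using one [OF l] lF by (auto simp: inv_free_group)
  qed
  obtain l k where lk: "fst l = x" "u = replicate k l" using repl [OF u] by blast
  show ?thesis using pw [OF lk(1) lk(1), of 2 1 k] two [OF lk(1)] lk(2) by simp
qed

end

lemma free_by_int_of_hom:
  assumes "finite X" and \<phi>: "\<phi> \<in> hom integer_group (AutoGroup (free_group X))"
  shows "free_by_int X \<phi>"
proof
  interpret F: group "free_group X" by (rule group_free_group)
  interpret \<phi>: group_hom integer_group "AutoGroup (free_group X)" \<phi>
    using \<phi> F.AutoGroup by (simp add: group_hom_def group_hom_axioms_def)
  have aut: "\<phi> k \<in> auto (free_group X)" for k
    using \<phi>.hom_closed [of k] by (simp add: AutoGroup_def)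
  show "finite X" by fact
  fix a b k l assume a: "a \<in> carrier (free_group X)"
  show "\<phi> k a \<in> carrier (free_group X)" using aut [of k] a by (auto simp: auto_def hom_def)
  show "\<phi> (k + l) a = \<phi> k (\<phi> l a)"
    using a \<phi>.hom_mult [of k l] aut [of k] aut [of l]
    by (auto simp: AutoGroup_def BijGroup_def auto_def compose_def)
  show "\<phi> 0 a = a" using a \<phi>.hom_one by (simp add: AutoGroup_def BijGroup_def)
  assume b: "b \<in> carrier (free_group X)"
  show "\<phi> k (a \<otimes>\<^bsub>free_group X\<^esub> b) = \<phi> k a \<otimes>\<^bsub>free_group X\<^esub> \<phi> k b"
    using aut [of k] a b by (auto simp: auto_def hom_def)
qed

lemma semidirect_product_trivial: "semidirect_product N H (\<lambda>_ x. x) = N \<times>\<times> H"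
  by (simp add: semidirect_product_def DirProd_def)

theorem corollary9p1:
  fixes n :: nat and \<phi> :: "int \<Rightarrow> (nat \<times> bool) list \<Rightarrow> (nat \<times> bool) list"
  assumes "n \<ge> 1"
    and "\<phi> \<in> hom integer_group (AutoGroup (free_group {..<n}))"
  shows "quasi_isometric_groups
           (semidirect_product (free_group {..<n}) integer_group \<phi>)
           (free_group {..<n} \<times>\<times> integer_group)
         \<longleftrightarrow>
         virtually
           (semidirect_product (free_group {..<n}) integer_group \<phi>)
           (free_group {..<n} \<times>\<times> integer_group)"
proof -
  interpret X: free_by_int "{..<n}" \<phi> by (rule free_by_int_of_hom [OF _ assms(2)]) simp
  interpret Y: free_times_int "{..<n}" by unfold_locales simp
  have Y: "Y.G = X.F \<times>\<times> integer_group" by (rule semidirect_product_trivial)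
  show ?thesis
  proof
    assume "virtually X.G (X.F \<times>\<times> integer_group)"
    then show "quasi_isometric_groups X.G (X.F \<times>\<times> integer_group)"
      using Y.finite_generating_steps Y.G.is_group X.G.is_group unfolding Y
      by (intro virtually_imp_quasi_isometric_groups)
  next
    assume "quasi_isometric_groups X.G (X.F \<times>\<times> integer_group)"
    then obtain S T where ST: "finite_generating_set X.G S" "finite_generating_set Y.G T"
        "quasi_isometric (carrier X.G) (cayley_dist X.G S) (carrier Y.G) (cayley_dist Y.G T)"
      unfolding quasi_isometric_groups_def Y by blast
    have "\<exists>m w. m \<noteq> 0 \<and> w \<in> carrier X.F \<and> (\<forall>u\<in>carrier X.F. w \<otimes>\<^bsub>X.F\<^esub> \<phi> m u = u \<otimes>\<^bsub>X.F\<^esub> w)"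
    proof (cases "n = 1")
      case True
      then have "{..<n} = {0}" by auto
      then have "\<phi> 2 u = u" if "u \<in> carrier X.F" for u using X.rank_one_square_trivial that by blast
      then show ?thesis by (intro exI [of _ 2] exI [of _ "[]"]) simp
    next
      case False
      obtain f g where "coarse_map X.G Y.G f" "coarse_map Y.G X.G g"
          "close_to_id X.G (\<lambda>x. g (f x))" "close_to_id Y.G (\<lambda>y. f (g y))"
        using quasi_isometric_imp_coarse [OF X.G.is_group ST(1) Y.G.is_group ST(2,3)] by blast
      then interpret coarse_pair "{..<n}" \<phi> f g by unfold_locales
      show ?thesis by (rule power_is_inner [of 0 1]) (use False assms(1) in auto)
    qed
    then show "virtually X.G (X.F \<times>\<times> integer_group)"
      using X.inner_power_imp_virtually_product by blast
  qed
qed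
end
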